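(* Let $q_1=2^{a_1}$ and $q_2=p_2^{a_2}$ be distinct prime powers with $|\sqrt{q_1}-\sqrt{q_2}|\le 1$. Suppose $\mathcal{E}_1$ is supersingular, and let $t_1=q_1+1-q_2$. Then precisely one of the following holds: (1) $t_1=\pm 2^{(a_1+2)/2}$ and $(q_1,q_2)$ is either $(2^6,3^4)$, or $\big(2^{2^{n+1}},(2^{2^n}+1)^2\big)$ with $p_2=2^{2^n}+1$ a Fermat prime, or $\big(2^{2m},(2^m-1)^2\big)$ with $p_2=2^m-1$ a Mersenne prime; (2) $t_1=2$ and $(q_1,q_2)=(2^2,3)$; (3) $t_1=0$; or $a_1$ is odd and $t_1=\pm 2^{(a_1+1)/2}$; or $a_1$ is even, $t_1=\pm 2^{a_1/2}$ and $p_2\neq 3$. Moreover, in cases (1) and (2) the set $\mathcal{E}_2$ is supersingular, while in case (3) the set $\mathcal{E}_2$ is ordinary.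
   Context: For distinct prime powers $q_1,q_2$ and $(i,j)\in\{(1,2),(2,1)\}$, $\mathcal{E}_i$ denotes the set of $\mathbb{F}_{q_i}$-isomorphism classes of elliptic curves $E/\mathbb{F}_{q_i}$ with $|E(\mathbb{F}_{q_i})|=q_j$. A set $\mathcal{E}_i$ is called ordinary (resp. supersingular) if it is non-empty and all its curves are ordinary (resp. supersingular). *)

theory Defs
  imports Complex_Main "HOL-Library.Cardinality" "HOL-Algebra.Algebraic_Closure_Type"
begin

text \<open>
  \<open>Weierstrass a\<^sub>1 a\<^sub>2 a\<^sub>3 a\<^sub>4 a\<^sub>6\<close> is the projective curve with affine equation
  \<open>y\<^sup>2 + a\<^sub>1 x y + a\<^sub>3 y = x\<^sup>3 + a\<^sub>2 x\<^sup>2 + a\<^sub>4 x + a\<^sub>6\<close>. The generalized equation is needed because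
  characteristics 2 and 3 occur.
\<close>

datatype 'a weierstrass =
  Weierstrass (wc1: 'a) (wc2: 'a) (wc3: 'a) (wc4: 'a) (wc6: 'a)

text \<open>A Weierstrass cubic has exactly one point on the line at infinity.\<close>

datatype 'a point = Infinity | Affine 'a 'a

primrec on_curve :: "'a :: field weierstrass \<Rightarrow> 'a point \<Rightarrow> bool" where
  "on_curve W Infinity \<longleftrightarrow> True"
| "on_curve W (Affine x y) \<longleftrightarrow>
     y ^ 2 + wc1 W * x * y + wc3 W * y = x ^ 3 + wc2 W * x ^ 2 + wc4 W * x + wc6 W"

definition rational_points :: "'a :: field weierstrass \<Rightarrow> 'a point set" where
  "rational_points W = {P. on_curve W P}"

definition discriminant :: "'a :: field weierstrass \<Rightarrow> 'a" where
  "discriminant W =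
     (let b2 = wc1 W ^ 2 + 4 * wc2 W;
          b4 = 2 * wc4 W + wc1 W * wc3 W;
          b6 = wc3 W ^ 2 + 4 * wc6 W;
          b8 = wc1 W ^ 2 * wc6 W + 4 * wc2 W * wc6 W - wc1 W * wc3 W * wc4 W
               + wc2 W * wc3 W ^ 2 - wc4 W ^ 2
      in - (b2 ^ 2 * b8) - 8 * b4 ^ 3 - 27 * b6 ^ 2 + 9 * b2 * b4 * b6)"

definition elliptic_curve :: "'a :: field weierstrass \<Rightarrow> bool" where
  "elliptic_curve W \<longleftrightarrow> discriminant W \<noteq> 0"

text \<open>
  The isomorphisms over the base field between Weierstrass curves (fixing the point at infinity)
  are the substitutions \<open>x = u\<^sup>2 x' + r\<close>, \<open>y = u\<^sup>3 y' + u\<^sup>2 s x' + t\<close> with \<open>u \<noteq> 0\<close>; the equations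
  below say that this substitution turns \<open>W\<close> into \<open>W'\<close>.
\<close>

definition curve_iso :: "'a :: field weierstrass rel" where
  "curve_iso = {(W, W'). elliptic_curve W \<and> elliptic_curve W' \<and>
     (\<exists>u r s t. u \<noteq> 0 \<and>
        u * wc1 W' = wc1 W + 2 * s \<and>
        u ^ 2 * wc2 W' = wc2 W - s * wc1 W + 3 * r - s ^ 2 \<and>
        u ^ 3 * wc3 W' = wc3 W + r * wc1 W + 2 * t \<and>
        u ^ 4 * wc4 W' = wc4 W - s * wc3 W + 2 * r * wc2 W - (t + r * s) * wc1 W
                         + 3 * r ^ 2 - 2 * s * t \<and>
        u ^ 6 * wc6 W' = wc6 W + r * wc4 W + r ^ 2 * wc2 W + r ^ 3 - t * wc3 W - t ^ 2
                         - r * t * wc1 W)}"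

text \<open>
  The chord-and-tangent law. In the branch of equal abscissae the two points are not inverse to
  each other, so on the curve they coincide and \<open>l\<close> is the slope of the tangent.
\<close>

fun add_point :: "'a :: field weierstrass \<Rightarrow> 'a point \<Rightarrow> 'a point \<Rightarrow> 'a point" where
  "add_point W Infinity Q = Q"
| "add_point W P Infinity = P"
| "add_point W (Affine x1 y1) (Affine x2 y2) =
     (if x1 = x2 \<and> y1 + y2 + wc1 W * x2 + wc3 W = 0 then Infinity
      else
        (let l = (if x1 = x2
                  then (3 * x1 ^ 2 + 2 * wc2 W * x1 + wc4 W - wc1 W * y1)
                         / (2 * y1 + wc1 W * x1 + wc3 W)
                  else (y2 - y1) / (x2 - x1));
             x3 = l ^ 2 + wc1 W * l - wc2 W - x1 - x2
         in Affine x3 (- (l * (x3 - x1) + y1) - wc1 W * x3 - wc3 W)))"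

definition mult_point :: "'a :: field weierstrass \<Rightarrow> nat \<Rightarrow> 'a point \<Rightarrow> 'a point" where
  "mult_point W n P = (add_point W P ^^ n) Infinity"

text \<open>\<open>E\<close> is supersingular iff \<open>E[p]\<close> is trivial over the algebraic closure, \<open>p\<close> the characteristic.\<close>

definition base_change :: "'a :: field weierstrass \<Rightarrow> 'a alg_closure weierstrass" where
  "base_change W = map_weierstrass to_ac W"

definition supersingular :: "'a :: field_prime_char weierstrass \<Rightarrow> bool" where
  "supersingular W \<longleftrightarrow>
     {P \<in> rational_points (base_change W). mult_point (base_change W) CHAR('a) P = Infinity}
       = {Infinity}"

definition ordinary :: "'a :: field_prime_char weierstrass \<Rightarrow> bool" where
  "ordinary W \<longleftrightarrow> \<not> supersingular W"

text \<open>
  For a field \<open>'a\<close> having \<open>q\<^sub>i\<close> elements, \<open>curve_classes q\<^sub>j\<close> is the set \<open>\<E>\<^sub>i\<close>.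
\<close>

definition curve_classes :: "nat \<Rightarrow> 'a :: finite_field weierstrass set set" where
  "curve_classes n =
     {W. elliptic_curve W \<and> card (rational_points W) = n} // curve_iso"

definition supersingular_classes :: "'a :: finite_field weierstrass set set \<Rightarrow> bool" where
  "supersingular_classes \<E> \<longleftrightarrow> \<E> \<noteq> {} \<and> (\<forall>C\<in>\<E>. \<forall>W\<in>C. supersingular W)"

definition ordinary_classes :: "'a :: finite_field weierstrass set set \<Rightarrow> bool" where
  "ordinary_classes \<E> \<longleftrightarrow> \<E> \<noteq> {} \<and> (\<forall>C\<in>\<E>. \<forall>W\<in>C. ordinary W)"

end

theory Submission
  imports Defs "HOL-Library.Product_Plus" "HOL-Algebra.Sylow" "HOL-Number_Theory.Residues"
begin

text \<open>
  A supersingular curve in characteristic two has the form \<open>y\<^sup>2 + b y = f x\<close>, and its trace \<open>t\<close> is an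
  additive character sum with \<open>t\<^sup>2 = q\<^sub>1 M\<close>, where \<open>M\<close> is a character sum over the at most four roots
  of \<open>r\<^sup>4 + b r\<close>. As \<open>q\<^sub>1\<close> is a power of two, \<open>M \<in> {0, 1, 2, 4}\<close>, which fixes \<open>\<bar>t\<bar>\<close>. If \<open>M = 4\<close> then
  \<open>q\<^sub>2 = q\<^sub>1 + 1 - t\<close> is the square of a neighbour of a power of two, which leads to Fermat and Mersenne
  primes and to \<open>3\<^sup>4\<close>.

  In odd characteristic \<open>p\<close> the curve \<open>E\<close> is supersingular iff \<open>p\<close> divides \<open>|E| - 1\<close>: over the
  extension of degree \<open>n\<close> the number of points is, modulo \<open>p\<close>, one minus the product of the first \<open>n\<close>
  conjugates of the Hasse invariant, and these numbers detect \<open>p\<close>-torsion by the theorems of Lagrange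
  and Cauchy. This needs the addition to be associative, which follows by mapping points to ideal
  classes of the coordinate ring.

  Curves with \<open>q\<^sub>1\<close> points over the second field are found among the twists \<open>y\<^sup>2 = x\<^sup>3 - k x\<close> and
  \<open>y\<^sup>2 = x\<^sup>3 + k\<close>. The second moment of the traces over \<open>k\<close> shows that they come from a representation
  of \<open>q\<^sub>2\<close> as \<open>u\<^sup>2 + v\<^sup>2\<close> resp. of \<open>4 q\<^sub>2\<close> as \<open>s\<^sup>2 + 3 u\<^sup>2\<close>. A representation prime to \<open>p\<^sub>2\<close> is unique up
  to units, and \<open>q\<^sub>2 = q\<^sub>1 + 1 - t\<close> exhibits one with the required trace.
\<close>

subsection \<open>The coordinate ring\<close>

text \<open>The quadratic forms arise by inserting the admissible traces into
  \<open>q2 = q1 + 1 - t\<close>. With \<open>e = 1\<close> or \<open>e = -1\<close>: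
  \<open>q1 = 2 x^2\<close>, \<open>t = 2 e x\<close> gives \<open>q2 = (e x - 1)^2 + x^2\<close>;
  \<open>q1 = x^2\<close>, \<open>t = e x\<close> gives \<open>4 q2 = (e x - 2)^2 + 3 x^2\<close>;
  \<open>q1 = x^2\<close>, \<open>t = 2 e x\<close> gives \<open>q2 = (x - e)^2\<close>. So curves
  with multiplication by \<open>Z[i]\<close> or \<open>Z[omega]\<close> suffice. In the ordinary
  cases \<open>p2\<close> splits in the relevant ring, and a binomial coefficient that is nonzero
  modulo \<open>p2\<close> makes the traces of the twists prime to \<open>p2\<close>. In the maximal
  case \<open>p2\<close> is inert in one of the rings, and a trace of absolute value
  \<open>2 sqrt q2\<close> is forced among the twists. The trace 0 with odd \<open>a1\<close> fits
  neither form: there 3 divides \<open>q2\<close>, which leaves the fields of order 3 and 9, where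
  both families of twists are useless for an ordinary curve and explicit equations take over.
  Whether the second set is ordinary depends only on whether \<open>p2\<close> divides
  \<open>q1 - 1\<close>.\<close>

lemma disc_singular:
  fixes W :: "'a::field weierstrass"
  assumes "on_curve W (Affine x y)"
    and "2 * y + wc1 W * x + wc3 W = 0"
    and "3 * x ^ 2 + 2 * wc2 W * x + wc4 W - wc1 W * y = 0"
  shows "discriminant W = 0"
proof -
  obtain a1 a2 a3 a4 a6 where W: "W = Weierstrass a1 a2 a3 a4 a6"
    by (cases W)
  \<comment> \<open>The two vanishing derivatives and the curve equation are solved for
    \<open>a3\<close>, \<open>a4\<close>, \<open>a6\<close>. Then \<open>b4\<close>,
    \<open>b6\<close>, \<open>b8\<close> are polynomials in \<open>x\<close> and \<open>b\<close>
    alone and the discriminant vanishes identically. Nothing is divided, so every characteristic is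
    covered.\<close>
  have a3: "a3 = - (2 * y + a1 * x)"
    using assms(2) by (simp add: W add_eq_0_iff)
  have a4: "a4 = a1 * y - (3 * x ^ 2 + 2 * a2 * x)"
    using assms(3) by (simp add: W algebra_simps)
  have a6: "a6 = y ^ 2 + a1 * x * y + a3 * y - (x ^ 3 + a2 * x ^ 2 + a4 * x)"
    using assms(1) by (simp add: W algebra_simps)
  define b where "b = a1 ^ 2 + 4 * a2"
  have b4: "2 * a4 + a1 * a3 = - (6 * x ^ 2 + b * x)"
    unfolding a4 a3 b_def by Groebner_Basis.algebra
  have b6: "a3 ^ 2 + 4 * a6 = 8 * x ^ 3 + b * x ^ 2"
    unfolding a6 a4 a3 b_def by Groebner_Basis.algebra
  have b8: "a1 ^ 2 * a6 + 4 * a2 * a6 - a1 * a3 * a4 + a2 * a3 ^ 2 - a4 ^ 2 = - (b * x ^ 3 + 9 * x ^ 4)"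
    unfolding a6 a4 a3 b_def by Groebner_Basis.algebra
  show ?thesis
    unfolding W discriminant_def Let_def weierstrass.sel b4 b6 b8 unfolding b_def[symmetric] by Groebner_Basis.algebra
qed

locale smooth_weierstrass =
  fixes W :: "'a::field weierstrass"
  assumes elliptic: "elliptic_curve W"
begin

text \<open>Together with \<open>lin\<close> this presents the coordinate ring as polynomials modulo
  \<open>y^2 + lin y = cub\<close>. A pair \<open>(f, g)\<close> stands for
  \<open>f + g y\<close>.\<close>

definition cub :: "'a poly" where
  "cub = [:wc6 W, wc4 W, wc2 W, 1:]"

definition lin :: "'a poly" where
  "lin = [:wc3 W, wc1 W:]"

definition cmul :: "'a poly \<times> 'a poly \<Rightarrow> 'a poly \<times> 'a poly \<Rightarrow> 'a poly \<times> 'a poly" where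
  "cmul f g = (fst f * fst g + snd f * snd g * cub,
     fst f * snd g + snd f * fst g - snd f * snd g * lin)"

text \<open>The product of \<open>f\<close> with its conjugate under the substitution of
  \<open>- y - lin\<close> for \<open>y\<close>, which is free of \<open>y\<close>.\<close>

definition cnorm :: "'a poly \<times> 'a poly \<Rightarrow> 'a poly" where
  "cnorm f = fst f ^ 2 - fst f * snd f * lin - snd f ^ 2 * cub"

definition ev :: "'a poly \<times> 'a poly \<Rightarrow> 'a \<Rightarrow> 'a \<Rightarrow> 'a" where
  "ev f x y = poly (fst f) x + poly (snd f) x * y"

lemma cmul_comm: "cmul f g = cmul g f"
  by (simp add: cmul_def mult.commute add.commute)

lemma cmul_assoc: "cmul (cmul f g) h = cmul f (cmul g h)"
  by (simp add: cmul_def algebra_simps)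

lemma cmul_left_comm: "cmul f (cmul g h) = cmul g (cmul f h)"
  by (metis cmul_assoc cmul_comm)

lemma cmul_add_left: "cmul (f + g) h = cmul f h + cmul g h"
  by (simp add: cmul_def algebra_simps)

lemma cmul_add_right: "cmul f (g + h) = cmul f g + cmul f h"
  by (simp add: cmul_def algebra_simps)

lemma cmul_zero [simp]: "cmul f 0 = 0" "cmul 0 f = 0"
  by (simp_all add: cmul_def prod_eq_iff)

lemma cmul_one [simp]: "cmul (1, 0) f = f" "cmul f (1, 0) = f"
  by (simp_all add: cmul_def prod_eq_iff)

lemma cnorm_mult: "cnorm (cmul f g) = cnorm f * cnorm g"
  by (simp add: cmul_def cnorm_def power2_eq_square algebra_simps)

lemma ev_add: "ev (f + g) x y = ev f x y + ev g x y"
  by (simp add: ev_def algebra_simps)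

lemma ev_zero [simp]: "ev 0 x y = 0"
  by (simp add: ev_def)

lemma ev_mult:
  assumes "on_curve W (Affine x y)"
  shows "ev (cmul f g) x y = ev f x y * ev g x y"
proof -
  have c: "poly cub x = y ^ 2 + poly lin x * y"
    using assms by (simp add: cub_def lin_def power2_eq_square power3_eq_cube algebra_simps)
  show ?thesis
    unfolding ev_def cmul_def by (simp add: c power2_eq_square algebra_simps)
qed

text \<open>The outer terms of the norm of \<open>a + b y\<close> have degrees
  \<open>2 deg a\<close> and \<open>2 deg b + 3\<close>, of different parity, and the mixed term
  stays below the larger one. That degree 1 never occurs is the form in which genus one enters; it
  later separates distinct points.\<close>

lemma degree_cnorm:
  assumes "f \<noteq> 0"
  shows "cnorm f \<noteq> 0" and "Polynomial.degree (cnorm f) \<noteq> 1"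
    and "Polynomial.degree (cnorm f) = 0 \<Longrightarrow> snd f = 0 \<and> Polynomial.degree (fst f) = 0"
proof -
  obtain a b where f: "f = (a, b)" by (cases f)
  let ?d = "Polynomial.degree"
  have dc: "?d cub = 3" by (simp add: cub_def)
  have dl: "?d lin \<le> 1" by (simp add: lin_def)
  have n: "cnorm f = a ^ 2 - (a * b * lin + b ^ 2 * cub)"
    by (simp add: cnorm_def f)
  have c0: "cub \<noteq> 0" by (simp add: cub_def)
  have "cnorm f \<noteq> 0 \<and> ?d (cnorm f) \<noteq> 1 \<and> (?d (cnorm f) = 0 \<longrightarrow> b = 0 \<and> ?d a = 0)"
  proof (cases "b = 0")
    case True
    then have "a \<noteq> 0" using assms f by (auto simp: zero_prod_def)
    then show ?thesis using True by (auto simp: n degree_power_eq)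
  next
    case b: False
    have d1: "?d (a * b * lin) \<le> ?d a + ?d b + 1"
      using degree_mult_le[of "a * b" lin] degree_mult_le[of a b] dl by linarith
    have d2: "?d (b ^ 2 * cub) = 2 * ?d b + 3"
      using b c0 by (simp add: degree_mult_eq degree_power_eq dc)
    show ?thesis
    proof (cases "?d a \<ge> ?d b + 2")
      case True
      then have a: "a \<noteq> 0" by auto
      have "?d (a * b * lin + b ^ 2 * cub) < 2 * ?d a"
        by (rule degree_add_less) (use d1 d2 True in linarith)+
      moreover have "?d (a ^ 2) = 2 * ?d a" using a by (simp add: degree_power_eq)
      ultimately have "?d (cnorm f) = 2 * ?d a"
        unfolding n by (metis degree_add_eq_left degree_minus diff_conv_add_uminus)
      then show ?thesis using True by auto
    next
      case False
      have "?d (a * b * lin) < 2 * ?d b + 3" using d1 False by linarith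
      then have 1: "?d (a * b * lin + b ^ 2 * cub) = 2 * ?d b + 3"
        by (subst degree_add_eq_right) (simp_all add: d2)
      moreover have "?d (a ^ 2) < 2 * ?d b + 3"
        using degree_power_le[of a 2] False by linarith
      ultimately have "?d (cnorm f) = 2 * ?d b + 3"
        unfolding n using degree_add_eq_right[of "a ^ 2" "- (a * b * lin + b ^ 2 * cub)"] 1
        by (simp only: degree_minus diff_conv_add_uminus)
      then show ?thesis by auto
    qed
  qed
  then show "cnorm f \<noteq> 0" "?d (cnorm f) \<noteq> 1" "?d (cnorm f) = 0 \<Longrightarrow> snd f = 0 \<and> ?d (fst f) = 0"
    by (auto simp: f)
qed

text \<open>The ring is a domain because the norm is multiplicative and vanishes only at 0.\<close>

lemma cmul_eq_0_iff [simp]: "cmul f g = 0 \<longleftrightarrow> f = 0 \<or> g = 0"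
proof
  assume "cmul f g = 0"
  then have "cnorm f * cnorm g = 0"
    by (metis cnorm_mult cnorm_def fst_zero snd_zero mult_zero_left power_zero_numeral diff_zero)
  then show "f = 0 \<or> g = 0" by (meson degree_cnorm(1) mult_eq_0_iff)
qed auto

lemma cmul_diff_right: "cmul f (g - h) = cmul f g - cmul f h"
  by (simp add: cmul_def algebra_simps)

lemma cmul_left_cancel: "f \<noteq> 0 \<Longrightarrow> cmul f g = cmul f h \<longleftrightarrow> g = h"
  by (metis cmul_diff_right cmul_eq_0_iff right_minus_eq)

subsection \<open>Ideal classes of the coordinate ring\<close>

definition cideal :: "('a poly \<times> 'a poly) set \<Rightarrow> bool" where
  "cideal I \<longleftrightarrow> 0 \<in> I \<and> (\<forall>f\<in>I. \<forall>g\<in>I. f + g \<in> I) \<and> (\<forall>f\<in>I. \<forall>g. cmul g f \<in> I)"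

lemma cidealD:
  assumes "cideal I"
  shows "0 \<in> I" "f \<in> I \<Longrightarrow> g \<in> I \<Longrightarrow> f + g \<in> I" "f \<in> I \<Longrightarrow> cmul g f \<in> I" "f \<in> I \<Longrightarrow> cmul f g \<in> I"
  using assms unfolding cideal_def by (blast, blast, blast, metis cmul_comm)

lemma cideal_diff:
  assumes "cideal I" "f \<in> I" "g \<in> I"
  shows "f - g \<in> I"
proof -
  have "cmul (-1, 0) g = - g" by (simp add: cmul_def prod_eq_iff)
  then show ?thesis using assms by (metis cidealD(2,3) diff_conv_add_uminus)
qed

inductive_set iprod :: "('a poly \<times> 'a poly) set \<Rightarrow> ('a poly \<times> 'a poly) set \<Rightarrow> ('a poly \<times> 'a poly) set"
  for I J where
  zero: "0 \<in> iprod I J"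
| step: "f \<in> I \<Longrightarrow> g \<in> J \<Longrightarrow> h \<in> iprod I J \<Longrightarrow> cmul f g + h \<in> iprod I J"

lemma iprod_mult: "f \<in> I \<Longrightarrow> g \<in> J \<Longrightarrow> cmul f g \<in> iprod I J"
  using iprod.step[OF _ _ iprod.zero, of f I g J] by simp

lemma cideal_iprod:
  assumes "cideal I"
  shows "cideal (iprod I J)"
  unfolding cideal_def
proof (intro conjI ballI allI)
  show "f + g \<in> iprod I J" if "f \<in> iprod I J" "g \<in> iprod I J" for f g
    using that by (induction) (auto simp: add.assoc intro: iprod.step)
  show "cmul g f \<in> iprod I J" if "f \<in> iprod I J" for f g
    using that
  proof induction
    case (step f1 g1 h)
    have "cmul (cmul g f1) g1 + cmul g h \<in> iprod I J"
      using step assms by (intro iprod.step) (auto simp: cidealD)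
    then show ?case by (simp add: cmul_add_right cmul_assoc)
  qed (simp add: iprod.zero)
qed (rule iprod.zero)

lemma iprod_least:
  assumes "cideal K" "\<And>f g. f \<in> I \<Longrightarrow> g \<in> J \<Longrightarrow> cmul f g \<in> K"
  shows "iprod I J \<subseteq> K"
proof
  show "f \<in> K" if "f \<in> iprod I J" for f
    using that by induction (use assms in \<open>auto simp: cidealD\<close>)
qed

lemma iprod_comm:
  assumes "cideal I" "cideal J"
  shows "iprod I J = iprod J I"
proof -
  have "iprod I J \<subseteq> iprod J I" if "cideal I" "cideal J" for I J
    using that by (intro iprod_least) (metis cideal_iprod cmul_comm iprod_mult)+
  then show ?thesis using assms by blast
qed

text \<open>The colon ideal. Combined with \<open>iprod_least\<close> it reduces a containment for
  nested products to products of single elements.\<close>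

lemma cideal_quotient:
  assumes "cideal K"
  shows "cideal {f. \<forall>g\<in>S. cmul f g \<in> K}"
  using assms unfolding cideal_def by (auto simp: cmul_add_left cmul_assoc)

lemma iprod_assoc:
  assumes "cideal I" "cideal J" "cideal K"
  shows "iprod (iprod I J) K = iprod I (iprod J K)"
proof -
  have sub: "iprod (iprod I J) K \<subseteq> iprod I (iprod J K)" if "cideal I" "cideal J" "cideal K" for I J K
  proof (rule iprod_least)
    show id: "cideal (iprod I (iprod J K))" using that by (intro cideal_iprod)
    have "iprod I J \<subseteq> {f. \<forall>g\<in>K. cmul f g \<in> iprod I (iprod J K)}"
      by (rule iprod_least[OF cideal_quotient[OF id]]) (auto simp: cmul_assoc intro!: iprod_mult)
    then show "cmul f g \<in> iprod I (iprod J K)" if "f \<in> iprod I J" "g \<in> K" for f g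
      using that by blast
  qed
  \<comment> \<open>Commutativity turns the missing inclusion into the one already shown, with
    \<open>I\<close> and \<open>K\<close> exchanged.\<close>
  have "iprod I (iprod J K) = iprod (iprod K J) I"
    using assms by (simp add: iprod_comm cideal_iprod)
  also have "\<dots> \<subseteq> iprod K (iprod J I)"
    using sub assms by blast
  also have "\<dots> = iprod (iprod I J) K"
    using assms by (metis iprod_comm cideal_iprod)
  finally show ?thesis using sub[OF assms] by blast
qed

lemma cideal_UNIV: "cideal UNIV"
  by (simp add: cideal_def)

lemma iprod_UNIV:
  assumes "cideal I"
  shows "iprod I UNIV = I" "iprod UNIV I = I"
proof -
  have "iprod UNIV I \<subseteq> I"
    by (rule iprod_least) (use assms in \<open>auto simp: cidealD\<close>)
  moreover have "I \<subseteq> iprod UNIV I"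
    using iprod_mult[of "(1, 0)" UNIV _ I] by auto
  ultimately show "iprod UNIV I = I" by blast
  then show "iprod I UNIV = I" using assms cideal_UNIV iprod_comm by metis
qed

lemma cideal_scale:
  assumes "cideal I"
  shows "cideal (cmul u ` I)"
proof -
  have "cmul u f + cmul u g \<in> cmul u ` I" if "f \<in> I" "g \<in> I" for f g
    using that assms by (metis cidealD(2) cmul_add_right imageI)
  moreover have "cmul g (cmul u f) \<in> cmul u ` I" if "f \<in> I" for f g
    using that assms by (metis cidealD(3) cmul_left_comm imageI)
  moreover have "0 \<in> cmul u ` I"
    using assms cidealD(1) by force
  ultimately show ?thesis by (auto simp: cideal_def)
qed

lemma iprod_scale:
  assumes "cideal I"
  shows "iprod (cmul u ` I) J = cmul u ` iprod I J"
proof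
  show "iprod (cmul u ` I) J \<subseteq> cmul u ` iprod I J"
    by (rule iprod_least)
      (use assms in \<open>auto simp: cideal_scale cideal_iprod cmul_assoc intro!: imageI iprod_mult\<close>)
  have "cideal (iprod (cmul u ` I) J)" using assms by (simp add: cideal_scale cideal_iprod)
  from cideal_quotient[OF this, of "{u}"]
  have "iprod I J \<subseteq> {f. \<forall>g\<in>{u}. cmul f g \<in> iprod (cmul u ` I) J}"
  proof (rule iprod_least)
    fix f g assume "f \<in> I" "g \<in> J"
    then have "cmul (cmul u f) g \<in> iprod (cmul u ` I) J"
      by (intro iprod_mult) auto
    moreover have "cmul (cmul f g) u = cmul (cmul u f) g"
      by (metis cmul_assoc cmul_comm)
    ultimately show "cmul f g \<in> {f. \<forall>g\<in>{u}. cmul f g \<in> iprod (cmul u ` I) J}"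
      by simp
  qed
  then show "cmul u ` iprod I J \<subseteq> iprod (cmul u ` I) J"
    by (force simp: cmul_comm[of u])
qed

text \<open>Equality in the ideal class group with denominators cleared, so that no fractional
  ideals appear.\<close>

definition same_class :: "('a poly \<times> 'a poly) set \<Rightarrow> ('a poly \<times> 'a poly) set \<Rightarrow> bool" where
  "same_class I J \<longleftrightarrow> (\<exists>u v. u \<noteq> 0 \<and> v \<noteq> 0 \<and> cmul u ` I = cmul v ` J)"

lemma one_pair_neq_0 [simp]: "(1, 0) \<noteq> (0 :: 'a poly \<times> 'a poly)"
  by (simp add: zero_prod_def)

lemma same_class_refl: "same_class I I"
  unfolding same_class_def using one_pair_neq_0 by blast

lemma same_class_sym: "same_class I J \<Longrightarrow> same_class J I"
  unfolding same_class_def by metis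

lemma scale_scale: "cmul u ` cmul v ` I = cmul (cmul u v) ` I"
  by (simp add: image_image cmul_assoc)

lemma same_class_trans:
  assumes "same_class I J" "same_class J K"
  shows "same_class I K"
proof -
  obtain u v where 1: "u \<noteq> 0" "v \<noteq> 0" "cmul u ` I = cmul v ` J"
    using assms(1) by (auto simp: same_class_def)
  obtain u' v' where 2: "u' \<noteq> 0" "v' \<noteq> 0" "cmul u' ` J = cmul v' ` K"
    using assms(2) by (auto simp: same_class_def)
  have "cmul (cmul u' u) ` I = cmul (cmul v v') ` K"
    using 1(3) 2(3) by (metis scale_scale cmul_comm)
  then show ?thesis
    unfolding same_class_def using 1 2 by (meson cmul_eq_0_iff)
qed

lemma same_class_iprod:
  assumes "same_class I I'" "same_class J J'" "cideal I" "cideal I'" "cideal J" "cideal J'"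
  shows "same_class (iprod I J) (iprod I' J')"
proof -
  have 1: "same_class (iprod I J) (iprod I' J)"
    if "same_class I I'" "cideal I" "cideal I'" for I I' J
    using that unfolding same_class_def by (metis iprod_scale)
  show ?thesis
    using 1[OF assms(1,3,4), of J] 1[OF assms(2,5,6), of I'] assms
    by (metis iprod_comm same_class_trans)
qed

lemma same_class_principal: "u \<noteq> 0 \<Longrightarrow> same_class (cmul u ` UNIV) UNIV"
  unfolding same_class_def by (intro exI[of _ "(1, 0)"] exI[of _ u]) auto


text \<open>The neutral point is sent to the unit ideal. Up to sign the class of the ideal is that
  of the divisor \<open>P - Infinity\<close>, so adding points has to correspond to multiplying
  ideals.\<close>

definition place :: "'a point \<Rightarrow> ('a poly \<times> 'a poly) set" where
  "place P = (case P of Infinity \<Rightarrow> UNIV | Affine x y \<Rightarrow> {f. ev f x y = 0})"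

lemma place_simps [simp]: "place Infinity = UNIV" "f \<in> place (Affine x y) \<longleftrightarrow> ev f x y = 0"
  by (simp_all add: place_def)

lemma cideal_place: "on_curve W P \<Longrightarrow> cideal (place P)"
  by (cases P) (auto simp: cideal_def ev_add ev_mult simp del: on_curve.simps split_paired_All)

text \<open>The point is cut out by \<open>X - x\<close> and \<open>y - L\<close> for any polynomial
  \<open>L\<close> through it. The freedom in \<open>L\<close> lets three points of one line share
  the generator \<open>y - L\<close>.\<close>

lemma place_eq:
  assumes "poly L x = y"
  shows "place (Affine x y) = {cmul ([:- x, 1:], 0) (r, 0) + cmul (- L, 1) (b, 0) | r b. True}"
proof (rule Set.set_eqI, rule iffI)
  fix f assume f: "f \<in> place (Affine x y)"
  have "poly (fst f + snd f * L) x = 0"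
    using f assms by (simp add: ev_def)
  then obtain r where r: "fst f + snd f * L = [:- x, 1:] * r"
    using poly_eq_0_iff_dvd by (metis dvdE)
  have "f = cmul ([:- x, 1:], 0) (r, 0) + cmul (- L, 1) (snd f, 0)"
    by (simp add: cmul_def prod_eq_iff r[symmetric] mult.commute[of L] del: mult_pCons_left)
  then show "f \<in> {cmul ([:- x, 1:], 0) (r, 0) + cmul (- L, 1) (b, 0) | r b. True}" by blast
next
  fix f assume "f \<in> {cmul ([:- x, 1:], 0) (r, 0) + cmul (- L, 1) (b, 0) | r b. True}"
  then show "f \<in> place (Affine x y)"
    using assms by (auto simp: ev_def cmul_def algebra_simps)
qed

text \<open>For distinct roots, differences of the three products yield linear factors, and the
  difference of two of these is a nonzero constant. For a repeated root \<open>r\<close>,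
  \<open>d\<close> is a unit modulo \<open>X - r\<close>: the square of \<open>X - r\<close> and its
  multiple by \<open>d\<close> give \<open>X - r\<close> itself, after which \<open>d ^ 2\<close>
  gives a nonzero constant.\<close>

lemma unit_of_pairwise_products:
  fixes J :: "'a poly set"
  assumes add: "\<And>f g. f \<in> J \<Longrightarrow> g \<in> J \<Longrightarrow> f + g \<in> J"
    and mult: "\<And>f g. f \<in> J \<Longrightarrow> g * f \<in> J"
    and prods: "[:- x1, 1:] * [:- x2, 1:] \<in> J" "[:- x1, 1:] * [:- x3, 1:] \<in> J"
      "[:- x2, 1:] * [:- x3, 1:] \<in> J"
    and d: "d ^ 2 \<in> J" "d * [:- x1, 1:] \<in> J" "d * [:- x2, 1:] \<in> J" "d * [:- x3, 1:] \<in> J"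
    and nz: "x1 = x2 \<Longrightarrow> poly d x1 \<noteq> 0" "x1 = x3 \<Longrightarrow> poly d x1 \<noteq> 0" "x2 = x3 \<Longrightarrow> poly d x2 \<noteq> 0"
  shows "1 \<in> J"
proof -
  have diff: "f - g \<in> J" if "f \<in> J" "g \<in> J" for f g
    using add[OF that(1) mult[OF that(2), of "-1"]] by simp
  have const: "1 \<in> J" if "[:c:] \<in> J" "c \<noteq> 0" for c
    using mult[OF that(1), of "[:inverse c:]"] that(2) by (simp add: one_pCons)
  have cancel: "f \<in> J" if "[:c:] * f \<in> J" "c \<noteq> 0" for c f
    using mult[OF that(1), of "[:inverse c:]"] that(2) by simp
  have double: "1 \<in> J" if "[:- r, 1:] * [:- r, 1:] \<in> J" "d * [:- r, 1:] \<in> J" "poly d r \<noteq> 0" for r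
  proof -
    have "poly (d - [:poly d r:]) r = 0" by simp
    then obtain e where "d - [:poly d r:] = [:- r, 1:] * e"
      using poly_eq_0_iff_dvd by (metis dvdE)
    then have e: "d = [:- r, 1:] * e + [:poly d r:]" by (simp add: diff_eq_eq)
    have "d * [:- r, 1:] - e * ([:- r, 1:] * [:- r, 1:]) \<in> J"
      using that mult diff by blast
    also have "d * [:- r, 1:] - e * ([:- r, 1:] * [:- r, 1:]) = [:poly d r:] * [:- r, 1:]"
      using e by Groebner_Basis.algebra
    finally have X: "[:- r, 1:] \<in> J"
      using that(3) by (rule cancel)
    have "d ^ 2 - ([:- r, 1:] * e ^ 2 + 2 * [:poly d r:] * e) * [:- r, 1:] \<in> J"
      using d(1) X mult diff by blast
    also have "d ^ 2 - ([:- r, 1:] * e ^ 2 + 2 * [:poly d r:] * e) * [:- r, 1:] = [:poly d r:] ^ 2"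
      using e by Groebner_Basis.algebra
    finally show "1 \<in> J"
      using const[of "poly d r ^ 2"] that(3) by (simp add: power2_eq_square)
  qed
  show ?thesis
  proof (cases "x1 = x2 \<or> x1 = x3 \<or> x2 = x3")
    case True
    then show ?thesis using double prods d nz by metis
  next
    case False
    have "[:x2 - x1:] * [:- x3, 1:] \<in> J"
      using diff[OF prods(2,3)] by (simp add: algebra_simps)
    then have 3: "[:- x3, 1:] \<in> J"
      by (rule cancel) (use False in auto)
    have "[:x3 - x1:] * [:- x2, 1:] \<in> J"
      using diff[OF prods(1,3)] by (simp add: algebra_simps)
    then have 2: "[:- x2, 1:] \<in> J"
      by (rule cancel) (use False in auto)
    show ?thesis
      using const[of "x2 - x3"] diff[OF 3 2] False by simp
  qed
qed

text \<open>\<open>(- L, 1)\<close> is the function \<open>y - L\<close>, and \<open>N\<close> says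
  that its norm is, up to sign, the product of the three linear factors. The line thus meets the
  curve in these three points with multiplicity, and their ideals multiply to a principal
  ideal.\<close>

lemma line_product:
  assumes "L = [:c, l:]"
    and N: "L ^ 2 + L * lin - cub = - ([:- x1, 1:] * [:- x2, 1:] * [:- x3, 1:])"
  shows "iprod (iprod (place (Affine x1 (poly L x1))) (place (Affine x2 (poly L x2))))
      (place (Affine x3 (poly L x3))) = cmul (- L, 1) ` UNIV" (is "?T = _")
proof
  let ?X = "\<lambda>r. ([:- r, 1:], 0 :: 'a poly)" and ?l = "(- L, 1 :: 'a poly)"
  let ?P = "\<lambda>r. place (Affine r (poly L r))"
  have on: "on_curve W (Affine r (poly L r))" if "r \<in> {x1, x2, x3}" for r
  proof -
    have "poly (L ^ 2 + L * lin - cub) r = 0"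
      unfolding N poly_minus poly_mult using that by auto
    then show ?thesis
      by (simp add: lin_def cub_def algebra_simps power2_eq_square power3_eq_cube)
  qed
  then have id: "cideal (?P x1)" "cideal (?P x2)" "cideal (?P x3)"
    by (auto intro!: cideal_place)
  \<comment> \<open>In the expanded product of the three ideals this is the only term without a
    visible factor \<open>y - L\<close>. Being minus the norm, it is \<open>y - L\<close> times
    \<open>y + L + lin\<close>, the negated conjugate.\<close>
  have NX: "cmul (?X x1) (cmul (?X x2) (?X x3)) = cmul ?l (L + lin, 1)"
    using N by (simp add: cmul_def prod_eq_iff power2_eq_square algebra_simps)
  have idl: "cideal (cmul ?l ` UNIV)" by (rule cideal_scale[OF cideal_UNIV])
  have "cmul (cmul f g) h \<in> cmul ?l ` UNIV" if fgh: "f \<in> ?P x1" "g \<in> ?P x2" "h \<in> ?P x3" for f g h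
  proof -
    obtain r1 b1 where f: "f = cmul (?X x1) r1 + cmul ?l b1" using fgh(1) place_eq[OF refl] by blast
    obtain r2 b2 where g: "g = cmul (?X x2) r2 + cmul ?l b2" using fgh(2) place_eq[OF refl] by blast
    obtain r3 b3 where h: "h = cmul (?X x3) r3 + cmul ?l b3" using fgh(3) place_eq[OF refl] by blast
    have "cmul (cmul f g) h
        = cmul ?l (cmul b1 (cmul g h)) + cmul (cmul (?X x1) r1) (cmul g h)"
      by (simp add: f cmul_add_left cmul_assoc add.commute)
    also have "cmul (cmul (?X x1) r1) (cmul g h)
        = cmul ?l (cmul b2 (cmul (cmul (?X x1) r1) h)) + cmul (cmul (?X x1) r1) (cmul (cmul (?X x2) r2) h)"
      by (simp only: g cmul_add_left cmul_add_right cmul_assoc cmul_comm cmul_left_comm add.commute)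
    also have "cmul (cmul (?X x1) r1) (cmul (cmul (?X x2) r2) h)
        = cmul ?l (cmul b3 (cmul (cmul (?X x1) r1) (cmul (?X x2) r2)))
          + cmul (cmul r1 (cmul r2 r3)) (cmul (?X x1) (cmul (?X x2) (?X x3)))"
      by (simp only: h cmul_add_left cmul_add_right cmul_assoc cmul_comm cmul_left_comm add.commute)
    also have "cmul (cmul r1 (cmul r2 r3)) (cmul (?X x1) (cmul (?X x2) (?X x3)))
        = cmul ?l (cmul (cmul r1 (cmul r2 r3)) (L + lin, 1))"
      by (simp only: NX cmul_left_comm)
    finally show ?thesis
      by (metis cmul_add_right rangeI)
  qed
  then have "iprod (?P x1) (?P x2) \<subseteq> {f. \<forall>h\<in>?P x3. cmul f h \<in> cmul ?l ` UNIV}"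
    by (intro iprod_least cideal_quotient[OF idl]) blast
  then show "?T \<subseteq> cmul ?l ` UNIV"
    by (intro iprod_least[OF idl]) blast

  have idT: "cideal ?T" by (intro cideal_iprod id)
  \<comment> \<open>The reverse inclusion says that \<open>J\<close> is the whole ring, so 1 has to
    be found in it.\<close>
  define J where "J = {f. cmul ?l f \<in> ?T}"
  have idJ: "cideal J"
    using cideal_quotient[OF idT, of "{?l}"] by (simp add: J_def cmul_comm)
  have prod: "cmul (cmul f g) h \<in> ?T" if "f \<in> ?P x1" "g \<in> ?P x2" "h \<in> ?P x3" for f g h
    using that by (intro iprod_mult)
  have X: "?X r \<in> ?P r" and l: "?l \<in> ?P r" for r by (simp_all add: ev_def)
  have conj: "(L + lin, 1) \<in> J"
    using prod[OF X X X] by (simp add: J_def NX[symmetric] cmul_assoc)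
  have XX: "cmul (?X x1) (?X x2) \<in> J" "cmul (?X x1) (?X x3) \<in> J" "cmul (?X x2) (?X x3) \<in> J"
    using prod[OF X X l] prod[OF X l X] prod[OF l X X]
    by (simp_all add: J_def cmul_assoc cmul_left_comm cmul_comm)
  have lX: "cmul ?l (?X x1) \<in> J" "cmul ?l (?X x2) \<in> J" "cmul ?l (?X x3) \<in> J"
    using prod[OF X l l] prod[OF l X l] prod[OF l l X]
    by (simp_all add: J_def cmul_assoc cmul_left_comm cmul_comm)
  have ll: "cmul ?l ?l \<in> J"
    using prod[OF l l l] by (simp add: J_def cmul_assoc)
  \<comment> \<open>The difference of \<open>y + L + lin\<close> and \<open>y - L\<close>: it is
    free of \<open>y\<close>, which moves the argument to polynomials in \<open>x\<close>. On the
    line it equals the derivative of the curve equation in \<open>y\<close>.\<close>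
  define d where "d = 2 * L + lin"
  have dl: "(d, 0) + ?l = (L + lin, 1)" by (simp add: d_def)
  define J0 where "J0 = {f. (f, 0) \<in> J}"
  have "1 \<in> J0"
  proof (rule unit_of_pairwise_products)
    show "f + g \<in> J0" if "f \<in> J0" "g \<in> J0" for f g
      using cidealD(2)[OF idJ, of "(f, 0)" "(g, 0)"] that by (simp add: J0_def)
    show "g * f \<in> J0" if "f \<in> J0" for f g
      using cidealD(3)[OF idJ, of "(f, 0)" "(g, 0)"] that by (simp add: J0_def cmul_def)
    have sub: "f \<in> J" if "f + cmul ?l g \<in> J" "cmul ?l g \<in> J" for f g
      using cideal_diff[OF idJ that] by simp
    have "cmul (d, 0) (?X r) \<in> J" if "cmul ?l (?X r) \<in> J" for r
      by (rule sub[OF _ that], simp only: cmul_add_left[symmetric] dl) (rule cidealD(4)[OF idJ conj])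
    from this[OF lX(1)] this[OF lX(2)] this[OF lX(3)]
    show "d * [:- x1, 1:] \<in> J0" "d * [:- x2, 1:] \<in> J0" "d * [:- x3, 1:] \<in> J0"
      by (simp_all add: J0_def cmul_def)
    have "cmul (d, 0) (d, 0) \<in> J"
    proof (rule sub)
      have "cmul (d, 0) (d, 0) + cmul ?l ?l
          = cmul ((d, 0) + ?l) ((d, 0) - ?l) + (cmul ?l ?l + cmul ?l ?l)"
        by (simp only: cmul_add_left cmul_diff_right cmul_comm[of ?l "(d, 0)"]) simp
      then show "cmul (d, 0) (d, 0) + cmul ?l ?l \<in> J"
        unfolding dl by (simp only: cidealD[OF idJ] conj ll)
    qed (rule ll)
    then show "d ^ 2 \<in> J0"
      by (simp add: J0_def cmul_def power2_eq_square)
    show "[:- x1, 1:] * [:- x2, 1:] \<in> J0" "[:- x1, 1:] * [:- x3, 1:] \<in> J0"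
      "[:- x2, 1:] * [:- x3, 1:] \<in> J0"
      using XX by (simp_all add: J0_def cmul_def)
    \<comment> \<open>A repeated factor makes the derivative of the norm vanish at \<open>r\<close>.
      If \<open>d\<close> vanished there as well, both partial derivatives of the equation would be
      zero, against the nonzero discriminant.\<close>
    have smooth: "poly d r \<noteq> 0"
      if r: "r \<in> {x1, x2, x3}" and "L ^ 2 + L * lin - cub = [:- r, 1:] ^ 2 * h" for r h
    proof
      assume dr: "poly d r = 0"
      have "poly (pderiv (L ^ 2 + L * lin - cub)) r = 0"
        unfolding that(2) by (simp add: pderiv_mult pderiv_power pderiv_pCons)
      then have "l * poly d r + wc1 W * poly L r - (3 * r ^ 2 + 2 * wc2 W * r + wc4 W) = 0"
        unfolding assms(1) d_def lin_def cub_def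
        by (simp add: pderiv_mult pderiv_power pderiv_diff pderiv_add pderiv_pCons power2_eq_square algebra_simps)
      then have "3 * r ^ 2 + 2 * wc2 W * r + wc4 W - wc1 W * poly L r = 0"
        using dr by simp
      moreover have "2 * poly L r + wc1 W * r + wc3 W = 0"
        using dr by (simp add: d_def lin_def algebra_simps)
      ultimately have "discriminant W = 0"
        using disc_singular[OF on[OF r]] by blast
      then show False using elliptic by (simp add: elliptic_curve_def)
    qed
    show "poly d x1 \<noteq> 0" if "x1 = x2"
      by (rule smooth[of _ "- [:- x3, 1:]"]) (simp, unfold N that, simp only: power2_eq_square mult_minus_right)
    show "poly d x1 \<noteq> 0" if "x1 = x3"
      by (rule smooth[of _ "- [:- x2, 1:]"]) (simp, unfold N that, simp only: power2_eq_square mult_minus_right mult_ac)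
    show "poly d x2 \<noteq> 0" if "x2 = x3"
      by (rule smooth[of _ "- [:- x1, 1:]"]) (simp, unfold N that, simp only: power2_eq_square mult_minus_right mult_ac)
  qed
  then have "cmul f (1, 0) \<in> J" for f by (intro cidealD(3)[OF idJ]) (simp add: J0_def)
  then show "cmul ?l ` UNIV \<subseteq> ?T" by (auto simp: J_def)
qed

subsection \<open>The group law\<close>

lemma ev_diff: "ev (f - g) x y = ev f x y - ev g x y"
  by (simp add: ev_def algebra_simps)

fun neg_point :: "'a point \<Rightarrow> 'a point" where
  "neg_point Infinity = Infinity"
| "neg_point (Affine x y) = Affine x (- y - wc1 W * x - wc3 W)"

lemma on_curve_neg: "on_curve W P \<Longrightarrow> on_curve W (neg_point P)"
  by (cases P) (simp_all add: power2_eq_square algebra_simps)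

text \<open>The vertical line through the point. For the harder inclusion the quotient ideal
  \<open>J\<close> contains the maximal ideal of the point, so one element of \<open>J\<close> not
  vanishing there suffices: the function \<open>y - y'\<close> if the two points differ, and
  otherwise the cofactor \<open>?S\<close>, whose value is the derivative of the equation in
  \<open>x\<close>, up to sign.\<close>

lemma place_neg_product:
  assumes P: "on_curve W (Affine x y)"
  shows "iprod (place (Affine x y)) (place (neg_point (Affine x y))) = cmul ([:- x, 1:], 0) ` UNIV"
    (is "iprod ?M ?M' = cmul ?X ` UNIV")
proof -
  define y' where "y' = - y - wc1 W * x - wc3 W"
  have neg: "neg_point (Affine x y) = Affine x y'" by (simp add: y'_def)
  have P': "on_curve W (Affine x y')" using on_curve_neg[OF P] by (simp only: neg)
  let ?l = "([:- y:], 1) :: 'a poly \<times> 'a poly" and ?l' = "([:- y':], 1) :: 'a poly \<times> 'a poly"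
  have "poly (cub - [:poly cub x:]) x = 0" by simp
  then obtain s where s: "cub - [:poly cub x:] = [:- x, 1:] * s"
    using poly_eq_0_iff_dvd by (metis dvdE)
  have "y * y' = - (y ^ 2 + wc1 W * x * y + wc3 W * y)"
    by (simp add: y'_def power2_eq_square algebra_simps)
  also have "y ^ 2 + wc1 W * x * y + wc3 W * y = poly cub x"
    using P by (simp add: cub_def power2_eq_square power3_eq_cube algebra_simps)
  finally have yy: "y * y' = - poly cub x" .
  have ysum: "- y - y' = poly lin x"
    by (simp add: y'_def lin_def)
  have linx: "lin = [:poly lin x:] + [:wc1 W:] * [:- x, 1:]"
    by (simp add: lin_def)
  let ?S = "(s, [:- wc1 W:])"
  have llS: "cmul ?l ?l' = cmul ?X ?S"
  proof -
    have "[:- y:] * [:- y':] = - [:poly cub x:]" using yy by (simp add: mult.commute)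
    moreover have "[:- y:] + [:- y':] = [:poly lin x:]" using ysum by simp
    moreover have "[:- wc1 W:] = - [:wc1 W:]" by simp
    ultimately have "[:- y:] * [:- y':] + 1 * 1 * cub = [:- x, 1:] * s + 0 * [:- wc1 W:] * cub"
      and "[:- y:] * 1 + 1 * [:- y':] - 1 * 1 * lin
        = [:- x, 1:] * [:- wc1 W:] + 0 * s - 0 * [:- wc1 W:] * lin"
      using s linx by Groebner_Basis.algebra+
    then show ?thesis by (simp only: cmul_def fst_conv snd_conv)
  qed
  have eqs: "?M = {cmul ?X (r, 0) + cmul ?l (b, 0) | r b. True}"
    "?M' = {cmul ?X (r, 0) + cmul ?l' (b, 0) | r b. True}"
    unfolding neg using place_eq[of "[:y:]" x y] place_eq[of "[:y':]" x y'] by simp_all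
  have idX: "cideal (cmul ?X ` UNIV)" by (rule cideal_scale[OF cideal_UNIV])
  have M: "cideal ?M" "cideal ?M'" using P P' neg cideal_place by auto
  show ?thesis
  proof
    have "cmul f g \<in> cmul ?X ` UNIV" if fg: "f \<in> ?M" "g \<in> ?M'" for f g
    proof -
      obtain r b where f: "f = cmul ?X r + cmul ?l b" using fg eqs by blast
      obtain r' b' where g: "g = cmul ?X r' + cmul ?l' b'" using fg eqs by blast
      have "cmul f g = cmul ?X (cmul r g) + cmul (cmul ?l b) g"
        by (simp add: f cmul_add_left cmul_assoc)
      also have "cmul (cmul ?l b) g = cmul ?X (cmul r' (cmul ?l b)) + cmul (cmul ?l ?l') (cmul b b')"
        by (simp only: g cmul_add_left cmul_add_right cmul_assoc cmul_comm cmul_left_comm add.commute)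
      finally show ?thesis
        unfolding llS cmul_assoc by (metis cmul_add_right rangeI)
    qed
    then show "iprod ?M ?M' \<subseteq> cmul ?X ` UNIV"
      by (intro iprod_least[OF idX]) blast
    define J where "J = {f. cmul ?X f \<in> iprod ?M ?M'}"
    have idJ: "cideal J"
      using cideal_quotient[OF cideal_iprod[OF M(1)], of "{?X}"] by (simp add: J_def cmul_comm)
    have X: "?X \<in> ?M" "?X \<in> ?M'" and l: "?l \<in> ?M" "?l' \<in> ?M'" unfolding neg by (simp_all add: ev_def)
    have J: "?X \<in> J" "?l \<in> J" "?l' \<in> J" "?S \<in> J"
      using iprod_mult[OF X] iprod_mult[OF l(1) X(2)] iprod_mult[OF X(1) l(2)] iprod_mult[OF l]
      unfolding J_def mem_Collect_eq llS[symmetric] by (simp_all only: cmul_comm)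
    have unit: "(1, 0) \<in> J" if f: "f \<in> J" "ev f x y \<noteq> 0" for f
    proof -
      have "f - ([:ev f x y:], 0) \<in> ?M" using f by (simp add: ev_diff) (simp add: ev_def)
      then obtain r b where "f - ([:ev f x y:], 0) = cmul ?X r + cmul ?l b" using eqs by blast
      then have "f - ([:ev f x y:], 0) \<in> J" using J idJ by (metis cidealD(2,4))
      then have "f - (f - ([:ev f x y:], 0)) \<in> J" using idJ f(1) cideal_diff by blast
      then have "cmul ([:inverse (ev f x y):], 0) ([:ev f x y:], 0) \<in> J"
        using idJ cidealD(3) by simp
      then show ?thesis using f(2) by (simp add: cmul_def one_pCons)
    qed
    have "(1, 0) \<in> J"
    proof (cases "y = y'")
      case False
      then show ?thesis using unit[OF J(3)] by (simp add: ev_def)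
    next
      case True
      have "poly s x = poly (pderiv (cub - [:poly cub x:])) x"
        unfolding s pderiv_mult by (simp add: pderiv_pCons)
      also have "\<dots> = 3 * x ^ 2 + 2 * wc2 W * x + wc4 W"
        by (simp add: cub_def pderiv_pCons pderiv_diff power2_eq_square algebra_simps)
      finally have "ev ?S x y = 3 * x ^ 2 + 2 * wc2 W * x + wc4 W - wc1 W * y"
        by (simp add: ev_def)
      moreover have "2 * y + wc1 W * x + wc3 W = 0"
        using True by (simp add: y'_def algebra_simps)
      ultimately have "ev ?S x y \<noteq> 0"
        using disc_singular[OF P] elliptic by (auto simp: elliptic_curve_def)
      then show ?thesis by (rule unit[OF J(4)])
    qed
    then have "cmul f (1, 0) \<in> J" for f by (rule cidealD(3)[OF idJ])
    then show "cmul ?X ` UNIV \<subseteq> iprod ?M ?M'" by (auto simp: J_def)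
  qed
qed

lemma place_neg_class:
  assumes "on_curve W P"
  shows "same_class (iprod (place P) (place (neg_point P))) UNIV"
proof (cases P)
  case Infinity
  then show ?thesis by (simp add: iprod_UNIV cideal_UNIV same_class_refl)
next
  case (Affine x y)
  then show ?thesis
    using assms place_neg_product[of x y] same_class_principal[of "([:- x, 1:], 0)"]
    by (simp add: zero_prod_def del: neg_point.simps)
qed

text \<open>A generator \<open>f\<close> would divide \<open>X - x\<close>, whose norm has degree 2.
  As degree 1 is excluded for norms, \<open>f\<close> or its cofactor is constant; the former does
  not vanish at the point, and the latter would make \<open>y\<close> minus a constant divisible by
  \<open>X - x\<close>.\<close>

lemma place_not_principal:
  assumes P: "on_curve W P" and cl: "same_class (place P) UNIV"
  shows "P = Infinity"
proof (rule ccontr)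
  assume "P \<noteq> Infinity"
  then obtain x y where xy: "P = Affine x y" by (cases P) auto
  let ?M = "place (Affine x y)" and ?X = "([:- x, 1:], 0) :: 'a poly \<times> 'a poly"
  obtain u v where uv: "u \<noteq> 0" "v \<noteq> 0" "cmul u ` ?M = cmul v ` UNIV"
    using cl by (auto simp: same_class_def xy)
  have "cmul v (1, 0) \<in> cmul u ` ?M" unfolding uv(3) by blast
  then obtain f where f: "f \<in> ?M" "v = cmul u f" by auto
  have M: "\<exists>h. g = cmul f h" if "g \<in> ?M" for g
  proof -
    have "cmul u g \<in> cmul v ` UNIV" using that uv(3) by blast
    then obtain h where "cmul u g = cmul u (cmul f h)" by (auto simp: f(2) cmul_assoc)
    then show ?thesis using uv(1) cmul_left_cancel by blast
  qed
  obtain g where g: "?X = cmul f g" using M[of ?X] by (auto simp: ev_def)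
  obtain h where h: "([:- y:], 1) = cmul f h" using M[of "([:- y:], 1)"] by (auto simp: ev_def)
  have "cmul f g \<noteq> 0" unfolding g[symmetric] by (simp add: zero_prod_def)
  then have nz: "f \<noteq> 0" "g \<noteq> 0" by auto
  have "Polynomial.degree (cnorm ?X) = 2" by (simp add: cnorm_def degree_power_eq)
  then have deg: "Polynomial.degree (cnorm f) + Polynomial.degree (cnorm g) = 2"
    unfolding g cnorm_mult using nz degree_cnorm(1) by (simp add: degree_mult_eq)
  consider "Polynomial.degree (cnorm f) = 0" | "Polynomial.degree (cnorm g) = 0"
    using deg degree_cnorm(2)[OF nz(1)] by linarith
  then show False
  proof cases
    case 1
    from degree_cnorm(3)[OF nz(1) this] obtain c where c: "f = ([:c:], 0)"
      by (metis degree_eq_zeroE prod.collapse)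
    then show False using f(1) nz(1) by (simp add: ev_def zero_prod_def)
  next
    case 2
    from degree_cnorm(3)[OF nz(2) this] obtain c where c: "g = ([:c:], 0)"
      by (metis degree_eq_zeroE prod.collapse)
    then have "c \<noteq> 0" using nz(2) by (auto simp: zero_prod_def)
    have "cmul ([:c:], 0) ([:- y:], 1) = cmul ?X h"
      unfolding g h c by (metis cmul_assoc cmul_comm)
    then have "[:c:] = [:- x, 1:] * snd h" by (simp add: cmul_def prod_eq_iff)
    then have "Polynomial.degree ([:- x, 1:] * snd h) = 0" by (metis degree_pCons_0)
    moreover have "snd h \<noteq> 0" using \<open>[:c:] = _\<close> \<open>c \<noteq> 0\<close> by auto
    ultimately show False by (simp add: degree_mult_eq del: mult_pCons_left)
  qed
qed

text \<open>Brings chord and tangent to the common form required by \<open>line_product\<close>: one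
  line through both points, with the third intersection read off the addition formula.\<close>

lemma add_point_line:
  assumes P: "on_curve W (Affine x1 y1)" and Q: "on_curve W (Affine x2 y2)"
    and ne: "Affine x2 y2 \<noteq> neg_point (Affine x1 y1)"
  obtains c l x3 where "poly [:c, l:] x1 = y1" "poly [:c, l:] x2 = y2"
    "[:c, l:] ^ 2 + [:c, l:] * lin - cub = - ([:- x1, 1:] * [:- x2, 1:] * [:- x3, 1:])"
    "add_point W (Affine x1 y1) (Affine x2 y2) = neg_point (Affine x3 (poly [:c, l:] x3))"
proof -
  obtain a1 a2 a3 a4 a6 where "W = Weierstrass a1 a2 a3 a4 a6" by (cases W)
  then have sel: "wc1 W = a1" "wc2 W = a2" "wc3 W = a3" "wc4 W = a4" "wc6 W = a6" by simp_all
  have P1: "y1 ^ 2 + a1 * x1 * y1 + a3 * y1 = x1 ^ 3 + a2 * x1 ^ 2 + a4 * x1 + a6"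
    and Q1: "y2 ^ 2 + a1 * x2 * y2 + a3 * y2 = x2 ^ 3 + a2 * x2 ^ 2 + a4 * x2 + a6"
    using P Q by (simp_all add: sel)
  have yx: "y1 = y2 \<and> 2 * y1 + a1 * x1 + a3 \<noteq> 0" if "x1 = x2"
  proof -
    have *: "y2 \<noteq> - y1 - a1 * x1 - a3" using ne that by (simp add: sel)
    have "(y1 - y2) * (y1 + y2 + a1 * x1 + a3)
        = (y1 ^ 2 + a1 * x1 * y1 + a3 * y1) - (y2 ^ 2 + a1 * x1 * y2 + a3 * y2)"
      by (simp add: power2_eq_square algebra_simps)
    also have "\<dots> = 0" using P1 Q1 that by simp
    finally have "(y1 - y2) * (y1 + y2 + a1 * x1 + a3) = 0" .
    moreover have "y1 + y2 + a1 * x1 + a3 \<noteq> 0"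
    proof
      assume "y1 + y2 + a1 * x1 + a3 = 0"
      then have "y2 = - y1 - a1 * x1 - a3" by Groebner_Basis.algebra
      then show False using * by simp
    qed
    ultimately show ?thesis by (simp add: mult_2[symmetric])
  qed
  define l where "l = (if x1 = x2 then (3 * x1 ^ 2 + 2 * a2 * x1 + a4 - a1 * y1) / (2 * y1 + a1 * x1 + a3)
    else (y2 - y1) / (x2 - x1))"
  define c where "c = y1 - l * x1"
  define x3 where "x3 = l ^ 2 + a1 * l - a2 - x1 - x2"
  have y1: "c + l * x1 = y1" by (simp add: c_def)
  have y2: "c + l * x2 = y2"
  proof (cases "x1 = x2")
    case False
    then have "l * (x2 - x1) = y2 - y1" by (simp add: l_def)
    then show ?thesis by (simp add: c_def algebra_simps)
  qed (use yx y1 in simp)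
  \<comment> \<open>\<open>x3\<close> is chosen by Vieta to match the quadratic coefficients, so the
    two sides of the factorization differ by the linear polynomial \<open>[:d0, d1:]\<close>. It
    vanishes at \<open>x1\<close> and \<open>x2\<close>; if these coincide, the tangent slope makes
    its derivative vanish instead.\<close>
  define d1 where "d1 = 2 * c * l + c * a1 + l * a3 - a4 + x1 * x2 + x1 * x3 + x2 * x3"
  define d0 where "d0 = c ^ 2 + c * a3 - a6 - x1 * x2 * x3"
  have "d0 + d1 * x1 = (c + l * x1) ^ 2 + a1 * x1 * (c + l * x1) + a3 * (c + l * x1)
      - (x1 ^ 3 + a2 * x1 ^ 2 + a4 * x1 + a6)"
    by (simp add: d0_def d1_def x3_def power2_eq_square power3_eq_cube algebra_simps)
  then have e1: "d0 + d1 * x1 = 0" using P1 y1 by simp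
  have "d0 + d1 * x2 = (c + l * x2) ^ 2 + a1 * x2 * (c + l * x2) + a3 * (c + l * x2)
      - (x2 ^ 3 + a2 * x2 ^ 2 + a4 * x2 + a6)"
    by (simp add: d0_def d1_def x3_def power2_eq_square power3_eq_cube algebra_simps)
  then have e2: "d0 + d1 * x2 = 0" using Q1 y2 by simp
  have d1: "d1 = 0"
  proof (cases "x1 = x2")
    case False
    have "d1 * (x1 - x2) = (d0 + d1 * x1) - (d0 + d1 * x2)" by (simp add: algebra_simps)
    then show ?thesis using False by (simp add: e1 e2)
  next
    case True
    have "l * (2 * y1 + a1 * x1 + a3) = 3 * x1 ^ 2 + 2 * a2 * x1 + a4 - a1 * y1"
      using conjunct2[OF yx[OF True]] True by (simp add: l_def)
    moreover have "d1 = l * (2 * (c + l * x1) + a1 * x1 + a3)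
        - (3 * x1 ^ 2 + 2 * a2 * x1 + a4 - a1 * (c + l * x1))"
      by (simp add: d1_def x3_def True[symmetric] power2_eq_square algebra_simps)
    ultimately show ?thesis by (simp add: y1)
  qed
  then have d0: "d0 = 0" using e1 by simp
  have N: "[:c, l:] ^ 2 + [:c, l:] * lin - cub = - ([:- x1, 1:] * [:- x2, 1:] * [:- x3, 1:])"
  proof -
    have "[:c, l:] ^ 2 + [:c, l:] * lin - cub + [:- x1, 1:] * [:- x2, 1:] * [:- x3, 1:] = [:d0, d1:]"
      by (simp add: lin_def cub_def sel d0_def d1_def x3_def power2_eq_square algebra_simps)
    also have "\<dots> = 0" by (simp add: d0 d1)
    finally show ?thesis by (simp only: add_eq_0_iff2)
  qed
  have add: "add_point W (Affine x1 y1) (Affine x2 y2) = neg_point (Affine x3 (poly [:c, l:] x3))"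
  proof -
    have "\<not> (x1 = x2 \<and> y1 + y2 + a1 * x2 + a3 = 0)" using yx by (auto simp: mult_2[symmetric])
    then have "add_point W (Affine x1 y1) (Affine x2 y2) = Affine x3 (- (l * (x3 - x1) + y1) - a1 * x3 - a3)"
      by (simp only: add_point.simps sel if_False Let_def l_def[symmetric] x3_def[symmetric])
    then show ?thesis by (simp add: sel c_def algebra_simps)
  qed
  show ?thesis
    by (rule that[OF _ _ N add]) (use y1 y2 in \<open>simp_all add: mult.commute\<close>)
qed

lemma add_neg_point: "add_point W P (neg_point P) = Infinity" "add_point W (neg_point P) P = Infinity"
  by (cases P; simp)+

text \<open>The third point \<open>S\<close> on the line satisfies: the product of the ideals of
  \<open>P\<close>, \<open>Q\<close>, \<open>S\<close> is principal, and so is that of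
  \<open>S\<close> and its negative. Cancelling the class of \<open>S\<close> leaves the negative of
  \<open>S\<close>, which is the sum.\<close>

lemma add_point_place:
  assumes P: "on_curve W P" and Q: "on_curve W Q"
  shows "on_curve W (add_point W P Q) \<and>
    same_class (iprod (place P) (place Q)) (place (add_point W P Q))"
proof (cases "Q = neg_point P \<or> P = Infinity \<or> Q = Infinity")
  case True
  then consider "Q = neg_point P" | "P = Infinity" | "Q = Infinity" by blast
  then show ?thesis
  proof cases
    case 1
    then show ?thesis using place_neg_class[OF P] by (simp add: add_neg_point)
  next
    case 2
    then show ?thesis using Q cideal_place by (simp add: iprod_UNIV same_class_refl)
  next
    case 3
    then show ?thesis using P cideal_place by (cases P) (simp_all add: iprod_UNIV cideal_UNIV same_class_refl)
  qed
next
  case False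
  then obtain x1 y1 x2 y2 where PQ: "P = Affine x1 y1" "Q = Affine x2 y2" by (meson point.exhaust)
  obtain c l x3 where y: "poly [:c, l:] x1 = y1" "poly [:c, l:] x2 = y2"
    and N: "[:c, l:] ^ 2 + [:c, l:] * lin - cub = - ([:- x1, 1:] * [:- x2, 1:] * [:- x3, 1:])"
    and add: "add_point W P Q = neg_point (Affine x3 (poly [:c, l:] x3))"
    using add_point_line[of x1 y1 x2 y2] P Q False unfolding PQ by metis
  define S where "S = Affine x3 (poly [:c, l:] x3)"
  have "poly ([:c, l:] ^ 2 + [:c, l:] * lin - cub) x3 = 0"
    unfolding N poly_minus poly_mult by simp
  then have S: "on_curve W S"
    by (simp add: S_def lin_def cub_def power2_eq_square power3_eq_cube algebra_simps)
  have R: "on_curve W (neg_point S)" by (rule on_curve_neg[OF S])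
  note id = cideal_place[OF P] cideal_place[OF Q] cideal_place[OF S] cideal_place[OF R]
  let ?PQ = "iprod (place P) (place Q)"
  have PQS: "same_class (iprod ?PQ (place S)) UNIV"
    unfolding PQ S_def line_product[OF refl N, unfolded y]
    by (rule same_class_principal) (simp add: zero_prod_def)
  have "same_class ?PQ (iprod ?PQ (iprod (place S) (place (neg_point S))))"
    using same_class_iprod[OF same_class_refl same_class_sym[OF place_neg_class[OF S]], of ?PQ] id
    by (simp add: cideal_iprod cideal_UNIV iprod_UNIV)
  also have "iprod ?PQ (iprod (place S) (place (neg_point S))) = iprod (iprod ?PQ (place S)) (place (neg_point S))"
    using id by (simp add: iprod_assoc cideal_iprod)
  finally have 1: "same_class ?PQ (iprod (iprod ?PQ (place S)) (place (neg_point S)))" .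
  have 2: "same_class (iprod (iprod ?PQ (place S)) (place (neg_point S))) (place (neg_point S))"
    using same_class_iprod[OF PQS same_class_refl, of "place (neg_point S)"] id
    by (simp add: cideal_iprod cideal_UNIV iprod_UNIV)
  show ?thesis using same_class_trans[OF 1 2] R by (simp add: add S_def)
qed

lemma on_curve_add: "on_curve W P \<Longrightarrow> on_curve W Q \<Longrightarrow> on_curve W (add_point W P Q)"
  using add_point_place by blast

text \<open>Points with equal classes have a difference of trivial class, and only
  \<open>Infinity\<close> has a trivial class.\<close>

lemma place_inject:
  assumes "on_curve W P" "on_curve W Q" "same_class (place P) (place Q)"
  shows "P = Q"
proof -
  note Q' = on_curve_neg[OF assms(2)]
  have "same_class (place (add_point W P (neg_point Q))) (iprod (place P) (place (neg_point Q)))"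
    using add_point_place[OF assms(1) Q'] same_class_sym by blast
  moreover have "same_class (iprod (place P) (place (neg_point Q))) (iprod (place Q) (place (neg_point Q)))"
    using same_class_iprod[OF assms(3) same_class_refl] assms Q' cideal_place by blast
  ultimately have "same_class (place (add_point W P (neg_point Q))) UNIV"
    using place_neg_class[OF assms(2)] same_class_trans by blast
  then have "add_point W P (neg_point Q) = Infinity"
    using place_not_principal on_curve_add[OF assms(1) Q'] by blast
  then show "P = Q"
    by (cases P; cases Q) (auto simp: Let_def split: if_splits)
qed

lemma add_point_assoc:
  assumes "on_curve W P" "on_curve W Q" "on_curve W R"
  shows "add_point W (add_point W P Q) R = add_point W P (add_point W Q R)"
proof (rule place_inject)
  note id = assms[THEN cideal_place]
  have PQ: "on_curve W (add_point W P Q)" and QR: "on_curve W (add_point W Q R)"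
    using assms on_curve_add by auto
  show "on_curve W (add_point W (add_point W P Q) R)" "on_curve W (add_point W P (add_point W Q R))"
    using assms PQ QR on_curve_add by auto
  have "same_class (iprod (iprod (place P) (place Q)) (place R)) (iprod (place (add_point W P Q)) (place R))"
    by (rule same_class_iprod[OF conjunct2[OF add_point_place[OF assms(1,2)]] same_class_refl])
      (intro cideal_iprod id cideal_place PQ)+
  from same_class_trans[OF this conjunct2[OF add_point_place[OF PQ assms(3)]]]
  have 1: "same_class (iprod (iprod (place P) (place Q)) (place R)) (place (add_point W (add_point W P Q) R))" .
  have "same_class (iprod (place P) (iprod (place Q) (place R))) (iprod (place P) (place (add_point W Q R)))"
    by (rule same_class_iprod[OF same_class_refl conjunct2[OF add_point_place[OF assms(2,3)]]])
      (intro cideal_iprod id cideal_place QR)+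
  from same_class_trans[OF this conjunct2[OF add_point_place[OF assms(1) QR]]]
  have 2: "same_class (iprod (place P) (iprod (place Q) (place R))) (place (add_point W P (add_point W Q R)))" .
  show "same_class (place (add_point W (add_point W P Q) R)) (place (add_point W P (add_point W Q R)))"
    using same_class_trans[OF same_class_sym[OF 1], unfolded iprod_assoc[OF id], OF 2] .
qed

end

subsection \<open>The finite subfields of an algebraically closed field\<close>

text \<open>Inside an algebraically closed field of prime characteristic \<open>p\<close> and for
  positive \<open>n\<close> this is the subfield with \<open>p^n\<close> elements. For
  \<open>n = 0\<close> it is everything, hence the positivity assumptions below.\<close>

definition frob_fixed :: "nat \<Rightarrow> 'a::field set" where
  "frob_fixed n = {z. z ^ (CHAR('a) ^ n) = z}"

context
  assumes prime_char: "prime CHAR('a::field)"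
begin

lemma frob_fixed_closed:
  fixes x y :: 'a
  shows "x \<in> frob_fixed n \<Longrightarrow> y \<in> frob_fixed n \<Longrightarrow> x + y \<in> frob_fixed n"
    "x \<in> frob_fixed n \<Longrightarrow> - x \<in> frob_fixed n"
    "x \<in> frob_fixed n \<Longrightarrow> y \<in> frob_fixed n \<Longrightarrow> x - y \<in> frob_fixed n"
    "x \<in> frob_fixed n \<Longrightarrow> y \<in> frob_fixed n \<Longrightarrow> x * y \<in> frob_fixed n"
    "x \<in> frob_fixed n \<Longrightarrow> y \<in> frob_fixed n \<Longrightarrow> x / y \<in> frob_fixed n"
    "x \<in> frob_fixed n \<Longrightarrow> x ^ k \<in> frob_fixed n"
proof -
  let ?Q = "CHAR('a) ^ n"
  have add: "(x + y) ^ ?Q = x ^ ?Q + y ^ ?Q" for x y :: 'a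
    by (rule freshmans_dream'[OF prime_char refl])
  have minus: "(- x) ^ ?Q = - (x ^ ?Q)" for x :: 'a
    using add[of x "- x"] prime_char by (simp add: add_eq_0_iff power_0_left prime_gt_0_nat)
  show "x \<in> frob_fixed n \<Longrightarrow> y \<in> frob_fixed n \<Longrightarrow> x + y \<in> frob_fixed n"
    "x \<in> frob_fixed n \<Longrightarrow> - x \<in> frob_fixed n"
    "x \<in> frob_fixed n \<Longrightarrow> y \<in> frob_fixed n \<Longrightarrow> x - y \<in> frob_fixed n"
    using add[of x y] minus add[of x "- y"] by (simp_all add: frob_fixed_def)
  show "x \<in> frob_fixed n \<Longrightarrow> y \<in> frob_fixed n \<Longrightarrow> x * y \<in> frob_fixed n"
    "x \<in> frob_fixed n \<Longrightarrow> y \<in> frob_fixed n \<Longrightarrow> x / y \<in> frob_fixed n"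
    by (simp_all add: frob_fixed_def power_mult_distrib power_divide)
  show "x \<in> frob_fixed n \<Longrightarrow> x ^ k \<in> frob_fixed n"
    by (simp add: frob_fixed_def) (metis power_mult mult.commute)
qed

lemma frob_fixed_0_1: "(0::'a) \<in> frob_fixed n" "(1::'a) \<in> frob_fixed n"
  using prime_char by (simp_all add: frob_fixed_def power_0_left prime_gt_0_nat)

lemma frob_fixed_of_nat: "(of_nat k :: 'a) \<in> frob_fixed n"
  by (induction k) (auto simp: frob_fixed_0_1 frob_fixed_closed)

lemma frob_fixed_numeral: "(numeral k :: 'a) \<in> frob_fixed n"
  using frob_fixed_of_nat[of "numeral k" n] by simp

lemma frob_fixed_mono:
  assumes "m dvd n"
  shows "frob_fixed m \<subseteq> (frob_fixed n :: 'a set)"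
proof -
  obtain k where n: "n = m * k" using assms by blast
  have "x ^ (CHAR('a) ^ (m * k)) = x" if "x ^ (CHAR('a) ^ m) = x" for x :: 'a
  proof (induction k)
    case (Suc k)
    have "x ^ (CHAR('a) ^ (m * Suc k)) = (x ^ (CHAR('a) ^ m)) ^ (CHAR('a) ^ (m * k))"
      by (simp add: power_add power_mult[symmetric])
    then show ?case using Suc that by simp
  qed simp
  then show ?thesis by (auto simp: frob_fixed_def n)
qed

lemma card_frob_fixed_le:
  assumes "n > 0"
  shows "finite (frob_fixed n :: 'a set)" "card (frob_fixed n :: 'a set) \<le> CHAR('a) ^ n"
proof -
  let ?Q = "CHAR('a) ^ n"
  let ?p = "Polynomial.monom 1 ?Q - [:0, 1:] :: 'a poly"
  have Q: "?Q > 1" using prime_gt_1_nat[OF prime_char] assms by (metis one_less_power)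
  have deg: "Polynomial.degree ?p = ?Q"
    unfolding diff_conv_add_uminus by (subst degree_add_eq_left) (use Q in \<open>auto simp: degree_monom_eq\<close>)
  then have p0: "?p \<noteq> 0" using Q by (metis degree_0 not_one_less_zero)
  have eq: "frob_fixed n = {x. poly ?p x = 0}"
    by (auto simp: frob_fixed_def poly_monom)
  show "finite (frob_fixed n :: 'a set)" unfolding eq by (rule poly_roots_finite[OF p0])
  show "card (frob_fixed n :: 'a set) \<le> ?Q"
    using card_poly_roots_bound[OF p0] unfolding eq deg .
qed

end

text \<open>The polynomial \<open>X^Q - X\<close> splits into linear factors, and its derivative is
  -1, so no root is repeated.\<close>

lemma card_frob_fixed:
  assumes pc: "prime CHAR('a::alg_closed_field)" and "n > 0"
  shows "card (frob_fixed n :: 'a set) = CHAR('a) ^ n"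
proof -
  let ?Q = "CHAR('a) ^ n"
  let ?p = "Polynomial.monom 1 ?Q - [:0, 1:] :: 'a poly"
  have Q: "?Q > 1" using prime_gt_1_nat[OF pc] assms(2) by (metis one_less_power)
  have deg: "Polynomial.degree ?p = ?Q"
    unfolding diff_conv_add_uminus by (subst degree_add_eq_left) (use Q in \<open>auto simp: degree_monom_eq\<close>)
  then have p0: "?p \<noteq> 0" using Q by (metis degree_0 not_one_less_zero)
  have "of_nat ?Q = (0::'a)" using assms(2) by (simp add: power_0_left)
  then have der: "pderiv ?p = -1"
    using assms(2) by (simp add: pderiv_diff pderiv_monom pderiv_pCons one_pCons power_0_left)
  obtain A where A: "size A = ?Q" "?p = smult (Polynomial.lead_coeff ?p) (\<Prod>x\<in>#A. [:-x, 1:])"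
    using alg_closed_imp_factorization[OF p0] deg by metis
  have lc: "Polynomial.lead_coeff ?p \<noteq> 0" using p0 by (simp only: leading_coeff_0_iff not_False_eq_True)
  have "count A x \<le> 1" for x
  proof (rule ccontr)
    assume *: "\<not> count A x \<le> 1"
    then obtain B' where B': "A = add_mset x B'"
      by (metis count_inI multi_member_split zero_le)
    with * have "x \<in># B'" by (simp add: Suc_le_eq not_le)
    then obtain B where B: "A = add_mset x (add_mset x B)"
      using B' by (metis multi_member_split)
    have "?p = [:- x, 1:] * ([:- x, 1:] * smult (Polynomial.lead_coeff ?p) (\<Prod>x\<in>#B. [:-x, 1:]))"
      by (subst A(2), subst B) (simp only: image_mset_add_mset prod_mset.add_mset mult_smult_right)
    then obtain h where h: "?p = [:- x, 1:] * ([:- x, 1:] * h)" by blast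
    have "poly (pderiv ?p) x = 0"
      unfolding h pderiv_mult poly_add poly_mult by simp
    then show False unfolding der by simp
  qed
  then have "A = mset_set (set_mset A)"
  proof (intro multiset_eqI)
    fix x assume le: "\<And>x. count A x \<le> 1"
    show "count A x = count (mset_set (set_mset A)) x"
      using le[of x] by (cases "x \<in># A") (simp_all add: order_antisym not_in_iff)
  qed
  then have "size A = card (set_mset A)" by (metis size_mset_set)
  also have "set_mset A = {x. poly ?p x = 0}"
    using lc by (subst A(2)) (auto simp: poly_prod_mset prod_mset_zero_iff)
  also have "\<dots> = frob_fixed n"
    by (auto simp: frob_fixed_def poly_monom)
  finally show ?thesis using A(1) by simp
qed

section \<open>Power sums over finite subfields and middle coefficients of powers\<close>

lemma sum_frob_fixed_power:
  assumes pc: "prime CHAR('a::alg_closed_field)" and n: "n > 0" and i: "i < 2 * (CHAR('a) ^ n - 1)"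
  shows "(\<Sum>x\<in>frob_fixed n. x ^ i) = (if i = CHAR('a) ^ n - 1 then - 1 else 0 :: 'a)"
proof -
  let ?Q = "CHAR('a) ^ n" and ?F = "frob_fixed n :: 'a set"
  have Q: "?Q > 1" using prime_gt_1_nat[OF pc] n by (metis one_less_power)
  have Q0: "of_nat ?Q = (0::'a)" using n by (simp add: power_0_left)
  note card = card_frob_fixed[OF pc n] and fin = card_frob_fixed_le(1)[OF pc n]
  have F0: "0 \<in> ?F" by (rule frob_fixed_0_1[OF pc])
  have one: "x ^ (?Q - 1) = 1" if "x \<in> ?F - {0}" for x
  proof -
    have "x * x ^ (?Q - 1) = x * 1"
      using that power_minus_mult[OF less_trans[OF zero_less_one Q], of x] Q by (simp add: frob_fixed_def mult.commute)
    then show ?thesis using that by simp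
  qed
  show ?thesis
  proof (cases "i = 0")
    case True
    then show ?thesis using Q card Q0 by auto
  next
    case i0: False
    have split: "(\<Sum>x\<in>?F. x ^ i) = (\<Sum>x\<in>?F - {0}. x ^ i)"
      using fin F0 i0 by (simp add: sum.remove[of _ 0] power_0_left)
    show ?thesis
    proof (cases "i = ?Q - 1")
      case True
      have "(\<Sum>x\<in>?F - {0}. x ^ i) = (\<Sum>x\<in>?F - {0}. 1)"
        using one True by (intro sum.cong) auto
      also have "\<dots> = of_nat (?Q - 1)" using fin F0 card by simp
      also have "\<dots> = - 1" using Q Q0 by (simp add: of_nat_diff)
      finally show ?thesis using split True by simp
    next
      case False
      \<comment> \<open>\<open>r\<close> is \<open>i\<close> modulo \<open>Q - 1\<close>. It is
        nonzero because the bound on \<open>i\<close> admits \<open>Q - 1\<close> as its only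
        positive multiple. Then \<open>X^r - 1\<close> has too few roots to vanish on all nonzero
        elements, and some \<open>g\<close> rescales the sum by a factor other than 1.\<close>
      define r where "r = (if i < ?Q - 1 then i else i - (?Q - 1))"
      have r: "0 < r" "r < ?Q - 1" using i i0 False by (auto simp: r_def)
      have xr: "x ^ i = x ^ r" if "x \<in> ?F - {0}" for x
      proof (cases "i < ?Q - 1")
        case False
        then have "x ^ i = x ^ (?Q - 1) * x ^ (i - (?Q - 1))" by (simp flip: power_add)
        then show ?thesis using one[OF that] False by (simp add: r_def)
      qed (simp add: r_def)
      have "\<exists>g\<in>?F - {0}. g ^ r \<noteq> 1"
      proof (rule ccontr)
        assume *: "\<not> ?thesis"
        let ?p = "Polynomial.monom 1 r - 1 :: 'a poly"
        have deg: "Polynomial.degree ?p = r"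
          unfolding diff_conv_add_uminus by (subst degree_add_eq_left) (use r in \<open>auto simp: degree_monom_eq\<close>)
        then have "?p \<noteq> 0" using r by (metis degree_0 less_not_refl)
        have "card (?F - {0}) \<le> card {x. poly ?p x = 0}"
          using poly_roots_finite[OF \<open>?p \<noteq> 0\<close>] * by (intro card_mono) (auto simp: poly_monom)
        then show False
          using card_poly_roots_bound[OF \<open>?p \<noteq> 0\<close>] deg r fin F0 card by simp
      qed
      then obtain g where g: "g \<in> ?F" "g \<noteq> 0" "g ^ r \<noteq> 1" by blast
      have "(\<Sum>x\<in>?F. x ^ i) = (\<Sum>x\<in>?F. (g * x) ^ i)"
        by (rule sum.reindex_bij_witness[of _ "\<lambda>x. g * x" "\<lambda>x. x / g"])
          (use g frob_fixed_closed[OF pc] in auto)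
      also have "\<dots> = g ^ i * (\<Sum>x\<in>?F. x ^ i)"
        by (simp add: power_mult_distrib sum_distrib_left)
      finally have "(g ^ i - 1) * (\<Sum>x\<in>?F. x ^ i) = 0" by (simp add: algebra_simps)
      then show ?thesis using g xr[of g] False by auto
    qed
  qed
qed

lemma sum_frob_fixed_poly:
  assumes pc: "prime CHAR('a::alg_closed_field)" and n: "n > 0"
    and f: "Polynomial.degree (f :: 'a poly) < 2 * (CHAR('a) ^ n - 1)"
  shows "(\<Sum>x\<in>frob_fixed n. poly f x) = - Polynomial.coeff f (CHAR('a) ^ n - 1)"
proof -
  let ?Q = "CHAR('a) ^ n" and ?F = "frob_fixed n :: 'a set" and ?N = "2 * (CHAR('a) ^ n - 1)"
  have Q: "?Q > 1" using prime_gt_1_nat[OF pc] n by (metis one_less_power)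
  have "poly f x = (\<Sum>i<?N. Polynomial.coeff f i * x ^ i)" for x
    unfolding poly_altdef using f
    by (intro sum.mono_neutral_left) (auto simp: coeff_eq_0)
  then have "(\<Sum>x\<in>?F. poly f x) = (\<Sum>x\<in>?F. \<Sum>i<?N. Polynomial.coeff f i * x ^ i)"
    by simp
  also have "\<dots> = (\<Sum>i<?N. Polynomial.coeff f i * (\<Sum>x\<in>?F. x ^ i))"
    unfolding sum_distrib_left by (rule sum.swap)
  also have "\<dots> = (\<Sum>i<?N. if i = ?Q - 1 then - Polynomial.coeff f i else 0)"
    by (intro sum.cong refl) (simp add: sum_frob_fixed_power[OF pc n])
  also have "\<dots> = - Polynomial.coeff f (?Q - 1)" using Q by simp
  finally show ?thesis .
qed

text \<open>Euler's criterion: a square root \<open>w\<close> exists in the large field, and raising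
  it to the power \<open>Q\<close> multiplies it by \<open>v ^ ((Q - 1) div 2)\<close>. So
  \<open>w\<close> lies in the subfield exactly when this factor is 1 or \<open>w\<close> is
  0.\<close>

lemma card_sqrt_frob_fixed:
  assumes pc: "prime CHAR('a::alg_closed_field)" and n: "n > 0" and odd: "odd CHAR('a)"
    and v: "(v :: 'a) \<in> frob_fixed n"
  shows "of_nat (card {y \<in> frob_fixed n. y ^ 2 = v}) = 1 + v ^ ((CHAR('a) ^ n - 1) div 2)"
proof -
  let ?Q = "CHAR('a) ^ n" and ?F = "frob_fixed n :: 'a set"
  have Q: "?Q > 1" using prime_gt_1_nat[OF pc] n by (metis one_less_power)
  have oddQ: "odd ?Q" using odd by simp
  then obtain b where b: "?Q = 2 * b + 1" by (elim oddE)
  then have Q3: "?Q - 1 = 2 * ((?Q - 1) div 2)" "(?Q - 1) div 2 > 0"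
    using Q by simp_all
  have two: "(2 :: 'a) \<noteq> 0"
  proof
    assume "(2 :: 'a) = 0"
    then have "CHAR('a) dvd 2" using of_nat_eq_0_iff_char_dvd[of 2, where 'a='a] by simp
    then have "CHAR('a) \<le> 2" by (rule dvd_imp_le) simp
    then have "CHAR('a) = 2" using prime_gt_1_nat[OF pc] by simp
    then show False using odd by simp
  qed
  show ?thesis
  proof (cases "v = 0")
    case True
    have "{y \<in> ?F. y ^ 2 = v} = {0}" using True frob_fixed_0_1[OF pc] by auto
    then show ?thesis using True Q3 by (simp add: power_0_left)
  next
    case False
    obtain w where w: "w ^ 2 = v" using nth_root_exists[of 2 v] by auto
    then have w0: "w \<noteq> 0" using False by auto
    have ww: "w ^ (?Q - 1) = v ^ ((?Q - 1) div 2)"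
      by (subst Q3(1)) (simp add: power_mult w)
    have wQ: "w ^ ?Q = w * v ^ ((?Q - 1) div 2)"
      using power_minus_mult[OF less_trans[OF zero_less_one Q], of w] Q ww by (simp add: mult.commute)
    have "(v ^ ((?Q - 1) div 2)) ^ 2 = 1"
    proof -
      have "v * (v ^ ((?Q - 1) div 2)) ^ 2 = v * v ^ (?Q - 1)"
        by (subst (2) Q3(1)) (simp add: power_mult[symmetric] mult.commute)
      also have "\<dots> = v ^ ?Q" using power_minus_mult[OF less_trans[OF zero_less_one Q], of v] Q by (simp add: mult.commute)
      also have "\<dots> = v * 1" using v by (simp add: frob_fixed_def)
      finally show ?thesis using False by simp
    qed
    then consider "v ^ ((?Q - 1) div 2) = 1" | "v ^ ((?Q - 1) div 2) = -1"
      using power2_eq_1_iff by blast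
    then show ?thesis
    proof cases
      case 1
      then have "w \<in> ?F" using wQ by (simp add: frob_fixed_def)
      then have "{y \<in> ?F. y ^ 2 = v} = {w, - w}"
        using w frob_fixed_closed[OF pc] by (auto simp: power2_eq_iff)
      moreover have "w \<noteq> - w" using w0 two by (metis add_eq_0_iff2 mult_2 mult_eq_0_iff)
      ultimately show ?thesis using 1 by simp
    next
      case 2
      have "y \<notin> ?F" if "y ^ 2 = v" for y
      proof
        assume "y \<in> ?F"
        then have "- y \<in> ?F" using frob_fixed_closed[OF pc] by blast
        then have "w \<in> ?F" using \<open>y \<in> ?F\<close> that w power2_eq_iff by metis
        then have "w * v ^ ((?Q - 1) div 2) = w" using wQ by (simp add: frob_fixed_def)
        then have "(1::'a) = - 1" using w0 2 by simp
        then show False using two by (metis add.right_inverse one_add_one)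
      qed
      then have *: "{y \<in> ?F. y ^ 2 = v} = {}" by blast
      show ?thesis unfolding * 2 by simp
    qed
  qed
qed

text \<open>Freshman's dream: the power \<open>Q\<close> acts on each monomial separately, so only
  exponents divisible by \<open>Q\<close> survive.\<close>

lemma coeff_power_char:
  fixes f :: "'a::comm_ring_1 poly"
  assumes pc: "prime CHAR('a)"
  shows "Polynomial.coeff (f ^ (CHAR('a) ^ n)) i =
    (if CHAR('a) ^ n dvd i then Polynomial.coeff f (i div CHAR('a) ^ n) ^ (CHAR('a) ^ n) else 0)"
proof -
  let ?Q = "CHAR('a) ^ n" and ?N = "max (Polynomial.degree f) i"
  have Q: "?Q > 0" using pc by (simp add: prime_gt_0_nat)
  have "f ^ ?Q = (\<Sum>k\<le>?N. Polynomial.monom (Polynomial.coeff f k) k) ^ ?Q"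
    by (subst poly_as_sum_of_monoms') simp_all
  also have "\<dots> = (\<Sum>k\<le>?N. Polynomial.monom (Polynomial.coeff f k) k ^ ?Q)"
    by (rule freshmans_dream_sum') (use pc in simp_all)
  also have "\<dots> = (\<Sum>k\<le>?N. Polynomial.monom (Polynomial.coeff f k ^ ?Q) (?Q * k))"
    by (simp add: monom_power mult.commute)
  finally have "Polynomial.coeff (f ^ ?Q) i = (\<Sum>k\<le>?N. if ?Q * k = i then Polynomial.coeff f k ^ ?Q else 0)"
    by (simp add: coeff_sum)
  also have "\<dots> = (if ?Q dvd i then Polynomial.coeff f (i div ?Q) ^ ?Q else 0)"
  proof (cases "?Q dvd i")
    case True
    then obtain j where j: "i = ?Q * j" by blast
    have "j \<le> ?N" using j Q by (metis le_max_iff_disj mult_le_mono1 mult_1 Suc_leI One_nat_def)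
    moreover have "CHAR('a) \<noteq> 0" using pc by auto
    ultimately show ?thesis using Q by (simp add: j)
  next
    case False
    then have "?Q * k \<noteq> i" for k by auto
    then show ?thesis using False by simp
  qed
  finally show ?thesis .
qed

text \<open>The exponents below \<open>3 (p\<^sup>n - 1) / 2\<close> that are congruent to \<open>-1\<close> modulo \<open>p\<^sup>n\<close> consist of
  \<open>p\<^sup>n - 1\<close> alone, so the convolution for the middle coefficient has a single nonzero term.\<close>

lemma middle_coeff_Suc:
  fixes f :: "'a::comm_ring_1 poly"
  assumes pc: "prime CHAR('a)" and odd: "odd CHAR('a)" and deg: "Polynomial.degree f \<le> 3"
  shows "Polynomial.coeff (f ^ ((CHAR('a) ^ Suc n - 1) div 2)) (CHAR('a) ^ Suc n - 1)
    = Polynomial.coeff (f ^ ((CHAR('a) - 1) div 2)) (CHAR('a) - 1) ^ (CHAR('a) ^ n)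
      * Polynomial.coeff (f ^ ((CHAR('a) ^ n - 1) div 2)) (CHAR('a) ^ n - 1)"
proof -
  let ?p = "CHAR('a)" and ?Q = "CHAR('a) ^ n"
  let ?G = "f ^ ((?Q - 1) div 2)" and ?A = "f ^ ((?p - 1) div 2)"
  have p1: "?p > 1" using prime_gt_1_nat[OF pc] .
  have Q: "?Q > 0" "odd ?Q" using p1 odd by auto
  obtain a where a: "?p = 2 * a + 1" using odd by (elim oddE)
  obtain b where b: "?Q = 2 * b + 1" using Q(2) by (elim oddE)
  \<comment> \<open>Both summands are even, so the exponent can be halved term by term. The power of
    \<open>f\<close> then factors as \<open>?A ^ ?Q * ?G\<close>, with
    \<open>coeff_power_char\<close> applicable to the first factor.\<close>
  have N: "?p ^ Suc n - 1 = ?Q * (?p - 1) + (?Q - 1)"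
    using p1 Q by (simp add: algebra_simps)
  have half: "(?p ^ Suc n - 1) div 2 = (?p - 1) div 2 * ?Q + (?Q - 1) div 2"
  proof -
    have "?p ^ Suc n - 1 = 2 * (a * ?Q + b)" unfolding N using a b by (simp add: algebra_simps)
    then show ?thesis using a b by simp
  qed
  \<comment> \<open>With \<open>Q = 2 b + 1\<close> the degree is at most \<open>3 b\<close>,
    whereas \<open>2 Q - 1 = 4 b + 1\<close>.\<close>
  have G: "Polynomial.coeff ?G i = 0" if "i \<ge> 2 * ?Q - 1" for i
  proof (rule coeff_eq_0)
    have "Polynomial.degree ?G \<le> 3 * b"
      using degree_power_le[of f "(?Q - 1) div 2"] deg b
      by (metis add_diff_cancel_right' le_trans mult_le_mono1 nonzero_mult_div_cancel_left numeral_2_eq_2 zero_neq_numeral)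
    then show "Polynomial.degree ?G < i" using that b by simp
  qed
  let ?N = "?p ^ Suc n - 1"
  have "Polynomial.coeff (f ^ ((?p ^ Suc n - 1) div 2)) ?N = Polynomial.coeff (?A ^ ?Q * ?G) ?N"
    unfolding half by (simp add: power_add power_mult)
  also have "\<dots> = (\<Sum>i\<le>?N. Polynomial.coeff (?A ^ ?Q) i * Polynomial.coeff ?G (?N - i))"
    by (rule coeff_mult)
  also have "\<dots> = (\<Sum>i\<in>{?Q * (?p - 1)}. Polynomial.coeff (?A ^ ?Q) i * Polynomial.coeff ?G (?N - i))"
  proof (intro sum.mono_neutral_right ballI)
    show "{?Q * (?p - 1)} \<subseteq> {..?N}" unfolding N by simp
    fix i assume i: "i \<in> {..?N} - {?Q * (?p - 1)}"
    show "Polynomial.coeff (?A ^ ?Q) i * Polynomial.coeff ?G (?N - i) = 0"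
    proof (cases "?Q dvd i")
      case True
      then obtain k where k: "i = ?Q * k" by blast
      have "k < ?p"
      proof (rule ccontr)
        assume "\<not> k < ?p"
        then have "?Q * ?p \<le> ?Q * k" by simp
        moreover have "i < ?Q * ?p"
        proof -
          have "0 < ?Q * ?p" using Q p1 by simp
          moreover have "i \<le> ?Q * ?p - 1" using i by (simp add: mult.commute)
          ultimately show ?thesis by linarith
        qed
        ultimately show False using k by simp
      qed
      moreover have "k \<noteq> ?p - 1" using i k by auto
      ultimately have "k + 2 \<le> ?p" by simp
      then have "?Q * (k + 2) \<le> ?Q * ?p" by (rule mult_le_mono2)
      then have "?N - i \<ge> 2 * ?Q - 1" by (simp add: k algebra_simps)
      then show ?thesis using G by simp
    qed (simp add: coeff_power_char[OF pc])
  qed simp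
  also have "\<dots> = Polynomial.coeff ?A (?p - 1) ^ ?Q * Polynomial.coeff ?G (?Q - 1)"
    unfolding N using Q by (simp add: coeff_power_char[OF pc])
  finally show ?thesis .
qed

lemma middle_coeff:
  fixes f :: "'a::comm_ring_1 poly"
  assumes pc: "prime CHAR('a)" and odd: "odd CHAR('a)" and deg: "Polynomial.degree f \<le> 3"
  shows "Polynomial.coeff (f ^ ((CHAR('a) ^ n - 1) div 2)) (CHAR('a) ^ n - 1)
    = (\<Prod>i<n. Polynomial.coeff (f ^ ((CHAR('a) - 1) div 2)) (CHAR('a) - 1) ^ (CHAR('a) ^ i))"
proof (induction n)
  case (Suc n)
  show ?case unfolding middle_coeff_Suc[OF assms] Suc.IH by (simp add: mult.commute)
qed simp

subsection \<open>Supersingularity and the Hasse invariant\<close>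

text \<open>\<open>d\<close> records a finite field of definition. \<open>locally_finite\<close>
  places every point in a finite group of points over some extension, where torsion can be studied
  through group orders.\<close>

locale frobenius_curve = smooth_weierstrass W for W :: "'a::alg_closed_field weierstrass" +
  fixes d :: nat
  assumes prime_char: "prime CHAR('a)" and odd_char: "odd CHAR('a)" and d_pos: "d > 0"
    and coeffs_fixed: "wc1 W \<in> frob_fixed d" "wc2 W \<in> frob_fixed d" "wc3 W \<in> frob_fixed d"
      "wc4 W \<in> frob_fixed d" "wc6 W \<in> frob_fixed d"
    and locally_finite: "\<exists>n>0. (z :: 'a) \<in> frob_fixed n"
begin

definition fixed_points :: "nat \<Rightarrow> 'a point set" where
  "fixed_points n = {P. on_curve W P \<and> (\<forall>x y. P = Affine x y \<longrightarrow> x \<in> frob_fixed n \<and> y \<in> frob_fixed n)}"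

text \<open>The right-hand side after completing the square in \<open>y\<close>.\<close>

definition square_poly :: "'a poly" where
  "square_poly = cub + smult (1 / 4) (lin ^ 2)"

definition hasse :: 'a where
  "hasse = Polynomial.coeff (square_poly ^ ((CHAR('a) - 1) div 2)) (CHAR('a) - 1)"

lemma two_neq_0: "(2 :: 'a) \<noteq> 0"
proof
  assume "(2 :: 'a) = 0"
  then have "CHAR('a) dvd 2" using of_nat_eq_0_iff_char_dvd[of 2, where 'a='a] by simp
  then have "CHAR('a) \<le> 2" by (rule dvd_imp_le) simp
  then have "CHAR('a) = 2" using prime_gt_1_nat[OF prime_char] by simp
  then show False using odd_char by simp
qed

lemmas frob_fixed = frob_fixed_closed[OF prime_char] frob_fixed_0_1[OF prime_char]
  frob_fixed_numeral[OF prime_char]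

lemma coeffs_frob_fixed:
  assumes "d dvd n"
  shows "wc1 W \<in> frob_fixed n" "wc2 W \<in> frob_fixed n" "wc3 W \<in> frob_fixed n"
    "wc4 W \<in> frob_fixed n" "wc6 W \<in> frob_fixed n"
  using coeffs_fixed frob_fixed_mono[OF prime_char assms] by auto

lemma finite_fixed_points:
  assumes "n > 0"
  shows "finite (fixed_points n)"
proof -
  have "fixed_points n \<subseteq> insert Infinity (case_prod Affine ` (frob_fixed n \<times> frob_fixed n))"
  proof
    fix P assume "P \<in> fixed_points n"
    then show "P \<in> insert Infinity (case_prod Affine ` (frob_fixed n \<times> frob_fixed n))"
      by (cases P) (auto simp: fixed_points_def)
  qed
  then show ?thesis
    using card_frob_fixed_le(1)[OF prime_char assms] finite_subset by fastforce
qed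

text \<open>Euler's criterion counts the points above each \<open>x\<close>. The degree of the
  resulting power is at most \<open>3 (Q - 1) / 2\<close>, which is below the range
  \<open>2 (Q - 1)\<close> of the power sum lemma, so summation leaves minus one middle
  coefficient.\<close>

lemma card_fixed_points:
  assumes n: "n > 0" "d dvd n"
  shows "of_nat (card (fixed_points n)) = 1 - (\<Prod>i<n. hasse ^ (CHAR('a) ^ i))"
proof -
  let ?Q = "CHAR('a) ^ n" and ?F = "frob_fixed n :: 'a set"
  let ?f = "square_poly"
  note fin = card_frob_fixed_le(1)[OF prime_char n(1)]
  have Q: "?Q > 1" using prime_gt_1_nat[OF prime_char] n by (metis one_less_power)
  define Y where "Y = (\<lambda>x. {y \<in> ?F. on_curve W (Affine x y)})"
  have finY: "finite (Y x)" for x using fin by (simp add: Y_def)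
  have pts: "fixed_points n = insert Infinity (case_prod Affine ` Sigma ?F Y)"
  proof (rule Set.set_eqI)
    fix P show "P \<in> fixed_points n \<longleftrightarrow> P \<in> insert Infinity (case_prod Affine ` Sigma ?F Y)"
      by (cases P) (auto simp: fixed_points_def Y_def image_iff simp del: on_curve.simps(2))
  qed
  have "card (case_prod Affine ` Sigma ?F Y) = card (Sigma ?F Y)"
    by (rule card_image) (auto simp: inj_on_def)
  also have "\<dots> = (\<Sum>x\<in>?F. card (Y x))" using fin finY by (simp add: card_SigmaI)
  finally have card: "card (fixed_points n) = Suc (\<Sum>x\<in>?F. card (Y x))"
    unfolding pts using fin finY by (subst card_insert_disjoint) auto
  have cardY: "of_nat (card (Y x)) = 1 + poly ?f x ^ ((?Q - 1) div 2)" if x: "x \<in> ?F" for x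
  proof -
    let ?c = "poly lin x / 2"
    have lin: "poly lin x \<in> ?F" and cub: "poly cub x \<in> ?F"
      using x coeffs_frob_fixed[OF n(2)] by (auto simp: lin_def cub_def intro!: frob_fixed)
    have c: "?c \<in> ?F" using lin by (intro frob_fixed)
    have f: "poly ?f x = poly cub x + ?c ^ 2" by (simp add: square_poly_def power_divide)
    have "(y + ?c) ^ 2 = poly ?f x \<longleftrightarrow> on_curve W (Affine x y)" for y
    proof -
      have "(y + ?c) ^ 2 = poly ?f x \<longleftrightarrow> y ^ 2 + poly lin x * y = poly cub x"
        unfolding f using two_neq_0 by (simp add: power2_sum mult.commute)
      also have "\<dots> \<longleftrightarrow> on_curve W (Affine x y)"
        by (simp add: lin_def cub_def power2_eq_square power3_eq_cube algebra_simps)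
      finally show ?thesis .
    qed
    then have "bij_betw (\<lambda>y. y + ?c) (Y x) {y \<in> ?F. y ^ 2 = poly ?f x}"
      unfolding Y_def using c frob_fixed
      by (intro bij_betw_byWitness[where f' = "\<lambda>y. y - ?c"]) (auto simp del: on_curve.simps, metis diff_add_cancel)
    then have "card (Y x) = card {y \<in> ?F. y ^ 2 = poly ?f x}" by (rule bij_betw_same_card)
    moreover have "poly ?f x \<in> ?F"
      unfolding f by (rule frob_fixed_closed(1)[OF prime_char cub frob_fixed_closed(6)[OF prime_char c]])
    ultimately show ?thesis using card_sqrt_frob_fixed[OF prime_char n(1) odd_char] by simp
  qed
  have deg: "Polynomial.degree ?f \<le> 3"
  proof -
    have "Polynomial.degree (lin ^ 2) \<le> 2"
      using degree_power_le[of lin 2] degree_pCons_le[of "wc3 W" "[:wc1 W:]"] by (simp add: lin_def)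
    then show ?thesis unfolding square_poly_def
      by (intro degree_add_le) (auto simp: cub_def intro: order_trans[OF degree_smult_le])
  qed
  have "of_nat (card (fixed_points n)) = 1 + (\<Sum>x\<in>?F. of_nat (card (Y x)) :: 'a)"
    by (simp add: card)
  also have "\<dots> = 1 + of_nat ?Q + (\<Sum>x\<in>?F. poly (?f ^ ((?Q - 1) div 2)) x)"
    by (simp add: cardY sum.distrib card_frob_fixed[OF prime_char n(1)])
  also have "\<dots> = 1 + (\<Sum>x\<in>?F. poly (?f ^ ((?Q - 1) div 2)) x)"
    using n by (simp add: power_0_left)
  also have "(\<Sum>x\<in>?F. poly (?f ^ ((?Q - 1) div 2)) x) = - Polynomial.coeff (?f ^ ((?Q - 1) div 2)) (?Q - 1)"
  proof (rule sum_frob_fixed_poly[OF prime_char n(1)])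
    have "Polynomial.degree (?f ^ ((?Q - 1) div 2)) \<le> 3 * ((?Q - 1) div 2)"
      using degree_power_le[of ?f "(?Q - 1) div 2"] deg by (meson le_trans mult_le_mono1)
    also have "\<dots> < 2 * (?Q - 1)" using Q by linarith
    finally show "Polynomial.degree (?f ^ ((?Q - 1) div 2)) < 2 * (?Q - 1)" .
  qed
  also have "Polynomial.coeff (?f ^ ((?Q - 1) div 2)) (?Q - 1) = (\<Prod>i<n. hasse ^ (CHAR('a) ^ i))"
    unfolding hasse_def by (rule middle_coeff[OF prime_char odd_char deg])
  finally show ?thesis by simp
qed

definition fixed_group :: "nat \<Rightarrow> 'a point monoid" where
  "fixed_group n = \<lparr>carrier = fixed_points n, monoid.mult = add_point W, one = Infinity\<rparr>"

lemma add_fixed_points: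
  assumes n: "d dvd n" and P: "P \<in> fixed_points n" and Q: "Q \<in> fixed_points n"
  shows "add_point W P Q \<in> fixed_points n"
proof -
  have on: "on_curve W (add_point W P Q)"
    using P Q on_curve_add by (simp add: fixed_points_def)
  show ?thesis
  proof (cases "P = Infinity \<or> Q = Infinity")
    case True
    then have "add_point W P Q = P \<or> add_point W P Q = Q" by (cases P) auto
    then show ?thesis using P Q by auto
  next
    case False
    then obtain x1 y1 x2 y2 where PQ: "P = Affine x1 y1" "Q = Affine x2 y2" by (meson point.exhaust)
    have fixed: "x1 \<in> frob_fixed n" "y1 \<in> frob_fixed n" "x2 \<in> frob_fixed n" "y2 \<in> frob_fixed n"
      using P Q by (simp_all add: fixed_points_def PQ)
    define l where "l = (if x1 = x2 then (3 * x1 ^ 2 + 2 * wc2 W * x1 + wc4 W - wc1 W * y1)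
      / (2 * y1 + wc1 W * x1 + wc3 W) else (y2 - y1) / (x2 - x1))"
    define x3 where "x3 = l ^ 2 + wc1 W * l - wc2 W - x1 - x2"
    define y3 where "y3 = - (l * (x3 - x1) + y1) - wc1 W * x3 - wc3 W"
    have "l \<in> frob_fixed n"
      unfolding l_def using fixed coeffs_frob_fixed[OF n] by (auto intro!: frob_fixed)
    then have x3: "x3 \<in> frob_fixed n"
      unfolding x3_def using fixed coeffs_frob_fixed[OF n] by (intro frob_fixed)
    have y3: "y3 \<in> frob_fixed n"
      unfolding y3_def using fixed coeffs_frob_fixed[OF n] x3 \<open>l \<in> _\<close> by (intro frob_fixed)
    have "add_point W P Q = Infinity \<or> add_point W P Q = Affine x3 y3"
      unfolding PQ add_point.simps Let_def l_def[symmetric] x3_def[symmetric] y3_def[symmetric]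
      by simp
    then show ?thesis
      using on x3 y3 by (auto simp: fixed_points_def simp del: on_curve.simps)
  qed
qed

lemma neg_fixed_points:
  assumes "d dvd n" "P \<in> fixed_points n"
  shows "neg_point P \<in> fixed_points n"
proof -
  have "on_curve W (neg_point P)" using assms on_curve_neg by (simp add: fixed_points_def)
  then show ?thesis using assms coeffs_frob_fixed[OF assms(1)]
    by (cases P) (auto simp: fixed_points_def simp del: on_curve.simps intro!: frob_fixed)
qed

lemma fixed_group:
  assumes "d dvd n"
  shows "group (fixed_group n)"
proof (rule groupI)
  fix P assume P: "P \<in> carrier (fixed_group n)"
  show "\<exists>Q\<in>carrier (fixed_group n). Q \<otimes>\<^bsub>fixed_group n\<^esub> P = \<one>\<^bsub>fixed_group n\<^esub>"
    using P neg_fixed_points[OF assms] add_neg_point by (auto simp: fixed_group_def)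
  show "\<one>\<^bsub>fixed_group n\<^esub> \<otimes>\<^bsub>fixed_group n\<^esub> P = P" by (simp add: fixed_group_def)
next
  show "P \<otimes>\<^bsub>fixed_group n\<^esub> Q \<otimes>\<^bsub>fixed_group n\<^esub> R = P \<otimes>\<^bsub>fixed_group n\<^esub> (Q \<otimes>\<^bsub>fixed_group n\<^esub> R)"
    if "P \<in> carrier (fixed_group n)" "Q \<in> carrier (fixed_group n)" "R \<in> carrier (fixed_group n)" for P Q R
    using that by (simp add: fixed_group_def fixed_points_def add_point_assoc)
next
  show "\<one>\<^bsub>fixed_group n\<^esub> \<in> carrier (fixed_group n)"
    by (simp add: fixed_group_def fixed_points_def)
  show "P \<otimes>\<^bsub>fixed_group n\<^esub> Q \<in> carrier (fixed_group n)"
    if "P \<in> carrier (fixed_group n)" "Q \<in> carrier (fixed_group n)" for P Q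
    using that add_fixed_points[OF assms] by (simp add: fixed_group_def)
qed

lemma mult_point_eq_pow:
  assumes "d dvd n" "P \<in> fixed_points n"
  shows "mult_point W k P = P [^]\<^bsub>fixed_group n\<^esub> k"
proof (induction k)
  case 0
  interpret group "fixed_group n" by (rule fixed_group[OF assms(1)])
  have "P [^]\<^bsub>fixed_group n\<^esub> (0::nat) = \<one>\<^bsub>fixed_group n\<^esub>" by (rule nat_pow_0)
  then show ?case by (simp only: mult_point_def funpow_0) (simp add: fixed_group_def)
next
  case (Suc k)
  interpret group "fixed_group n" by (rule fixed_group[OF assms(1)])
  have "mult_point W (Suc k) P = P \<otimes>\<^bsub>fixed_group n\<^esub> (P [^]\<^bsub>fixed_group n\<^esub> k)"
    using Suc by (simp add: mult_point_def fixed_group_def)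
  also have "\<dots> = P [^]\<^bsub>fixed_group n\<^esub> Suc k"
    using assms(2) by (intro nat_pow_Suc2[symmetric]) (simp add: fixed_group_def)
  finally show ?case .
qed

lemma fixed_points_exhaust:
  assumes "on_curve W P"
  obtains n where "n > 0" "d dvd n" "P \<in> fixed_points n"
proof (cases P)
  case Infinity
  then have "P \<in> fixed_points d" by (simp add: fixed_points_def)
  then show ?thesis by (rule that[OF d_pos dvd_refl])
next
  case (Affine x y)
  obtain m where m: "m > 0" "x \<in> frob_fixed m" using locally_finite[of x] by blast
  obtain k where k: "k > 0" "y \<in> frob_fixed k" using locally_finite[of y] by blast
  have "x \<in> frob_fixed (d * m * k)" "y \<in> frob_fixed (d * m * k)"
    using m k frob_fixed_mono[OF prime_char, of m "d * m * k"] frob_fixed_mono[OF prime_char, of k "d * m * k"]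
    by auto
  then have "P \<in> fixed_points (d * m * k)" using assms Affine by (simp add: fixed_points_def)
  then show ?thesis by (rule that[rotated 2]) (use d_pos m k in simp_all)
qed

lemma no_torsion_if_hasse_0:
  assumes "hasse = 0" and P: "on_curve W P" and tors: "mult_point W CHAR('a) P = Infinity"
  shows "P = Infinity"
proof (rule ccontr)
  assume ne: "P \<noteq> Infinity"
  obtain n where n: "n > 0" "d dvd n" "P \<in> fixed_points n"
    using fixed_points_exhaust[OF P] .
  interpret group "fixed_group n" by (rule fixed_group[OF n(2)])
  have PG: "P \<in> carrier (fixed_group n)" using n by (simp add: fixed_group_def)
  have "P [^]\<^bsub>fixed_group n\<^esub> CHAR('a) = \<one>\<^bsub>fixed_group n\<^esub>"
    using mult_point_eq_pow[OF n(2,3)] tors by (simp add: fixed_group_def)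
  then have "ord P dvd CHAR('a)" using pow_eq_id[OF PG] by simp
  moreover have "ord P \<noteq> 1" using ord_eq_1[OF PG] ne by (simp add: fixed_group_def)
  ultimately have "ord P = CHAR('a)" using prime_char by (metis prime_nat_iff)
  then have "CHAR('a) dvd card (fixed_points n)"
    using ord_dvd_group_order[OF PG] by (simp add: Coset.order_def fixed_group_def)
  then have "of_nat (card (fixed_points n)) = (0::'a)"
    by (simp add: of_nat_eq_0_iff_char_dvd)
  moreover have "(\<Prod>i<n. hasse ^ (CHAR('a) ^ i)) = 0"
    using assms(1) n(1) by (auto intro!: bexI[of _ 0])
  ultimately show False using card_fixed_points[OF n(1,2)] by simp
qed

lemma torsion_if_hasse_nonzero:
  assumes "hasse \<noteq> 0"
  obtains P where "on_curve W P" "P \<noteq> Infinity" "mult_point W CHAR('a) P = Infinity"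
proof -
  let ?p = "CHAR('a)"
  obtain e where e: "e > 0" "hasse \<in> frob_fixed e" using locally_finite by blast
  define B where "B = (\<Prod>i<e. hasse ^ (?p ^ i))"
  have "B \<noteq> 0" using assms by (simp add: B_def)
  have "(\<Prod>i<k. hasse ^ (?p ^ i)) \<in> frob_fixed e" for k
    by (induction k) (auto intro: frob_fixed e)
  then have "B \<in> frob_fixed e" by (simp add: B_def)
  have split: "(\<Prod>i<a + k. hasse ^ (?p ^ i)) = (\<Prod>i<a. hasse ^ (?p ^ i)) * (\<Prod>i<k. hasse ^ (?p ^ (a + i)))" for a k
    by (induction k) (auto simp: mult_ac)
  have periodic: "(\<Prod>i<e * m. hasse ^ (?p ^ i)) = B ^ m" for m
  proof (induction m)
    case (Suc m)
    have "hasse ^ (?p ^ (e * m)) = hasse"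
      using e(2) frob_fixed_mono[OF prime_char, of e "e * m"] by (auto simp: frob_fixed_def)
    then have shift: "hasse ^ (?p ^ (e * m + i)) = hasse ^ (?p ^ i)" for i
      by (simp add: power_add power_mult)
    have "(\<Prod>i<e * Suc m. hasse ^ (?p ^ i)) = (\<Prod>i<e * m. hasse ^ (?p ^ i)) * (\<Prod>i<e. hasse ^ (?p ^ (e * m + i)))"
      using split[of "e * m" e] by (simp add: add.commute)
    then show ?case by (simp add: Suc shift B_def mult.commute)
  qed simp
  have pe: "?p ^ e > 1" using prime_gt_1_nat[OF prime_char] e by (metis one_less_power)
  have "B * B ^ (?p ^ e - 1) = B * 1"
    using \<open>B \<in> frob_fixed e\<close> power_minus_mult[OF less_trans[OF zero_less_one pe], of B]
    by (simp add: frob_fixed_def mult.commute)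
  then have B1: "B ^ (?p ^ e - 1) = 1" using \<open>B \<noteq> 0\<close> by simp
  \<comment> \<open>Taking \<open>e * m\<close> conjugates multiplies to \<open>B ^ m\<close>. The
    factor \<open>?p ^ e - 1\<close> of \<open>m\<close> makes this 1, so that the number of points
    is 0 modulo \<open>p\<close>; the factor \<open>d\<close> keeps the curve defined over the
    extension.\<close>
  define n where "n = e * ((?p ^ e - 1) * d)"
  have n: "n > 0" "d dvd n" using e pe d_pos by (simp_all add: n_def)
  have "of_nat (card (fixed_points n)) = (0::'a)"
    using card_fixed_points[OF n] by (simp only: n_def periodic power_mult B1 power_one diff_self)
  then have dvd: "?p dvd card (fixed_points n)" by (simp add: of_nat_eq_0_iff_char_dvd)
  interpret group "fixed_group n" by (rule fixed_group[OF n(2)])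
  \<comment> \<open>Sylow's theorem with exponent 1 takes the part of Cauchy's theorem.\<close>
  obtain m where m: "card (fixed_points n) = ?p ^ 1 * m" using dvd by auto
  have "finite (carrier (fixed_group n))" using finite_fixed_points[OF n(1)] by (simp add: fixed_group_def)
  then obtain H where H: "subgroup H (fixed_group n)" "card H = ?p"
    using sylow_thm[OF prime_char group_axioms, of 1 m] m by (auto simp: Coset.order_def fixed_group_def)
  have "card H > 1" using H prime_gt_1_nat[OF prime_char] by simp
  then have "H \<noteq> {Infinity}" by auto
  moreover have "Infinity \<in> H" using subgroup.one_closed[OF H(1)] by (simp add: fixed_group_def)
  ultimately obtain P where P: "P \<in> H" "P \<noteq> Infinity" by blast
  have PF: "P \<in> fixed_points n" using subgroup.subset[OF H(1)] P by (auto simp: fixed_group_def)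
  interpret H: group "fixed_group n\<lparr>carrier := H\<rparr>"
    by (rule subgroup.subgroup_is_group[OF H(1) group_axioms])
  have "P [^]\<^bsub>fixed_group n\<^esub> ?p = \<one>\<^bsub>fixed_group n\<^esub>"
    using H.pow_order_eq_1[of P] P H unfolding nat_pow_consistent[symmetric]
    by (simp add: Coset.order_def)
  then have "P [^]\<^bsub>fixed_group n\<^esub> ?p = Infinity" by (simp add: fixed_group_def)
  then show thesis
    using that[of P] PF P mult_point_eq_pow[OF n(2) PF] by (simp add: fixed_points_def)
qed

end


section \<open>Passage from a finite field to its algebraic closure\<close>

lemma CHAR_dvd_CARD: "CHAR('a::finite_field) dvd CARD('a)"
proof -
  \<comment> \<open>Translation by 1 permutes the field and hence fixes the sum of all elements, yet
    changes it by the image of the cardinality.\<close>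
  have "(\<Sum>x\<in>UNIV. x :: 'a) = (\<Sum>x\<in>UNIV. x + 1)"
    by (rule sum.reindex_bij_witness[of _ "\<lambda>x. x + 1" "\<lambda>x. x - 1"]) auto
  then have "of_nat CARD('a) = (0 :: 'a)" by (simp add: sum.distrib)
  then show ?thesis by (simp add: of_nat_eq_0_iff_char_dvd)
qed

lemma CHAR_of_CARD_power:
  assumes "CARD('a::finite_field) = p ^ n" "prime p"
  shows "CHAR('a) = p"
proof -
  have "CHAR('a) dvd p ^ n" using CHAR_dvd_CARD[where 'a='a] assms by simp
  then have "CHAR('a) dvd p" using CHAR_prime prime_dvd_power by blast
  then show ?thesis using assms(2) CHAR_prime primes_dvd_imp_eq by blast
qed

lemma base_change_sel [simp]:
  "wc1 (base_change W) = to_ac (wc1 W)" "wc2 (base_change W) = to_ac (wc2 W)"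
  "wc3 (base_change W) = to_ac (wc3 W)" "wc4 (base_change W) = to_ac (wc4 W)"
  "wc6 (base_change W) = to_ac (wc6 W)"
  by (cases W; simp add: base_change_def)+

lemma elliptic_base_change: "elliptic_curve W \<Longrightarrow> elliptic_curve (base_change W)"
proof -
  have "discriminant (base_change W) = to_ac (discriminant W)"
    by (simp add: discriminant_def Let_def)
  then show "elliptic_curve W \<Longrightarrow> elliptic_curve (base_change W)"
    by (simp add: elliptic_curve_def)
qed

context
  fixes n :: nat
  assumes card: "CARD('k::finite_field) = CHAR('k) ^ n"
begin

lemma n_pos: "n > 0"
proof (rule ccontr)
  assume "\<not> n > 0"
  then have "CARD('k) = 1" using card by simp
  then have "(0::'k) = 1" by (metis (full_types) UNIV_I card_1_singletonE singletonD)
  then show False by simp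
qed

lemma range_to_ac: "range (to_ac :: 'k \<Rightarrow> _) = frob_fixed n"
proof (rule card_subset_eq)
  have pc: "prime CHAR('k alg_closure)" by simp
  show "finite (frob_fixed n :: 'k alg_closure set)"
    by (rule card_frob_fixed_le(1)[OF pc n_pos])
  show "range to_ac \<subseteq> (frob_fixed n :: 'k alg_closure set)"
    using finite_field_power_card_eq_same[where 'a='k] card
    by (auto simp: frob_fixed_def simp flip: to_ac_power)
  have "card (range (to_ac :: 'k \<Rightarrow> _)) = CARD('k)"
    by (simp add: card_image inj_to_ac)
  then show "card (range (to_ac :: 'k \<Rightarrow> _)) = card (frob_fixed n :: 'k alg_closure set)"
    using card_frob_fixed[OF pc n_pos] card by simp
qed

text \<open>The \<open>q\<close>-th power map permutes the finitely many roots of a polynomial over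
  the base field, so the orbit of \<open>z\<close> repeats. Injectivity of the map, here in the
  shape that a power of a difference is 0, makes the repetition start at \<open>z\<close>.\<close>

lemma alg_closure_locally_finite: "\<exists>m>0. (z :: 'k alg_closure) \<in> frob_fixed m"
proof -
  let ?p = "CHAR('k)" and ?q = "CHAR('k) ^ n"
  have pc: "prime CHAR('k alg_closure)" by simp
  obtain f :: "'k poly" where f: "f \<noteq> 0" "poly (map_poly to_ac f) z = 0"
    using alg_closure_algebraic .
  let ?f = "map_poly to_ac f"
  have f0: "?f \<noteq> 0" using f by (simp add: map_poly_eq_0_iff)
  have frob: "poly ?f (u ^ ?q) = poly ?f u ^ ?q" for u
  proof -
    have "poly ?f u ^ ?q = (\<Sum>i\<le>Polynomial.degree ?f. (Polynomial.coeff ?f i * u ^ i) ^ ?q)"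
      unfolding poly_altdef by (rule freshmans_dream_sum') simp_all
    also have "\<dots> = (\<Sum>i\<le>Polynomial.degree ?f. Polynomial.coeff ?f i * (u ^ ?q) ^ i)"
    proof (intro sum.cong refl)
      fix i
      have "to_ac (Polynomial.coeff f i) ^ ?q = to_ac (Polynomial.coeff f i)"
        using finite_field_power_card_eq_same[where 'a='k] card by (simp flip: to_ac_power)
      then show "(Polynomial.coeff ?f i * u ^ i) ^ ?q = Polynomial.coeff ?f i * (u ^ ?q) ^ i"
        by (simp add: power_mult_distrib coeff_map_poly power_mult[symmetric] mult.commute)
    qed
    finally show ?thesis by (simp add: poly_altdef)
  qed
  have root: "poly ?f (z ^ (?q ^ j)) = 0" for j
  proof (induction j)
    case (Suc j)
    have "z ^ (?q ^ Suc j) = (z ^ (?q ^ j)) ^ ?q" by (simp add: power_mult[symmetric] mult.commute)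
    then show ?case using Suc frob by (simp add: power_0_left)
  qed (use f in simp)
  have "range (\<lambda>j. z ^ (?q ^ j)) \<subseteq> {u. poly ?f u = 0}" using root by blast
  then have "finite (range (\<lambda>j. z ^ (?q ^ j)))" using poly_roots_finite[OF f0] finite_subset by blast
  then have "\<not> inj (\<lambda>j. z ^ (?q ^ j))" using finite_imageD infinite_UNIV_nat by blast
  then obtain i j where "z ^ (?q ^ i) = z ^ (?q ^ j)" "i \<noteq> j" by (auto simp: inj_on_def)
  then obtain i k where ik: "z ^ (?q ^ (i + k)) = z ^ (?q ^ i)" "k > 0"
    by (metis less_imp_add_positive linorder_neqE_nat)
  have "(z ^ (?q ^ k) - z) ^ (?p ^ (n * i)) = 0"
  proof -
    have "(z ^ (?q ^ k)) ^ (?p ^ (n * i)) = z ^ (?p ^ (n * i))"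
      using ik by (simp add: power_mult[symmetric] power_add mult.commute)
    moreover have "(z ^ (?q ^ k)) ^ (?p ^ (n * i)) = (z ^ (?q ^ k) - z) ^ (?p ^ (n * i)) + z ^ (?p ^ (n * i))"
      using freshmans_dream'[of "?p ^ (n * i)" "n * i" "z ^ (?q ^ k) - z" z] by simp
    ultimately show ?thesis by simp
  qed
  then have "z ^ (?q ^ k) = z" by simp
  then show ?thesis using ik(2) n_pos
    by (intro exI[of _ "n * k"]) (simp add: frob_fixed_def power_mult)
qed

lemma frobenius_curve_base_change:
  fixes W :: "'k weierstrass"
  assumes "elliptic_curve W" "odd CHAR('k)"
  shows "frobenius_curve (base_change W) n"
proof
  let ?V = "base_change W"
  show "elliptic_curve ?V" by (rule elliptic_base_change[OF assms(1)])
  show "wc1 ?V \<in> frob_fixed n" "wc2 ?V \<in> frob_fixed n" "wc3 ?V \<in> frob_fixed n"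
    "wc4 ?V \<in> frob_fixed n" "wc6 ?V \<in> frob_fixed n"
    using range_to_ac by auto
qed (use assms n_pos alg_closure_locally_finite in simp_all)

text \<open>Over the base field itself the count is one minus a nonempty product of powers of
  \<open>hasse\<close>, which vanishes exactly when \<open>hasse\<close> does.\<close>

lemma char_dvd_card_iff_hasse:
  fixes W :: "'k weierstrass"
  assumes W: "elliptic_curve W" and odd: "odd CHAR('k)"
  shows "CHAR('k) dvd card (rational_points W) - 1 \<longleftrightarrow> frobenius_curve.hasse (base_change W) = 0"
proof -
  let ?V = "base_change W" and ?p = "CHAR('k)"
  interpret frobenius_curve ?V n by (rule frobenius_curve_base_change[OF assms])
  have on: "on_curve ?V (map_point to_ac P) \<longleftrightarrow> on_curve W P" for P
    by (cases P) (simp_all flip: to_ac_mult to_ac_power to_ac_add)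
  have "fixed_points n = map_point to_ac ` rational_points W"
  proof (rule Set.set_eqI)
    fix P show "P \<in> fixed_points n \<longleftrightarrow> P \<in> map_point to_ac ` rational_points W"
    proof (cases P)
      case Infinity
      then show ?thesis by (auto simp: fixed_points_def rational_points_def intro: image_eqI[of _ _ Infinity])
    next
      case (Affine x y)
      show ?thesis
      proof
        assume "P \<in> fixed_points n"
        then have "x \<in> range to_ac" "y \<in> range to_ac" "on_curve ?V P"
          using Affine range_to_ac by (auto simp: fixed_points_def simp del: on_curve.simps)
        then obtain x' y' where "P = map_point to_ac (Affine x' y')" "on_curve ?V P" using Affine by auto
        then show "P \<in> map_point to_ac ` rational_points W"
          using on[of "Affine x' y'"] unfolding rational_points_def by blast
      next
        assume "P \<in> map_point to_ac ` rational_points W"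
        then obtain P' where P': "P = map_point to_ac P'" "on_curve W P'" by (auto simp: rational_points_def)
        then have "on_curve ?V P" using on by simp
        moreover have "x \<in> range to_ac" "y \<in> range to_ac" using P' Affine by (cases P'; auto)+
        ultimately show "P \<in> fixed_points n"
          using Affine range_to_ac by (simp add: fixed_points_def del: on_curve.simps)
      qed
    qed
  qed
  moreover have "inj (map_point (to_ac :: 'k \<Rightarrow> _))" by (rule point.inj_map[OF inj_to_ac])
  ultimately have card_pts: "card (fixed_points n) = card (rational_points W)"
    by (simp add: card_image inj_on_subset)
  have "card (rational_points W) > 0"
  proof -
    have "finite (rational_points W)"
      using finite_fixed_points[OF n_pos] \<open>fixed_points n = _\<close> \<open>inj _\<close>
      by (metis finite_imageD inj_on_subset subset_UNIV)
    moreover have "Infinity \<in> rational_points W" by (simp add: rational_points_def)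
    ultimately show ?thesis by (auto simp: card_gt_0_iff)
  qed
  then have "?p dvd card (rational_points W) - 1 \<longleftrightarrow> of_nat (card (rational_points W)) = (1 :: 'k alg_closure)"
    using of_nat_eq_0_iff_char_dvd[of "card (rational_points W) - 1", where 'a="'k alg_closure"]
    by (simp add: of_nat_diff)
  also have "\<dots> \<longleftrightarrow> hasse = 0"
    using card_fixed_points[OF n_pos dvd_refl] n_pos unfolding card_pts
    by (auto simp: power_0_left)
  finally show ?thesis .
qed

theorem supersingular_iff_card:
  fixes W :: "'k weierstrass"
  assumes W: "elliptic_curve W" and odd: "odd CHAR('k)"
  shows "supersingular W \<longleftrightarrow> CHAR('k) dvd card (rational_points W) - 1"
proof -
  let ?V = "base_change W"
  interpret frobenius_curve ?V n by (rule frobenius_curve_base_change[OF assms])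
  have "hasse = 0 \<longleftrightarrow> supersingular W"
  proof
    have mult0: "mult_point ?V k Infinity = Infinity" for k
      by (induction k) (simp_all add: mult_point_def)
    assume "hasse = 0"
    then show "supersingular W"
      using no_torsion_if_hasse_0 mult0 by (auto simp: supersingular_def rational_points_def)
  next
    assume *: "supersingular W"
    show "hasse = 0"
    proof (rule ccontr)
      assume "hasse \<noteq> 0"
      from torsion_if_hasse_nonzero[OF this] * show False
        by (auto simp: supersingular_def rational_points_def)
    qed
  qed
  then show ?thesis using char_dvd_card_iff_hasse[OF assms] by blast
qed

end

subsection \<open>Prime powers next to powers of two\<close>

text \<open>\<open>p\<close> is 1 or -1 modulo \<open>2 ^ s\<close>, so its square is 1 modulo
  \<open>2 ^ Suc s\<close>. The extra factor 2 is what lets \<open>power_two_cong_imp_eq\<close>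
  compare exponents.\<close>

lemma odd_power_two_cong:
  fixes p :: nat
  assumes "p = 2 ^ s + 1 \<or> p + 1 = 2 ^ s" and s: "s \<ge> 1" and k: "odd k"
  shows "[p ^ k = p] (mod 2 ^ Suc s)"
proof -
  obtain r where r: "k = 2 * r + 1" using k by (elim oddE)
  have "[p ^ 2 = 1] (mod 2 ^ Suc s)"
    using assms(1)
  proof
    assume "p = 2 ^ s + 1"
    then have "p ^ 2 = 2 ^ s * 2 ^ s + 2 ^ Suc s + 1" by (simp add: power2_eq_square algebra_simps)
    also have "2 ^ s * 2 ^ s = 2 ^ Suc s * (2 ^ (s - 1) :: nat)"
      using s by (cases s) simp_all
    finally have "p ^ 2 = 2 ^ Suc s * (2 ^ (s - 1) + 1) + 1" by (simp add: algebra_simps)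
    then show ?thesis by (simp only: cong_def mod_mult_self4) 
  next
    assume p: "p + 1 = 2 ^ s"
    have "2 ^ s * 2 ^ s = p ^ 2 + 2 * p + 1"
      unfolding p[symmetric] by (simp add: power2_eq_square algebra_simps)
    moreover have "2 ^ Suc s = 2 * p + 2" using p by simp
    ultimately have "p ^ 2 + 2 ^ Suc s = 2 ^ s * 2 ^ s + 1" by simp
    also have "2 ^ s * 2 ^ s = 2 ^ Suc s * (2 ^ (s - 1) :: nat)"
      using s by (cases s) simp_all
    finally have e: "p ^ 2 + 2 ^ Suc s = 2 ^ Suc s * 2 ^ (s - 1) + 1" .
    have "p ^ 2 mod 2 ^ Suc s = (p ^ 2 + 2 ^ Suc s) mod 2 ^ Suc s" by (rule mod_add_self2[symmetric])
    also have "\<dots> = 1 mod 2 ^ Suc s" unfolding e by (rule mod_mult_self4)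
    finally show ?thesis by (simp only: cong_def)
  qed
  then have "[(p ^ 2) ^ r * p = 1 ^ r * p] (mod 2 ^ Suc s)" by (intro cong_mult cong_pow cong_refl)
  then show ?thesis by (simp only: r power_mult power_add power_one power_one_right mult_1)
qed

lemma dvd_power_two_cases:
  fixes q :: nat
  assumes "q dvd 2 ^ m"
  obtains s where "s \<le> m" "q = 2 ^ s"
  using assms divides_primepow_nat[OF two_is_prime_nat] by blast

lemma power_two_cong_imp_eq:
  assumes "[(2::nat) ^ m = 2 ^ s] (mod 2 ^ Suc s)" "s \<le> m"
  shows "m = s"
proof (rule ccontr)
  assume "m \<noteq> s"
  then have "(2::nat) ^ Suc s dvd 2 ^ m" using assms(2) by (intro le_imp_power_dvd) simp
  then have "(2::nat) ^ Suc s dvd 2 ^ s" using assms(1) cong_dvd_iff cong_sym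
    by (metis cong_dvd_modulus_nat dvd_refl cong_0_iff cong_trans)
  then show False by (auto dest: dvd_imp_le)
qed

text \<open>Squares are never 3 modulo 4, so \<open>k\<close> is odd. Then \<open>p + 1\<close>
  divides \<open>2 ^ m\<close>, hence is some \<open>2 ^ s\<close>, and the congruence for odd
  powers gives \<open>m = s\<close>.\<close>

lemma mersenne_prime_power:
  fixes p :: nat
  assumes "prime p" "p ^ k + 1 = 2 ^ m" "m \<ge> 2"
  shows "k = 1"
proof -
  have p: "p \<ge> 2" using assms(1) prime_ge_2_nat by blast
  have k0: "k \<noteq> 0"
  proof
    assume "k = 0"
    then have "(2::nat) ^ m = 2 ^ 1" using assms(2) by simp
    then have "m = 1" by (simp only: power_inject_exp one_less_numeral_iff semiring_norm)
    then show False using assms(3) by simp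
  qed
  have "(4::nat) dvd 2 ^ m" using assms(3) le_imp_power_dvd[of 2 m "2::nat"] by simp
  then have mod4: "p ^ k mod 4 = 3" using assms(2) by presburger
  have "odd k"
  proof
    assume "even k"
    then obtain j where "k = 2 * j" by blast
    then have "p ^ k = (p ^ j) ^ 2" by (simp add: power_mult[symmetric] mult.commute)
    moreover have "x ^ 2 mod 4 \<noteq> 3" for x :: nat
    proof (cases "even x")
      case False
      then obtain y where "x = 2 * y + 1" by (elim oddE)
      then have "x ^ 2 = 4 * (y ^ 2 + y) + 1" by (simp add: power2_eq_square)
      then show ?thesis by presburger
    qed (auto elim!: evenE simp: power2_eq_square)
    ultimately show False using mod4 by metis
  qed
  have "p + 1 dvd p ^ k + 1"
  proof -
    have "[int p ^ k = (- 1) ^ k] (mod int p + 1)"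
      by (intro cong_pow) (simp add: cong_iff_dvd_diff)
    then have "int p + 1 dvd int p ^ k + 1" using \<open>odd k\<close> by (simp add: cong_iff_dvd_diff)
    then have "int (p + 1) dvd int (p ^ k + 1)" by (simp add: add.commute)
    then show ?thesis by (simp only: int_dvd_int_iff)
  qed
  then obtain s where s: "s \<le> m" "p + 1 = 2 ^ s"
    using assms(2) dvd_power_two_cases by metis
  have "s \<ge> 1" using s p by (cases s) auto
  then have "[p ^ k = p] (mod 2 ^ Suc s)" using odd_power_two_cong s \<open>odd k\<close> by blast
  then have "[p ^ k + 1 = p + 1] (mod 2 ^ Suc s)" by (intro cong_add cong_refl)
  then have "m = s" using power_two_cong_imp_eq s assms(2) by metis
  then have "p ^ k = p ^ 1" using s assms(2) by simp
  moreover have "1 < p" using p by simp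
  ultimately show "k = 1" by (rule power_inject_exp[THEN iffD1, rotated])
qed

lemma power_two_diff_2:
  assumes "(2::nat) ^ a + 2 = 2 ^ b"
  shows "a = 1"
proof -
  have "a \<noteq> 0"
  proof
    assume "a = 0"
    then have "odd ((2::nat) ^ b)" unfolding assms[symmetric] by simp
    then have "b = 0" by simp
    then show False using assms by simp
  qed
  moreover have "\<not> a \<ge> 2"
  proof
    assume "a \<ge> 2"
    then have a4: "(4::nat) dvd 2 ^ a" using le_imp_power_dvd[of 2 a "2::nat"] by simp
    have "b \<ge> 2"
    proof (rule ccontr)
      assume "\<not> b \<ge> 2"
      then have "(2::nat) ^ b \<le> 2" using power_increasing[of b 1 "2::nat"] by simp
      moreover have "(2::nat) ^ a \<ge> 1" by simp
      ultimately show False using assms by linarith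
    qed
    then have "(4::nat) dvd 2 ^ b" using le_imp_power_dvd[of 2 b "2::nat"] by simp
    then have "(4::nat) dvd 2" using a4 assms dvd_add_right_iff by metis
    then show False by simp
  qed
  ultimately show "a = 1" by linarith
qed

text \<open>For even \<open>k\<close> the number \<open>2 ^ m\<close> is a product of two powers of
  two differing by 2, which leaves \<open>9 = 8 + 1\<close>, the origin of the pair
  \<open>2^6\<close>, \<open>3^4\<close>. For odd \<open>k\<close>, \<open>p - 1\<close> divides
  \<open>2 ^ m\<close>, and the congruence for odd powers gives
  \<open>p = 2 ^ m + 1\<close>.\<close>

lemma fermat_prime_power:
  fixes p :: nat
  assumes "prime p" "p ^ k = 2 ^ m + 1" "m \<ge> 1"
  shows "k = 1 \<or> (p = 3 \<and> k = 2 \<and> m = 3)"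
proof -
  have p: "p \<ge> 2" using assms(1) prime_ge_2_nat by blast
  have k0: "k \<noteq> 0" using assms(2) by (cases k) simp_all
  show ?thesis
  proof (cases "even k")
    case True
    then obtain j where j: "k = 2 * j" by blast
    define x where "x = p ^ j"
    have x2: "x ^ 2 = 2 ^ m + 1" using assms(2) by (simp add: x_def j power_mult[symmetric] mult.commute)
    have "x \<ge> p" unfolding x_def using p k0 j by (intro self_le_power) auto
    then obtain y where y: "x = y + 1" "y \<ge> 1" using p by (metis le_add_diff_inverse2 add_le_imp_le_diff le_trans one_add_one one_le_numeral)
    have yy: "y * (y + 2) = 2 ^ m" using x2 y by (simp add: power2_eq_square)
    then obtain a where a: "y = 2 ^ a" by (metis dvd_power_two_cases dvd_triv_left)
    obtain b where b: "y + 2 = 2 ^ b" using yy by (metis dvd_power_two_cases dvd_triv_right)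
    have "a = 1" using power_two_diff_2 a b by simp
    then have "x = 3" "2 ^ m = (2::nat) ^ 3" using y a yy by simp_all
    then have "m = 3" by (simp only: power_inject_exp one_less_numeral_iff semiring_norm)
    have "p dvd p ^ j" using k0 j by (intro dvd_power) auto
    then have "p dvd 3" using \<open>x = 3\<close> by (simp add: x_def)
    then have "p = 3" using assms(1) primes_dvd_imp_eq[of p 3] by (simp add: numeral_3_eq_3[symmetric])
    have "j = 1" using \<open>x = 3\<close> \<open>p = 3\<close> power_inject_exp[of "3::nat" j 1] by (simp add: x_def)
    then show ?thesis using \<open>p = 3\<close> \<open>m = 3\<close> j by simp
  next
    case False
    have "[p ^ k = 1 ^ k] (mod (p - 1))"
      using p by (intro cong_pow) (simp add: cong_altdef_nat)
    then have "p - 1 dvd 2 ^ m" using assms(2) p by (simp add: cong_altdef_nat)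
    then obtain s where s: "s \<le> m" "p - 1 = 2 ^ s" using dvd_power_two_cases by metis
    then have ps: "p = 2 ^ s + 1" using p by simp
    have "s \<ge> 1"
    proof (rule ccontr)
      assume "\<not> s \<ge> 1"
      then have "p = 2" using ps by simp
      then have "even (2 ^ m + 1 :: nat)" using assms(2) k0 by (metis dvd_power neq0_conv)
      then show False using assms(3) by simp
    qed
    then have "[p ^ k = p] (mod 2 ^ Suc s)" using odd_power_two_cong ps False by blast
    then have "[(2::nat) ^ m + 1 = 2 ^ s + 1] (mod 2 ^ Suc s)" using assms(2) ps by simp
    then have "[(2::nat) ^ m = 2 ^ s] (mod 2 ^ Suc s)" by (simp only: cong_add_rcancel_nat)
    then have "m = s" using power_two_cong_imp_eq s by blast
    then have "p ^ k = p ^ 1" using assms(2) ps by simp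
    moreover have "1 < p" using p by simp
    ultimately have "k = 1" by (rule power_inject_exp[THEN iffD1, rotated])
    then show ?thesis by simp
  qed
qed

text \<open>Writing \<open>m\<close> as \<open>2 ^ n\<close> times an odd number exhibits
  \<open>2 ^ (2 ^ n) + 1\<close> as a divisor of the prime.\<close>

lemma fermat_prime_exponent:
  assumes "prime (2 ^ m + 1 :: nat)" "m \<ge> 1"
  obtains n where "m = 2 ^ n"
proof -
  define n where "n = multiplicity 2 m"
  obtain r where m: "m = 2 ^ n * r" "odd r"
    using multiplicity_decompose'[of m 2] assms(2) unfolding n_def by auto
  have "2 ^ (2 ^ n) + 1 dvd (2 ^ m + 1 :: nat)"
  proof -
    have "[(2 ^ (2 ^ n)) ^ r = (- 1 :: int) ^ r] (mod (2 ^ (2 ^ n) + 1))"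
      by (intro cong_pow) (simp add: cong_iff_dvd_diff)
    then have "(2 ^ (2 ^ n) + 1 :: int) dvd 2 ^ m + 1"
      using m by (simp add: cong_iff_dvd_diff power_mult)
    then have "int (2 ^ (2 ^ n) + 1) dvd int (2 ^ m + 1)" by (simp add: add.commute)
    then show ?thesis by (simp only: int_dvd_int_iff)
  qed
  then have "(2::nat) ^ (2 ^ n) + 1 = 1 \<or> 2 ^ (2 ^ n) + 1 = (2::nat) ^ m + 1"
    using assms(1) by (meson prime_nat_iff)
  then have "(2::nat) ^ (2 ^ n) = 2 ^ m" by simp
  then have "m = 2 ^ n" by (simp only: power_inject_exp one_less_numeral_iff semiring_norm)
  then show thesis by (rule that)
qed

text \<open>The form is never 0 modulo 9, by inspection of residues. This settles characteristic 3
  when the first trace is a square root of \<open>q1\<close> up to sign.\<close>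

lemma eisenstein_power_three:
  fixes x :: int
  assumes "x ^ 2 - x + 1 = 3 ^ b"
  shows "b \<le> 1"
proof (rule ccontr)
  assume "\<not> b \<le> 1"
  then have "(9::int) dvd 3 ^ b" using le_imp_power_dvd[of 2 b "3::int"] by simp
  then have dvd: "9 dvd x ^ 2 - x + 1" using assms by simp
  define r where "r = x mod 9"
  define k where "k = x div 9"
  have x: "x = 9 * k + r" by (simp add: r_def k_def)
  have "x ^ 2 - x + 1 = 9 * (9 * k ^ 2 + 2 * k * r - k) + (r ^ 2 - r + 1)"
    by (simp add: x power2_eq_square algebra_simps)
  then have r9: "9 dvd r ^ 2 - r + 1" using dvd by (metis dvd_add_right_iff dvd_triv_left)
  have "r \<in> {0..8}" by (simp add: r_def)
  also have "{0..8} = {0,1,2,3,4,5,6,7,8::int}" by auto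
  finally show False using r9 by auto
qed

subsection \<open>Quadratic characters and point counts\<close>

text \<open>Cyclicity of the multiplicative group, phrased as a bijection so that sums over nonzero
  elements can be reindexed by exponents.\<close>

lemma finite_field_generator:
  obtains g :: "'a::finite_field" where "bij_betw (\<lambda>i. g ^ i) {..<CARD('a) - 1} (UNIV - {0})"
proof -
  let ?R = "ring_of_type_algebra :: 'a ring"
  have fin: "finite (carrier ?R)" by (simp add: ring_of_type_algebra_def)
  have pow: "x [^]\<^bsub>?R\<^esub> (i::nat) = x ^ i" for x i
    by (induction i) (simp_all add: ring_of_type_algebra_def mult.commute nat_pow_def)
  have carrier: "carrier (Multiplicative_Group.mult_of ?R) = UNIV - {0}"
    by (simp add: ring_of_type_algebra_def)
  interpret R: field ?R by (rule field_from_type_algebra)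
  from R.finite_field_mult_group_has_gen[OF fin]
  obtain g where g: "g \<in> carrier (Multiplicative_Group.mult_of ?R)"
    "carrier (Multiplicative_Group.mult_of ?R) = {g [^]\<^bsub>?R\<^esub> i | i::nat. i \<in> UNIV}" by (rule bexE)
  have gen: "UNIV - {0} = range (\<lambda>i. g ^ i)"
    using g(2) unfolding carrier pow by auto
  have g0: "g \<noteq> 0" using g(1) by (simp add: ring_of_type_algebra_def)
  have N: "CARD('a) - 1 > 0"
  proof -
    have "card {0, 1 :: 'a} \<le> CARD('a)" by (rule card_mono) auto
    then show ?thesis by simp
  qed
  have "g * g ^ (CARD('a) - 1) = g * 1"
    using finite_field_power_card_eq_same[of g] power_minus_mult[of "CARD('a)" g] N
    by (simp add: mult.commute)
  then have "g ^ (CARD('a) - 1) = 1" using g0 by simp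
  then have red: "g ^ i = g ^ (i mod (CARD('a) - 1))" for i
    using power_add[of g "(CARD('a) - 1) * (i div (CARD('a) - 1))" "i mod (CARD('a) - 1)"]
    by (simp add: power_mult)
  have sub: "range (\<lambda>i. g ^ i) \<subseteq> (\<lambda>i. g ^ i) ` {..<CARD('a) - 1}"
  proof
    fix x assume "x \<in> range (\<lambda>i. g ^ i)"
    then obtain i where "x = g ^ i" by blast
    then have "x = g ^ (i mod (CARD('a) - 1))" using red[of i] by (rule trans)
    then show "x \<in> (\<lambda>i. g ^ i) ` {..<CARD('a) - 1}" using N by simp
  qed
  have img: "(\<lambda>i. g ^ i) ` {..<CARD('a) - 1} = UNIV - {0}"
    unfolding gen by (rule equalityI[OF image_mono[OF subset_UNIV] sub])
  have "inj_on (\<lambda>i. g ^ i) {..<CARD('a) - 1}"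
    by (rule eq_card_imp_inj_on) (simp, unfold img, simp add: card_Diff_singleton)
  then show thesis using that img by (simp add: bij_betw_def)
qed

section \<open>The quadratic character and its sums\<close>

definition chi :: "'a::field \<Rightarrow> int" where
  "chi z = (if z = 0 then 0 else if \<exists>w. w ^ 2 = z then 1 else - 1)"

lemma chi_0 [simp]: "chi 0 = 0" and chi_1 [simp]: "chi 1 = 1"
  by (auto simp: chi_def intro: exI[of _ 1])

lemma chi_square: "z \<noteq> 0 \<Longrightarrow> chi (z ^ 2) = 1"
  by (auto simp: chi_def)

lemma chi_cases: "chi z = 0 \<or> chi z = 1 \<or> chi z = -1"
  by (simp add: chi_def)

locale odd_finite_field =
  fixes g :: "'a::finite_field"
  assumes odd_card: "odd CARD('a)"
    and gen: "bij_betw (\<lambda>i. g ^ i) {..<CARD('a) - 1} (UNIV - {0})"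
begin

lemma card_gt_1: "CARD('a) > 1"
proof -
  have "card {0, 1 :: 'a} \<le> CARD('a)" by (rule card_mono) auto
  then show ?thesis by simp
qed

lemma two_neq_0: "(2 :: 'a) \<noteq> 0"
proof
  assume "(2 :: 'a) = 0"
  then have inv: "x + 1 + 1 = x" for x :: 'a by (simp add: add.assoc)
  have "(\<Sum>x\<in>UNIV. x :: 'a) = (\<Sum>x\<in>UNIV. x + 1)"
    by (rule sum.reindex_bij_witness[of _ "\<lambda>x. x + 1" "\<lambda>x. x - 1"]) auto
  then have "of_nat CARD('a) = (0 :: 'a)" by (simp add: sum.distrib)
  moreover obtain k where "CARD('a) = 2 * k + 1" using odd_card by (elim oddE)
  ultimately show False using \<open>(2 :: 'a) = 0\<close> by simp
qed

lemma g_neq_0: "g \<noteq> 0"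
proof (cases "CARD('a) - 1 > 1")
  case True
  then have "g ^ 1 \<in> UNIV - {0}" using gen by (metis bij_betwE lessThan_iff)
  then show ?thesis by simp
next
  case False
  then have "CARD('a) = 2" using card_gt_1 by simp
  then show ?thesis using odd_card by simp
qed

lemma power_card: "x \<noteq> 0 \<Longrightarrow> x ^ (CARD('a) - 1) = (1 :: 'a)"
proof -
  assume "x \<noteq> 0"
  have "x * x ^ (CARD('a) - 1) = x * 1"
    using finite_field_power_card_eq_same[of x] power_minus_mult[of "CARD('a)" x] card_gt_1
    by (simp add: mult.commute)
  then show ?thesis using \<open>x \<noteq> 0\<close> by simp
qed

lemma g_power_eq_iff: "g ^ i = g ^ j \<longleftrightarrow> i mod (CARD('a) - 1) = j mod (CARD('a) - 1)"
proof -
  have red: "g ^ i = g ^ (i mod (CARD('a) - 1))" for i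
    using power_add[of g "(CARD('a) - 1) * (i div (CARD('a) - 1))" "i mod (CARD('a) - 1)"]
      power_card[OF g_neq_0] by (simp add: power_mult)
  have "g ^ (i mod (CARD('a) - 1)) = g ^ (j mod (CARD('a) - 1)) \<longleftrightarrow> i mod (CARD('a) - 1) = j mod (CARD('a) - 1)"
    using card_gt_1 gen by (auto simp: bij_betw_def inj_on_def)
  then show ?thesis using red[of i] red[of j] by simp
qed

lemma g_power_cases:
  assumes "x \<noteq> 0"
  obtains i where "x = g ^ i"
  using assms gen by (auto simp: bij_betw_def)

lemma chi_g: "chi (g ^ i) = (- 1) ^ i"
proof (cases "even i")
  case True
  then obtain j where "i = 2 * j" by blast
  then have "g ^ i = (g ^ j) ^ 2" by (simp add: power_mult[symmetric] mult.commute)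
  then show ?thesis using True g_neq_0 by (simp add: chi_square)
next
  case False
  have "w ^ 2 \<noteq> g ^ i" for w
  proof
    assume w: "w ^ 2 = g ^ i"
    then have "w \<noteq> 0" using g_neq_0 by auto
    then obtain j where "w = g ^ j" by (rule g_power_cases)
    then have "g ^ (2 * j) = g ^ i" using w by (simp add: power_mult[symmetric] mult.commute)
    then have eq: "2 * j mod (CARD('a) - 1) = i mod (CARD('a) - 1)" by (simp add: g_power_eq_iff)
    \<comment> \<open>Exponents of \<open>g\<close> are determined only modulo
      \<open>CARD('a) - 1\<close>; this modulus is even, so their parity is well defined.\<close>
    have "2 dvd CARD('a) - 1" using odd_card by simp
    then have "even (2 * j) \<longleftrightarrow> even i" using eq by (metis dvd_mod_iff)
    then show False using False by simp
  qed
  then show ?thesis using False g_neq_0 by (auto simp: chi_def)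
qed

lemma chi_mult: "chi (x * y) = chi x * chi (y :: 'a)"
proof (cases "x = 0 \<or> y = 0")
  case False
  then obtain i j where "x = g ^ i" "y = g ^ j" by (metis g_power_cases)
  then show ?thesis by (simp only: chi_g flip: power_add)
qed auto

lemma chi_power: "chi (x ^ n) = chi (x :: 'a) ^ n"
  by (induction n) (simp_all add: chi_mult)

lemma card_sqrt: "int (card {y. y ^ 2 = (z :: 'a)}) = 1 + chi z"
proof -
  consider "z = 0" | w where "z \<noteq> 0" "w ^ 2 = z" | "z \<noteq> 0" "\<And>w. w ^ 2 \<noteq> z" by blast
  then show ?thesis
  proof cases
    case 1
    then have "{y. y ^ 2 = z} = {0}" by auto
    then show ?thesis using 1 by simp
  next
    case 2
    then have "{y. y ^ 2 = z} = {w, - w}" by (auto simp: power2_eq_iff)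
    moreover have "w \<noteq> - w"
      using 2 two_neq_0 by (metis add_eq_0_iff2 mult_2 mult_eq_0_iff power_zero_numeral)
    moreover have "chi z = 1" using 2 chi_square[of w] by auto
    ultimately show ?thesis by simp
  next
    case 3
    then have "{y. y ^ 2 = z} = {}" by blast
    then show ?thesis using 3 by (simp add: chi_def)
  qed
qed

lemma sum_of_square: "(\<Sum>s\<in>UNIV. F (s ^ 2)) = (\<Sum>z\<in>UNIV. (1 + chi z) * F (z :: 'a))"
  for F :: "'a \<Rightarrow> int"
proof -
  have "(\<Sum>s\<in>UNIV. F (s ^ 2)) = (\<Sum>z\<in>UNIV. \<Sum>s\<in>{s. s ^ 2 = z}. F (s ^ 2))"
    using sum.group[of UNIV UNIV "\<lambda>s. s ^ 2" "\<lambda>s. F (s ^ 2)"] by simp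
  also have "\<dots> = (\<Sum>z\<in>UNIV. (1 + chi z) * F z)"
    by (intro sum.cong refl) (simp add: card_sqrt)
  finally show ?thesis .
qed

lemma sum_chi: "(\<Sum>z\<in>UNIV. chi (z :: 'a)) = 0"
  using sum_of_square[of "\<lambda>_. 1"] by (simp add: sum.distrib)

lemma sum_shift: "(\<Sum>z\<in>UNIV. F (z + d)) = (\<Sum>z\<in>UNIV. F (z :: 'a))" for F :: "'a \<Rightarrow> int"
  by (rule sum.reindex_bij_witness[of _ "\<lambda>z. z - d" "\<lambda>z. z + d"]) auto

lemma sum_scale: "d \<noteq> 0 \<Longrightarrow> (\<Sum>z\<in>UNIV. F (d * z)) = (\<Sum>z\<in>UNIV. F (z :: 'a))" for F :: "'a \<Rightarrow> int"
  by (rule sum.reindex_bij_witness[of _ "\<lambda>z. z / d" "\<lambda>z. d * z"]) auto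

text \<open>After a shift, the factor \<open>k^2\<close> is pulled out of \<open>k (k + c)\<close>.
  For nonzero \<open>c\<close> the remaining argument \<open>1 + c / k\<close> runs through
  everything except 1, and the full character sum is 0.\<close>

lemma sum_chi_product:
  "(\<Sum>k\<in>UNIV. chi ((k + a) * (k + b))) = (if a = b then int CARD('a) else 0) - (1 :: int)" for a b :: 'a
proof -
  have "(\<Sum>k\<in>UNIV. chi ((k + a) * (k + b))) = (\<Sum>k\<in>UNIV. chi (k * (k + (b - a))))"
    using sum_shift[of "\<lambda>k. chi (k * (k + (b - a)))" a] by (simp add: algebra_simps)
  also have "\<dots> = (\<Sum>k\<in>UNIV - {0}. chi (k * (k + (b - a))))"
    by (rule sum.mono_neutral_right) auto
  also have "\<dots> = (\<Sum>k\<in>UNIV - {0}. chi (1 + (b - a) / k))"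
  proof (intro sum.cong refl)
    fix k :: 'a assume "k \<in> UNIV - {0}"
    then have k: "k \<noteq> 0" by simp
    then have "k * (k + (b - a)) = k ^ 2 * (1 + (b - a) / k)"
      by (simp add: power2_eq_square field_simps)
    then show "chi (k * (k + (b - a))) = chi (1 + (b - a) / k)"
      using k by (simp add: chi_mult chi_square)
  qed
  also have "\<dots> = (if a = b then int CARD('a) else 0) - 1"
  proof (cases "a = b")
    case True
    then show ?thesis using card_gt_1 by (simp add: of_nat_diff)
  next
    case False
    have "bij_betw (\<lambda>k. 1 + (b - a) / k) (UNIV - {0}) (UNIV - {1})"
      by (rule bij_betw_byWitness[where f' = "\<lambda>u. (b - a) / (u - 1)"]) (use False in auto)
    then have "(\<Sum>k\<in>UNIV - {0}. chi (1 + (b - a) / k)) = (\<Sum>u\<in>UNIV - {1}. chi (u :: 'a))"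
      by (rule sum.reindex_bij_betw)
    then show ?thesis using False sum_chi by (simp add: sum_diff1)
  qed
  finally show ?thesis .
qed

lemma sum_chi_square_plus: "(\<Sum>s\<in>UNIV. chi (s ^ 2 + d)) = (if d = 0 then int CARD('a) else 0) - (1 :: int)" for d :: 'a
proof -
  have "(\<Sum>s\<in>UNIV. chi (s ^ 2 + d)) = (\<Sum>z\<in>UNIV. chi (z + d)) + (\<Sum>z\<in>UNIV. chi ((z + 0) * (z + d)))"
    using sum_of_square[of "\<lambda>z. chi (z + d)"] by (simp add: sum.distrib distrib_right chi_mult)
  then show ?thesis using sum_shift[of chi d] sum_chi sum_chi_product[of 0 d] by auto
qed

lemma sum_UNIV_split: "(\<Sum>z\<in>UNIV. F z) = F 0 + (\<Sum>i<CARD('a) - 1. F (g ^ i))" for F :: "'a \<Rightarrow> int"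
proof -
  have "(\<Sum>z\<in>UNIV. F z) = F 0 + (\<Sum>z\<in>UNIV - {0}. F z)" by (simp add: sum.remove)
  also have "(\<Sum>z\<in>UNIV - {0}. F z) = (\<Sum>i<CARD('a) - 1. F (g ^ i))"
    by (rule sum.reindex_bij_betw[OF gen, symmetric])
  finally show ?thesis .
qed

lemma sum_periodic:
  fixes F :: "nat \<Rightarrow> int"
  assumes "\<And>i. F (i + r) = F i"
  shows "(\<Sum>i<m * r. F i) = int m * (\<Sum>i<r. F i)"
proof (induction m)
  case (Suc m)
  have shift: "F (m * r + i) = F i" for i
  proof (induction m)
    case (Suc m)
    then show ?case using assms[of "m * r + i"] by (simp add: add_ac)
  qed simp
  have split: "(\<Sum>i<a + k. F i) = (\<Sum>i<a. F i) + (\<Sum>i<k. F (a + i))" for a k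
    by (induction k) auto
  show ?case using split[of "m * r" r] Suc shift by (simp add: algebra_simps)
qed simp

lemma card_points_short:
  fixes a2 a4 a6 :: 'a
  shows "int (card (rational_points (Weierstrass 0 a2 0 a4 a6)))
    = int CARD('a) + 1 + (\<Sum>x\<in>UNIV. chi (x ^ 3 + a2 * x ^ 2 + a4 * x + a6))"
proof -
  let ?W = "Weierstrass 0 a2 0 a4 a6" and ?f = "\<lambda>x. x ^ 3 + a2 * x ^ 2 + a4 * x + a6"
  have pts: "rational_points ?W = insert Infinity (case_prod Affine ` (SIGMA x:UNIV. {y. y ^ 2 = ?f x}))"
  proof (rule Set.set_eqI)
    fix P show "P \<in> rational_points ?W \<longleftrightarrow>
      P \<in> insert Infinity (case_prod Affine ` (SIGMA x:UNIV. {y. y ^ 2 = ?f x}))"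
      by (cases P) (auto simp: rational_points_def image_iff)
  qed
  have "card (case_prod Affine ` (SIGMA x:UNIV. {y. y ^ 2 = ?f x})) = card (SIGMA x:UNIV. {y. y ^ 2 = ?f x})"
    by (rule card_image) (auto simp: inj_on_def)
  also have "\<dots> = (\<Sum>x\<in>UNIV. card {y. y ^ 2 = ?f x})" by (simp add: card_SigmaI)
  finally have "card (rational_points ?W) = Suc (\<Sum>x\<in>UNIV. card {y. y ^ 2 = ?f x})"
    unfolding pts by (subst card_insert_disjoint) auto
  then show ?thesis by (simp add: card_sqrt sum.distrib)
qed

text \<open>Minus the Frobenius trace of \<open>y^2 = x^3 + k x\<close>, for nonzero
  \<open>k\<close>. Likewise \<open>sextic_sum\<close> belongs to
  \<open>y^2 = x^3 + k\<close>.\<close>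

definition quartic_sum :: "'a \<Rightarrow> int" where
  "quartic_sum k = (\<Sum>x\<in>UNIV. chi (x ^ 3 + k * x))"

definition sextic_sum :: "'a \<Rightarrow> int" where
  "sextic_sum k = (\<Sum>x\<in>UNIV. chi (x ^ 3 + k))"

lemma quartic_sum_0: "quartic_sum 0 = 0"
proof -
  have "chi (x ^ 3) = chi x" for x :: 'a
    using chi_cases[of x] by (auto simp: chi_power)
  then show ?thesis by (simp add: quartic_sum_def sum_chi)
qed

lemma sextic_sum_0: "sextic_sum 0 = 0"
proof -
  have "chi (x ^ 3) = chi x" for x :: 'a
    using chi_cases[of x] by (auto simp: chi_power)
  then show ?thesis by (simp add: sextic_sum_def sum_chi)
qed

text \<open>Passing from \<open>k\<close> to \<open>k u^2\<close> is the quadratic twist by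
  \<open>u\<close>: replacing \<open>x\<close> by \<open>u x\<close> pulls out
  \<open>u^3\<close>.\<close>

lemma quartic_sum_twist:
  assumes "u \<noteq> 0"
  shows "quartic_sum (k * u ^ 2) = chi u * quartic_sum k"
proof -
  have key: "chi (u ^ 2 * (u * z)) = chi u * chi z" for z
    by (simp only: chi_mult chi_square[OF assms] mult_1)
  have "quartic_sum (k * u ^ 2) = (\<Sum>x\<in>UNIV. chi ((u * x) ^ 3 + k * u ^ 2 * (u * x)))"
    unfolding quartic_sum_def by (rule sum_scale[OF assms, symmetric])
  also have "\<dots> = (\<Sum>x\<in>UNIV. chi u * chi (x ^ 3 + k * x))"
  proof (intro sum.cong refl)
    fix x
    have "(u * x) ^ 3 + k * u ^ 2 * (u * x) = u ^ 2 * (u * (x ^ 3 + k * x))"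
      by (simp add: power2_eq_square power3_eq_cube algebra_simps)
    then show "chi ((u * x) ^ 3 + k * u ^ 2 * (u * x)) = chi u * chi (x ^ 3 + k * x)"
      by (simp only: key)
  qed
  finally show ?thesis by (simp add: quartic_sum_def sum_distrib_left)
qed

lemma sextic_sum_twist:
  assumes "u \<noteq> 0"
  shows "sextic_sum (k * u ^ 3) = chi u * sextic_sum k"
proof -
  have key: "chi (u ^ 2 * (u * z)) = chi u * chi z" for z
    by (simp only: chi_mult chi_square[OF assms] mult_1)
  have "sextic_sum (k * u ^ 3) = (\<Sum>x\<in>UNIV. chi ((u * x) ^ 3 + k * u ^ 3))"
    unfolding sextic_sum_def by (rule sum_scale[OF assms, symmetric])
  also have "\<dots> = (\<Sum>x\<in>UNIV. chi u * chi (x ^ 3 + k))"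
  proof (intro sum.cong refl)
    fix x
    have "(u * x) ^ 3 + k * u ^ 3 = u ^ 2 * (u * (x ^ 3 + k))"
      by (simp add: power2_eq_square power3_eq_cube algebra_simps)
    then show "chi ((u * x) ^ 3 + k * u ^ 3) = chi u * chi (x ^ 3 + k)"
      by (simp only: key)
  qed
  finally show ?thesis by (simp add: sextic_sum_def sum_distrib_left)
qed

text \<open>Second moment: once the square is expanded, the sum over \<open>k\<close> is inner and
  has the form of \<open>sum_chi_product\<close>. The constant -1 contributes a product of two
  vanishing character sums, so only the pairs with \<open>y^2 = x^2\<close> remain.\<close>

lemma sum_quartic_sum_square: "(\<Sum>k\<in>UNIV. quartic_sum k ^ 2) =
  (\<Sum>x\<in>UNIV. \<Sum>y | y ^ 2 = x ^ 2. int CARD('a) * chi (x * y :: 'a))"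
proof -
  have "quartic_sum k ^ 2 = (\<Sum>x\<in>UNIV. \<Sum>y\<in>UNIV. chi (x * y) * chi ((k + x ^ 2) * (k + y ^ 2)))" for k
  proof -
    have "chi (x ^ 3 + k * x) * chi (y ^ 3 + k * y) = chi (x * y) * chi ((k + x ^ 2) * (k + y ^ 2))" for x y
      unfolding chi_mult[symmetric]
      by (rule arg_cong[of _ _ chi]) (simp add: power2_eq_square power3_eq_cube algebra_simps)
    then show ?thesis by (simp add: quartic_sum_def power2_eq_square sum_product)
  qed
  then have "(\<Sum>k\<in>UNIV. quartic_sum k ^ 2) =
      (\<Sum>k\<in>(UNIV :: 'a set). \<Sum>x\<in>UNIV. \<Sum>y\<in>UNIV. chi (x * y) * chi ((k + x ^ 2) * (k + y ^ 2)))"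
    by simp
  also have "\<dots> = (\<Sum>x\<in>UNIV. \<Sum>y\<in>UNIV. \<Sum>k\<in>(UNIV :: 'a set). chi (x * y) * chi ((k + x ^ 2) * (k + y ^ 2)))"
    by (rule trans[OF sum.swap], rule sum.cong[OF refl], rule sum.swap)
  also have "\<dots> = (\<Sum>x\<in>(UNIV :: 'a set). \<Sum>y\<in>UNIV. chi (x * y) * ((if x ^ 2 = y ^ 2 then int CARD('a) else 0) - 1))"
    by (simp only: sum_distrib_left[symmetric] sum_chi_product)
  also have "\<dots> = (\<Sum>x\<in>(UNIV :: 'a set). \<Sum>y\<in>UNIV. (if y ^ 2 = x ^ 2 then int CARD('a) * chi (x * y) else 0))
      - (\<Sum>x\<in>UNIV. \<Sum>y\<in>UNIV. chi (x :: 'a) * chi (y :: 'a))"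
    unfolding sum_subtractf[symmetric] by (intro sum.cong refl) (auto simp: chi_mult algebra_simps)
  also have "(\<Sum>x\<in>UNIV. \<Sum>y\<in>UNIV. chi (x :: 'a) * chi (y :: 'a)) = 0"
    by (simp add: sum_distrib_left[symmetric] sum_chi)
  finally show ?thesis by (simp add: sum.If_cases)
qed

lemma sum_sextic_sum_square: "(\<Sum>k\<in>UNIV. sextic_sum k ^ 2) =
  int CARD('a) * (\<Sum>x\<in>UNIV. int (card {y. y ^ 3 = (x :: 'a) ^ 3})) - int CARD('a) ^ 2"
proof -
  have "sextic_sum k ^ 2 = (\<Sum>x\<in>UNIV. \<Sum>y\<in>UNIV. chi ((k + x ^ 3) * (k + y ^ 3)))" for k
    by (simp add: sextic_sum_def power2_eq_square sum_product chi_mult add.commute)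
  then have "(\<Sum>k\<in>UNIV. sextic_sum k ^ 2) =
      (\<Sum>k\<in>(UNIV :: 'a set). \<Sum>x\<in>UNIV. \<Sum>y\<in>UNIV. chi ((k + x ^ 3) * (k + y ^ 3)))"
    by simp
  also have "\<dots> = (\<Sum>x\<in>UNIV. \<Sum>y\<in>UNIV. \<Sum>k\<in>(UNIV :: 'a set). chi ((k + x ^ 3) * (k + y ^ 3)))"
    by (rule trans[OF sum.swap], rule sum.cong[OF refl], rule sum.swap)
  also have "\<dots> = (\<Sum>x\<in>(UNIV :: 'a set). \<Sum>y\<in>UNIV. (if y ^ 3 = x ^ 3 then int CARD('a) else 0) - 1)"
    by (simp only: sum_chi_product eq_commute)
  also have "\<dots> = (\<Sum>x\<in>UNIV. int CARD('a) * int (card {y. y ^ 3 = (x :: 'a) ^ 3})) - int CARD('a) ^ 2"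
    by (simp add: sum_subtractf sum.If_cases power2_eq_square mult.commute)
  finally show ?thesis by (simp add: sum_distrib_left)
qed

text \<open>A shift of the exponent by 2 changes the sign of the sum, so its squares have period 2
  and the second moment determines \<open>quartic_sum 1 ^ 2 + quartic_sum g ^ 2\<close>. The four
  values at \<open>1, g, g^2, g^3\<close> supply both signs.\<close>

lemma quartic_sums:
  assumes q4: "CARD('a) mod 4 = 1"
  obtains A B where "A ^ 2 + B ^ 2 = int CARD('a)"
    "\<And>s. s \<in> {A, - A, B, - B} \<Longrightarrow> \<exists>k. k \<noteq> 0 \<and> quartic_sum k = 2 * s"
proof -
  let ?q = "CARD('a)"
  define m where "m = (?q - 1) div 2"
  have m: "?q - 1 = m * 2" "even m"
    using q4 unfolding m_def by presburger+
  have chi_m1: "chi (- 1 :: 'a) = 1"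
  proof -
    have "(g ^ m) ^ 2 = 1" using power_card[OF g_neq_0] m by (simp add: power_mult)
    moreover have "g ^ m \<noteq> 1"
      using g_power_eq_iff[of m 0] m card_gt_1 by simp
    ultimately have "g ^ m = -1" using power2_eq_1_iff by blast
    then show ?thesis using chi_g[of m] m by simp
  qed
  \<comment> \<open>For nonzero \<open>x\<close> the two solutions \<open>x\<close> and
    \<open>- x\<close> contribute equally, because -1 is a square.\<close>
  have "(\<Sum>y | y ^ 2 = x ^ 2. int ?q * chi (x * y)) = (if x = 0 then 0 else 2 * int ?q)" for x :: 'a
  proof (cases "x = 0")
    case False
    then have "x \<noteq> - x" using two_neq_0 by (metis add_eq_0_iff2 mult_2 mult_eq_0_iff)
    moreover have "{y. y ^ 2 = x ^ 2} = {x, - x}" by (auto simp: power2_eq_iff)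
    moreover have "chi (x * x) = 1" using False chi_square[of x] by (simp add: power2_eq_square)
    moreover have "chi (x * - x) = 1"
      using chi_mult[of "-1" "x * x"] \<open>chi (x * x) = 1\<close> chi_m1 by simp
    ultimately show ?thesis using False by simp
  qed auto
  then have "(\<Sum>k\<in>UNIV. quartic_sum k ^ 2) = (\<Sum>x\<in>(UNIV::'a set). if x = 0 then 0 else 2 * int ?q)"
    unfolding sum_quartic_sum_square by simp
  also have "\<dots> = 2 * int ?q * int (?q - 1)"
    by (simp add: sum.If_cases Collect_neg_eq[symmetric] card_Diff_singleton Compl_eq_Diff_UNIV mult.commute)
  finally have "(\<Sum>i<?q - 1. quartic_sum (g ^ i) ^ 2) = 2 * int ?q * int (?q - 1)"
    using sum_UNIV_split[of "\<lambda>k. quartic_sum k ^ 2"] by (simp add: quartic_sum_0)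
  then have 1: "(\<Sum>i<m * 2. quartic_sum (g ^ i) ^ 2) = 2 * int ?q * int (m * 2)"
    unfolding m(1) .
  have twist: "quartic_sum (g ^ (i + 2)) = - quartic_sum (g ^ i)" for i
    using quartic_sum_twist[OF g_neq_0, of "g ^ i"] chi_g[of 1] by (simp only: power_add) simp
  have "(\<Sum>i<m * 2. quartic_sum (g ^ i) ^ 2) = int m * (\<Sum>i<2. quartic_sum (g ^ i) ^ 2)"
    by (rule sum_periodic) (simp only: twist power2_minus)
  then have "int m * (quartic_sum 1 ^ 2 + quartic_sum g ^ 2) = int m * (4 * int ?q)"
    using 1 by (simp add: numeral_2_eq_2 algebra_simps)
  moreover have "m > 0" using m card_gt_1 by simp
  ultimately have sq: "quartic_sum 1 ^ 2 + quartic_sum g ^ 2 = 4 * int ?q" by simp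
  \<comment> \<open>Two squares with a sum divisible by 4 are both even, which permits halving both
    sums.\<close>
  have par: "x ^ 2 mod 4 = (if even x then 0 else 1)" for x :: int
  proof (cases "even x")
    case False
    then obtain y where "x = 2 * y + 1" by (elim oddE)
    then have "x ^ 2 = 4 * (y ^ 2 + y) + 1" by (simp add: power2_eq_square algebra_simps)
    then show ?thesis using False by presburger
  qed (auto elim!: evenE simp: power2_eq_square)
  have "(quartic_sum 1 ^ 2 mod 4 + quartic_sum g ^ 2 mod 4) mod 4 = 0"
    unfolding mod_add_eq sq by simp
  then have "even (quartic_sum 1)" "even (quartic_sum g)"
    unfolding par by (auto split: if_splits)
  then obtain A B where AB: "quartic_sum 1 = 2 * A" "quartic_sum g = 2 * B" by blast
  show thesis
  proof (rule that[of A B])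
    show "A ^ 2 + B ^ 2 = int ?q" using sq by (simp add: AB power2_eq_square)
    have "quartic_sum (g ^ 2) = 2 * - A" "quartic_sum (g ^ 3) = 2 * - B"
      using twist[of 0] twist[of 1] by (simp_all add: AB numeral_2_eq_2 numeral_3_eq_3)
    then show "\<exists>k. k \<noteq> 0 \<and> quartic_sum k = 2 * s" if "s \<in> {A, - A, B, - B}" for s
      using that AB g_neq_0 by (metis empty_iff insert_iff one_neq_zero power_not_zero)
  qed
qed

text \<open>A shift of the exponent by 3 changes the sign, so the squares have period 3 and the
  second moment gives their sum over one period. With three unknowns instead of two, a linear
  relation is needed in addition.\<close>

lemma sextic_sums:
  assumes q3: "CARD('a) mod 3 = 1"
  obtains A B C where "A + B + C = 0" "A ^ 2 + B ^ 2 + C ^ 2 = 6 * int CARD('a)"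
    "\<And>s. s \<in> {A, - A, B, - B, C, - C} \<Longrightarrow> \<exists>k. k \<noteq> 0 \<and> sextic_sum k = s"
proof -
  let ?q = "CARD('a)"
  define m where "m = (?q - 1) div 3"
  have m: "?q - 1 = m * 3" using q3 unfolding m_def by presburger
  have m0: "m > 0" using m card_gt_1 by simp
  define c where "c = g ^ m"
  have c3: "c ^ 3 = 1" using power_card[OF g_neq_0] m by (simp add: c_def power_mult)
  have c1: "c \<noteq> 1" using g_power_eq_iff[of m 0] m m0 by (simp add: c_def)
  have "(c - 1) * (1 + c + c ^ 2) = 0" using c3 by (simp add: power2_eq_square power3_eq_cube algebra_simps)
  then have cc: "1 + c + c ^ 2 = 0" using c1 by simp
  have "card {y. y ^ 3 = x ^ 3} = (if x = 0 then 1 else 3)" for x :: 'a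
  proof (cases "x = 0")
    case True
    then have "{y. y ^ 3 = x ^ 3} = {0}" by auto
    then show ?thesis using True by simp
  next
    case False
    have "y ^ 3 - x ^ 3 = (y - x) * (y - c * x) * (y - c ^ 2 * x)" for y
      using cc c3 by Groebner_Basis.algebra
    then have "y ^ 3 = x ^ 3 \<longleftrightarrow> y \<in> {x, c * x, c ^ 2 * x}" for y
      by (metis eq_iff_diff_eq_0 insert_iff mult_eq_0_iff singletonD)
    then have "{y. y ^ 3 = x ^ 3} = {x, c * x, c ^ 2 * x}" by blast
    moreover have "c ^ 2 \<noteq> 1"
    proof
      assume "c ^ 2 = 1"
      then have "c ^ 3 = c" by (simp add: power2_eq_square power3_eq_cube)
      then show False using c3 c1 by simp
    qed
    moreover have "c \<noteq> 0" using c3 by auto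
    moreover have "c ^ 2 \<noteq> c" using c1 \<open>c \<noteq> 0\<close> by (simp add: power2_eq_square)
    ultimately show ?thesis using False c1 by simp
  qed
  then have "(\<Sum>x\<in>UNIV. int (card {y. y ^ 3 = (x :: 'a) ^ 3})) = (\<Sum>x\<in>(UNIV :: 'a set). if x = 0 then 1 else 3)"
    by (intro sum.cong) auto
  also have "\<dots> = 1 + 3 * int (?q - 1)"
    by (simp add: sum.If_cases Collect_neg_eq[symmetric] card_Diff_singleton Compl_eq_Diff_UNIV mult.commute)
  finally have "(\<Sum>k\<in>UNIV. sextic_sum k ^ 2) = int ?q * (1 + 3 * int (?q - 1)) - int ?q ^ 2"
    unfolding sum_sextic_sum_square by simp
  also have "\<dots> = 2 * int ?q * int (?q - 1)"
    using card_gt_1 by (simp add: of_nat_diff power2_eq_square algebra_simps)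
  finally have "(\<Sum>i<?q - 1. sextic_sum (g ^ i) ^ 2) = 2 * int ?q * int (?q - 1)"
    using sum_UNIV_split[of "\<lambda>k. sextic_sum k ^ 2"] by (simp add: sextic_sum_0)
  then have 1: "(\<Sum>i<m * 3. sextic_sum (g ^ i) ^ 2) = 2 * int ?q * int (m * 3)"
    unfolding m .
  have twist: "sextic_sum (g ^ (i + 3)) = - sextic_sum (g ^ i)" for i
    using sextic_sum_twist[OF g_neq_0, of "g ^ i"] chi_g[of 1] by (simp only: power_add) simp
  have "(\<Sum>i<m * 3. sextic_sum (g ^ i) ^ 2) = int m * (\<Sum>i<3. sextic_sum (g ^ i) ^ 2)"
    by (rule sum_periodic) (simp only: twist power2_minus)
  then have "int m * (sextic_sum 1 ^ 2 + sextic_sum g ^ 2 + sextic_sum (g ^ 2) ^ 2) = int m * (6 * int ?q)"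
    using 1 by (simp add: numeral_2_eq_2 numeral_3_eq_3 algebra_simps)
  then have sq: "sextic_sum 1 ^ 2 + sextic_sum g ^ 2 + sextic_sum (g ^ 2) ^ 2 = 6 * int ?q" using m0 by simp
  \<comment> \<open>The linear relation: restricting \<open>k\<close> to squares makes the inner sum
    one over \<open>s^2 + x^3\<close>, which is known for each \<open>x\<close>. The total is
    \<open>q - q = 0\<close>.\<close>
  have "(\<Sum>s\<in>UNIV. sextic_sum (s ^ 2)) = (\<Sum>x\<in>UNIV. \<Sum>s\<in>UNIV. chi (s ^ 2 + x ^ 3 :: 'a))"
    unfolding sextic_sum_def by (subst sum.swap) (simp add: add.commute)
  also have "\<dots> = (\<Sum>x\<in>(UNIV :: 'a set). (if x = 0 then int ?q else 0) - 1)"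
    unfolding sum_chi_square_plus by simp
  also have "\<dots> = 0" by (simp add: sum_subtractf)
  finally have "(\<Sum>i<?q - 1. sextic_sum ((g ^ i) ^ 2)) = 0"
    using sum_UNIV_split[of "\<lambda>s. sextic_sum (s ^ 2)"] by (simp add: sextic_sum_0)
  then have "(\<Sum>i<m * 3. sextic_sum ((g ^ i) ^ 2)) = 0" unfolding m .
  moreover have "(\<Sum>i<m * 3. sextic_sum ((g ^ i) ^ 2)) = int m * (\<Sum>i<3. sextic_sum ((g ^ i) ^ 2))"
  proof (rule sum_periodic)
    fix i
    have "(g ^ (i + 3)) ^ 2 = g ^ (2 * i + 3 + 3)" by (simp add: power_mult[symmetric] algebra_simps)
    moreover have "(g ^ i) ^ 2 = g ^ (2 * i)" by (simp add: power_mult[symmetric] mult.commute)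
    ultimately show "sextic_sum ((g ^ (i + 3)) ^ 2) = sextic_sum ((g ^ i) ^ 2)" by (simp only: twist minus_minus)
  qed
  ultimately have "(\<Sum>i<3. sextic_sum ((g ^ i) ^ 2)) = 0" using m0 by simp
  then have "sextic_sum 1 + sextic_sum (g ^ 2) + sextic_sum (g * (g * (g * g))) = 0"
    by (simp add: numeral_3_eq_3 power_mult[symmetric])
  moreover have "g * (g * (g * g)) = g ^ 4" by (simp add: eval_nat_numeral)
  ultimately have lin: "sextic_sum 1 + sextic_sum (g ^ 2) + sextic_sum (g ^ 4) = 0" by simp
  have tw: "sextic_sum (g ^ 3) = - sextic_sum 1" "sextic_sum (g ^ 4) = - sextic_sum g"
    "sextic_sum (g ^ 5) = - sextic_sum (g ^ 2)"
    using twist[of 0] twist[of 1] twist[of 2] by (simp_all add: eval_nat_numeral)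
  show thesis
  \<comment> \<open>The third number is the value at \<open>g ^ 4\<close>, so these are the sums at
    the even exponents, the ones in the linear relation.\<close>
  proof (rule that[of "sextic_sum 1" "sextic_sum (g ^ 2)" "- sextic_sum g"])
    show "sextic_sum 1 + sextic_sum (g ^ 2) + - sextic_sum g = 0" using lin tw by simp
    show "sextic_sum 1 ^ 2 + sextic_sum (g ^ 2) ^ 2 + (- sextic_sum g) ^ 2 = 6 * int ?q" using sq by simp
    show "\<exists>k. k \<noteq> 0 \<and> sextic_sum k = s"
      if "s \<in> {sextic_sum 1, - sextic_sum 1, sextic_sum (g ^ 2), - sextic_sum (g ^ 2),
        - sextic_sum g, - (- sextic_sum g)}" for s
    proof -
      have "s \<in> sextic_sum ` {1, g, g ^ 2, g ^ 3, g ^ 4, g ^ 5}" using that tw by auto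
      then obtain k where k: "k \<in> {1, g, g ^ 2, g ^ 3, g ^ 4, g ^ 5}" "s = sextic_sum k" by blast
      then have "k \<noteq> 0" using g_neq_0 by auto
      then show ?thesis using k(2) by blast
    qed
  qed
qed

end

subsection \<open>Supersingular curves in characteristic two\<close>

text \<open>In characteristic two a point is its own negative exactly when
  \<open>wc1 x + wc3 = 0\<close>. If \<open>wc1\<close> is nonzero this has a solution
  \<open>x\<close>, and the closure contains a matching \<open>y\<close>, so there is a point of
  order 2.\<close>

lemma supersingular_char_2_imp_wc1_0:
  fixes W :: "'a::field_prime_char weierstrass"
  assumes char: "CHAR('a) = 2" and ss: "supersingular W"
  shows "wc1 W = 0"
proof (rule ccontr)
  assume a1: "wc1 W \<noteq> 0"
  let ?V = "base_change W"
  have sel: "wc1 ?V = to_ac (wc1 W)" "wc3 ?V = to_ac (wc3 W)"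
    by (cases W; simp add: base_change_def)+
  have two: "(2 :: 'a alg_closure) = 0"
    using of_nat_CHAR[where 'a = "'a alg_closure"] char by simp
  define x where "x = wc3 ?V / wc1 ?V"
  have lin: "wc1 ?V * x + wc3 ?V = 0"
  proof -
    have "wc1 ?V * x + wc3 ?V = 2 * wc3 ?V" using a1 by (simp add: x_def sel)
    then show ?thesis using two by simp
  qed
  obtain y where y: "y ^ 2 = x ^ 3 + wc2 ?V * x ^ 2 + wc4 ?V * x + wc6 ?V"
    using nth_root_exists[of 2] by auto
  have "y ^ 2 + wc1 ?V * x * y + wc3 ?V * y = y ^ 2 + (wc1 ?V * x + wc3 ?V) * y"
    by (simp add: algebra_simps)
  then have on: "on_curve ?V (Affine x y)" using y lin by simp
  have "y + y + wc1 ?V * x + wc3 ?V = 2 * y + (wc1 ?V * x + wc3 ?V)" by (simp add: algebra_simps)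
  then have "y + y + wc1 ?V * x + wc3 ?V = 0" using lin two by simp
  then have "mult_point ?V 2 (Affine x y) = Infinity"
    by (simp add: mult_point_def numeral_2_eq_2)
  then have "Affine x y \<in> {Infinity}"
    using ss on unfolding supersingular_def char rational_points_def by blast
  then show False by simp
qed

locale char_2_cubic =
  fixes b c d e :: "'a::finite_field"
  assumes char: "CHAR('a) = 2" and b: "b \<noteq> 0"
begin

lemma two [simp]: "(2 :: 'a) = 0"
  using of_nat_CHAR[where 'a = 'a] char by simp

lemma add_self [simp]: "x + x = (0 :: 'a)"
  using mult_2[of x] by simp

lemma add_self_left [simp]: "x + (x + y) = (y :: 'a)"
  by (simp add: add.assoc[symmetric])

lemma square_add: "(x + y) ^ 2 = x ^ 2 + (y :: 'a) ^ 2"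
  by (simp add: power2_sum)

lemma add_eq_iff: "x + y = z \<longleftrightarrow> x = y + (z :: 'a)"
  by (metis add.commute add_self_left)

definition quad :: "'a \<Rightarrow> 'a" where
  "quad y = y ^ 2 + b * y"

text \<open>The additive character of order two with kernel the image of \<open>quad\<close>; in
  closed form, -1 to the absolute trace of \<open>z / b^2\<close>.\<close>

definition psi :: "'a \<Rightarrow> int" where
  "psi z = (if z \<in> range quad then 1 else - 1)"

definition cubic :: "'a \<Rightarrow> 'a" where
  "cubic x = x ^ 3 + c * x ^ 2 + d * x + e"

lemma quad_add: "quad (x + y) = quad x + quad y"
  by (simp add: quad_def square_add algebra_simps)

lemma quad_eq_iff: "quad x = quad y \<longleftrightarrow> x = y \<or> x = y + b"
proof -
  have "quad x = quad y \<longleftrightarrow> quad (x + y) = 0" by (simp add: quad_add add_eq_iff)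
  also have "\<dots> \<longleftrightarrow> (x + y) * (x + y + b) = 0"
    by (simp add: quad_def power2_eq_square algebra_simps)
  also have "\<dots> \<longleftrightarrow> x + y = 0 \<or> x + y = b"
    unfolding mult_eq_0_iff by (metis add.commute add_self add_self_left add_0_right)
  also have "\<dots> \<longleftrightarrow> x = y \<or> x = y + b" by (simp add: add_eq_iff)
  finally show ?thesis .
qed

lemma card_quad: "int (card {y. quad y = z}) = 1 + psi z"
proof (cases "z \<in> range quad")
  case True
  then obtain y where "z = quad y" by blast
  then have "{y. quad y = z} = {y, y + b}" by (auto simp: quad_eq_iff)
  then show ?thesis using True b by (simp add: psi_def)
next
  case False
  then have "{y. quad y = z} = {}" by blast
  then show ?thesis using False by (simp add: psi_def)
qed

lemma sum_psi: "(\<Sum>z\<in>UNIV. psi z) = 0"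
proof -
  have "int CARD('a) = (\<Sum>z\<in>UNIV. \<Sum>y\<in>{y. quad y = z}. 1)"
    using sum.group[of UNIV UNIV quad "\<lambda>_. 1 :: int"] by simp
  also have "\<dots> = (\<Sum>z\<in>UNIV. 1 + psi z)" by (intro sum.cong refl) (simp add: card_quad)
  finally show ?thesis by (simp add: sum.distrib)
qed

lemma range_quad_add: "x \<in> range quad \<Longrightarrow> y \<in> range quad \<Longrightarrow> x + y \<in> range quad"
  by (auto simp flip: quad_add)

text \<open>For \<open>v\<close> outside the image of \<open>quad\<close> the point is that two
  elements outside have their sum inside. As \<open>z\<close> and \<open>z + v\<close> are never
  both inside, a certain sum vanishes; removing its parts with zero total leaves a vanishing sum of
  the nonnegative terms \<open>1 + psi z * psi (z + v)\<close>.\<close>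

lemma psi_add: "psi (u + v) = psi u * psi v"
proof (cases "v \<in> range quad")
  case True
  have "u \<in> range quad" if "u + v \<in> range quad"
    using range_quad_add[OF that True] by (simp add: add.assoc)
  then have "u + v \<in> range quad \<longleftrightarrow> u \<in> range quad" using True range_quad_add by blast
  then show ?thesis using True by (simp add: psi_def)
next
  case False
  have "z + v \<notin> range quad" if z: "z \<in> range quad" for z
  proof
    assume "z + v \<in> range quad"
    from range_quad_add[OF z this] show False using False by simp
  qed
  then have "(1 + psi z) * (1 + psi (z + v)) = 0" for z by (simp add: psi_def)
  then have "(\<Sum>z\<in>UNIV. (1 + psi z) * (1 + psi (z + v))) = 0"
    by (intro sum.neutral ballI)
  moreover have "(\<Sum>z\<in>UNIV. (1 + psi z) * (1 + psi (z + v)))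
      = (\<Sum>z\<in>UNIV. psi z) + (\<Sum>z\<in>UNIV. psi (z + v)) + (\<Sum>z\<in>UNIV. 1 + psi z * psi (z + v))"
    by (simp add: algebra_simps sum.distrib)
  moreover have "(\<Sum>z\<in>UNIV. psi (z + v)) = (\<Sum>z\<in>UNIV. psi z)"
    by (rule sum.reindex_bij_witness[of _ "\<lambda>z. z - v" "\<lambda>z. z + v"]) auto
  ultimately have "(\<Sum>z\<in>UNIV. 1 + psi z * psi (z + v)) = 0" by (simp add: sum_psi)
  moreover have "0 \<le> 1 + psi z * psi (z + v)" for z by (simp add: psi_def)
  ultimately have "1 + psi u * psi (u + v) = 0"
    using sum_nonneg_eq_0_iff[of UNIV "\<lambda>z. 1 + psi z * psi (z + v)"] by simp
  then show ?thesis using False by (auto simp: psi_def split: if_splits)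
qed

lemma sum_psi_scale: "(\<Sum>x\<in>UNIV. psi (x * k)) = (if k = 0 then int CARD('a) else 0)"
proof (cases "k = 0")
  case True
  have "quad 0 = 0" by (simp add: quad_def)
  then have "psi 0 = 1" unfolding psi_def by (metis rangeI)
  then show ?thesis using True by simp
next
  case False
  then have "(\<Sum>x\<in>UNIV. psi (x * k)) = (\<Sum>x\<in>UNIV. psi x)"
    by (intro sum.reindex_bij_witness[of _ "\<lambda>x. x / k" "\<lambda>x. x * k"]) auto
  then show ?thesis using False by (simp add: sum_psi)
qed

definition trace_sum :: int where
  "trace_sum = (\<Sum>x\<in>UNIV. psi (cubic x))"

text \<open>Squaring and differencing: the sum of the values at \<open>x\<close> and
  \<open>x + h\<close> is a term in \<open>h\<close> plus \<open>x^2 h + x h^2\<close>, in which the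
  cube of \<open>x\<close> has cancelled.\<close>

lemma trace_sum_square:
  obtains M where "trace_sum ^ 2 = int CARD('a) * M" "M \<le> 4"
proof -
  define E where "E = (\<lambda>h. h ^ 3 + c * h ^ 2 + d * h)"
  have cub: "cubic x + cubic (x + h) = E h + (x ^ 2 * h + x * h ^ 2)" for x h
  proof -
    have "cubic x + cubic (x + h) = E h + (x ^ 2 * h + x * h ^ 2)
        + 2 * (x ^ 3 + x ^ 2 * h + x * h ^ 2 + c * x ^ 2 + c * x * h + d * x + e)"
      by (simp add: cubic_def E_def power2_eq_square power3_eq_cube algebra_simps del: two add_self add_self_left)
    then show ?thesis by simp
  qed
  have inj: "inj (\<lambda>h :: 'a. h ^ 2)"
  proof (rule injI)
    fix x y :: 'a assume "x ^ 2 = y ^ 2"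
    then have "(x + y) ^ 2 = 0" by (simp add: square_add)
    then show "x = y" by (simp add: add_eq_iff)
  qed
  then have bij: "bij (\<lambda>h :: 'a. h ^ 2)" by (simp add: bij_def finite_UNIV_inj_surj)
  have "trace_sum ^ 2 = (\<Sum>x\<in>UNIV. \<Sum>y\<in>UNIV. psi (cubic x + cubic y))"
    by (simp add: trace_sum_def power2_eq_square sum_product psi_add)
  also have "\<dots> = (\<Sum>x\<in>UNIV. \<Sum>h\<in>UNIV. psi (cubic x + cubic (x + h)))"
  proof (rule sum.cong[OF refl])
    fix x
    show "(\<Sum>y\<in>UNIV. psi (cubic x + cubic y)) = (\<Sum>h\<in>UNIV. psi (cubic x + cubic (x + h)))"
      by (rule sum.reindex_bij_witness[of _ "\<lambda>h. x + h" "\<lambda>y. y - x"]) auto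
  qed
  also have "\<dots> = (\<Sum>h\<in>UNIV. psi (E h) * (\<Sum>x\<in>UNIV. psi (x ^ 2 * h + x * h ^ 2)))"
    by (subst sum.swap) (simp add: cub psi_add sum_distrib_left)
  \<comment> \<open>Squaring is bijective, so \<open>h = r^2\<close> may be substituted. Then
    \<open>x^2 r^2\<close> differs from \<open>b x r\<close> by a value of \<open>quad\<close>, the
    argument becomes linear in \<open>x\<close>, and the inner sum vanishes unless
    \<open>b r + r^4 = 0\<close>.\<close>
  also have "\<dots> = (\<Sum>r\<in>UNIV. psi (E (r ^ 2)) * (\<Sum>x\<in>UNIV. psi (x ^ 2 * r ^ 2 + x * (r ^ 2) ^ 2)))"
    by (rule sum.reindex_bij_betw[OF bij, symmetric])
  also have "\<dots> = (\<Sum>r\<in>UNIV. psi (E (r ^ 2)) * (if b * r + r ^ 4 = 0 then int CARD('a) else 0))"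
  proof (intro sum.cong refl)
    fix r
    have "psi (x ^ 2 * r ^ 2 + x * (r ^ 2) ^ 2) = psi (x * (b * r + r ^ 4))" for x
    proof -
      have "x ^ 2 * r ^ 2 + x * (r ^ 2) ^ 2 = quad (x * r) + x * (b * r + r ^ 4)"
        by (simp add: quad_def power_mult_distrib algebra_simps flip: power_mult)
      moreover have "psi (quad (x * r)) = 1" by (simp add: psi_def)
      ultimately show ?thesis by (simp add: psi_add)
    qed
    then show "psi (E (r ^ 2)) * (\<Sum>x\<in>UNIV. psi (x ^ 2 * r ^ 2 + x * (r ^ 2) ^ 2))
        = psi (E (r ^ 2)) * (if b * r + r ^ 4 = 0 then int CARD('a) else 0)"
      by (simp add: sum_psi_scale)
  qed
  also have "\<dots> = int CARD('a) * (\<Sum>r | b * r + r ^ 4 = 0. psi (E (r ^ 2)))"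
    by (simp add: sum.If_cases sum_distrib_left if_distrib mult.commute cong: if_cong)
  finally have "trace_sum ^ 2 = int CARD('a) * (\<Sum>r | b * r + r ^ 4 = 0. psi (E (r ^ 2)))" .
  moreover have "(\<Sum>r | b * r + r ^ 4 = 0. psi (E (r ^ 2))) \<le> 4"
  proof -
    have "(\<Sum>r | b * r + r ^ 4 = 0. psi (E (r ^ 2))) \<le> (\<Sum>r | b * r + r ^ 4 = 0. 1)"
      by (rule sum_mono) (simp add: psi_def)
    also have "\<dots> = int (card {r. b * r + r ^ 4 = 0})" by simp
    also have "\<dots> \<le> 4"
    proof -
      have "{r. b * r + r ^ 4 = 0} = {r. poly [:0, b, 0, 0, 1:] r = 0}"
        by (auto simp: eval_nat_numeral algebra_simps)
      then show ?thesis using card_poly_roots_bound[of "[:0, b, 0, 0, 1:]"] by simp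
    qed
    finally show ?thesis .
  qed
  ultimately show thesis by (rule that)
qed

lemma card_points:
  "int (card (rational_points (Weierstrass 0 c b d e))) = int CARD('a) + 1 + trace_sum"
proof -
  let ?W = "Weierstrass 0 c b d e"
  have pts: "rational_points ?W = insert Infinity (case_prod Affine ` (SIGMA x:UNIV. {y. quad y = cubic x}))"
  proof (rule Set.set_eqI)
    fix P show "P \<in> rational_points ?W \<longleftrightarrow>
      P \<in> insert Infinity (case_prod Affine ` (SIGMA x:UNIV. {y. quad y = cubic x}))"
      by (cases P) (auto simp: rational_points_def image_iff quad_def cubic_def)
  qed
  have "card (case_prod Affine ` (SIGMA x:UNIV. {y. quad y = cubic x})) = card (SIGMA x:UNIV. {y. quad y = cubic x})"
    by (rule card_image) (auto simp: inj_on_def)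
  also have "\<dots> = (\<Sum>x\<in>UNIV. card {y. quad y = cubic x})" by (simp add: card_SigmaI)
  finally have "card (rational_points ?W) = Suc (\<Sum>x\<in>UNIV. card {y. quad y = cubic x})"
    unfolding pts by (subst card_insert_disjoint) auto
  then show ?thesis by (simp add: card_quad sum.distrib trace_sum_def)
qed

end

theorem supersingular_char_2_trace:
  fixes W :: "'a::finite_field weierstrass"
  assumes char: "CHAR('a) = 2" and "elliptic_curve W" "supersingular W"
  obtains M where "(int CARD('a) + 1 - int (card (rational_points W))) ^ 2 = int CARD('a) * M" "M \<le> 4"
proof -
  have a1: "wc1 W = 0" by (rule supersingular_char_2_imp_wc1_0[OF char assms(3)])
  have "(2 :: 'a) = 0" using of_nat_CHAR[where 'a = 'a] char by simp
  then have even: "of_nat (2 * n) = (0 :: 'a)" for n by simp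
  \<comment> \<open>With \<open>wc1 W = 0\<close> in characteristic two, \<open>b2\<close> and
    \<open>b4\<close> vanish and \<open>b6\<close> is \<open>wc3 W ^ 2\<close>, so nothing of the
    discriminant survives once \<open>wc3 W\<close> is 0.\<close>
  have a3: "wc3 W \<noteq> 0"
  proof
    assume "wc3 W = 0"
    then have "discriminant W = of_nat (2 * 0)"
      using a1 even[of 2] even[of 4] by (simp add: discriminant_def Let_def)
    then show False using assms(2) by (simp add: elliptic_curve_def)
  qed
  interpret char_2_cubic "wc3 W" "wc2 W" "wc4 W" "wc6 W"
    by unfold_locales (use char a3 in auto)
  obtain M where M: "trace_sum ^ 2 = int CARD('a) * M" "M \<le> 4" by (rule trace_sum_square)
  have "W = Weierstrass 0 (wc2 W) (wc3 W) (wc4 W) (wc6 W)" using a1 by (cases W) simp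
  then have "int CARD('a) + 1 - int (card (rational_points W)) = - trace_sum"
    using card_points by simp
  then show thesis using that M by simp
qed

subsection \<open>Uniqueness of representations by binary quadratic forms\<close>

lemma prime_power_dvd_mult_cases:
  fixes x y :: int
  assumes "prime p" "p ^ b dvd x * y" "\<not> (p dvd x \<and> p dvd y)"
  shows "p ^ b dvd x \<or> p ^ b dvd y"
proof (cases "p dvd x")
  case True
  then have "coprime (p ^ b) y" using assms prime_imp_coprime by (metis coprime_power_left_iff)
  then show ?thesis using assms(2) by (simp add: coprime_dvd_mult_left_iff)
next
  case False
  then have "coprime (p ^ b) x" using assms prime_imp_coprime by (metis coprime_power_left_iff)
  then show ?thesis using assms(2) by (simp add: coprime_dvd_mult_right_iff)
qed

lemma nonneg_factor: "0 \<le> a * x \<Longrightarrow> 0 < a \<Longrightarrow> 0 \<le> x" for a x :: int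
  by (auto simp: zero_le_mult_iff)

lemma odd_prime_not_dvd_2: "prime p \<Longrightarrow> odd p \<Longrightarrow> \<not> p dvd (2 :: int)"
  using primes_dvd_imp_eq[of p 2] by auto

text \<open>With \<open>q = p ^ b\<close>, the product of \<open>A v - B u\<close> and
  \<open>A v + B u\<close> is a multiple of \<open>q\<close>, and \<open>p\<close> cannot divide
  both, so up to the sign of \<open>v\<close> all of \<open>q\<close> divides the first. The
  composition identity bounds the quotient \<open>w\<close> by 1 in absolute value:
  \<open>w = 0\<close> gives \<open>A\<close> up to sign, the other values give \<open>B\<close>,
  matching the four units of \<open>Z[i]\<close>.\<close>

lemma sum_two_squares_unique:
  fixes p A B u v :: int
  assumes p: "prime p" "odd p" and AB: "A ^ 2 + B ^ 2 = p ^ b" and uv: "u ^ 2 + v ^ 2 = p ^ b"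
    and "b > 0" "\<not> p dvd A" "\<not> p dvd u"
  shows "u \<in> {A, - A, B, - B}"
proof -
  define q where "q = p ^ b"
  note AB = AB[folded q_def] and uv = uv[folded q_def]
  have q0: "q > 0" using p prime_gt_0_int by (simp add: q_def)
  have pq: "p dvd q" using assms by (simp add: q_def dvd_power)
  have main: "u \<in> {A, - A, B, - B}" if uv: "u ^ 2 + v ^ 2 = q" and dvd: "q dvd A * v - B * u" for v
  proof -
    obtain w where w: "A * v - B * u = q * w" using dvd by blast
    have id: "(A * v - B * u) ^ 2 + (A * u + B * v) ^ 2 = (A ^ 2 + B ^ 2) * (u ^ 2 + v ^ 2)"
      by (simp add: power2_eq_square algebra_simps)
    then have sq: "(A * u + B * v) ^ 2 = q ^ 2 * (1 - w ^ 2)"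
      unfolding w AB uv by (simp add: power2_eq_square algebra_simps)
    have "q ^ 2 * (1 - w ^ 2) \<ge> 0" unfolding sq[symmetric] by simp
    then have "0 \<le> 1 - w ^ 2" by (rule nonneg_factor) (rule zero_less_power[OF q0])
    then have "w ^ 2 \<le> 1" by simp
    then have "\<bar>w\<bar> \<le> 1" by (simp add: abs_square_le_1)
    then have "w \<in> {-1, 0, 1}" by auto
    then consider "w = 0" | "w ^ 2 = 1" by auto
    then show ?thesis
    proof cases
      case 1
      have "A * q = u * (A * u + B * v) + v * (A * v - B * u)"
        unfolding uv[symmetric] by (simp add: power2_eq_square algebra_simps)
      moreover have "A * u + B * v = q \<or> A * u + B * v = - q"
        using sq 1 by (simp add: power2_eq_iff)
      ultimately have "A * q = u * q \<or> A * q = - u * q" using w 1 by auto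
      then have "A = u \<or> A = - u" using q0 by (metis less_irrefl mult_right_cancel)
      then show ?thesis using q0 by auto
    next
      case 2
      have "A * u + B * v = 0" using sq 2 by simp
      moreover have "B * q = v * (A * u + B * v) - u * (A * v - B * u)"
        unfolding uv[symmetric] by (simp add: power2_eq_square algebra_simps)
      ultimately have "B * q = - u * w * q" using w by simp
      then have "B = - u * w" using q0 by (metis less_irrefl mult_right_cancel)
      moreover have "w = 1 \<or> w = -1" using 2 power2_eq_1_iff by blast
      ultimately show ?thesis by auto
    qed
  qed
  have "(A * v - B * u) * (A * v + B * u) = q * (A ^ 2 - u ^ 2)"
  proof -
    have "(A * v - B * u) * (A * v + B * u) = A ^ 2 * (u ^ 2 + v ^ 2) - (A ^ 2 + B ^ 2) * u ^ 2"
      by (simp add: power2_eq_square algebra_simps)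
    then show ?thesis unfolding AB uv by (simp add: algebra_simps)
  qed
  then have dvd: "q dvd (A * v - B * u) * (A * v + B * u)" by simp
  have pv: "\<not> p dvd v"
  proof
    assume "p dvd v"
    moreover note pq
    ultimately have "p dvd u ^ 2" using uv by (metis dvd_add_left_iff dvd_power dvd_trans pos2)
    then show False using p assms prime_dvd_power by blast
  qed
  have "\<not> (p dvd A * v - B * u \<and> p dvd A * v + B * u)"
  proof
    assume "p dvd A * v - B * u \<and> p dvd A * v + B * u"
    then have "p dvd (A * v - B * u) + (A * v + B * u)" by (meson dvd_add)
    then have "p dvd 2 * (A * v)" by (simp add: algebra_simps)
    then have "p dvd 2 \<or> p dvd A * v" using p prime_dvd_mult_iff by blast
    moreover have "\<not> p dvd 2" using p by (rule odd_prime_not_dvd_2)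
    ultimately show False using p assms pv prime_dvd_mult_iff by blast
  qed
  from prime_power_dvd_mult_cases[OF p(1) dvd[unfolded q_def] this, folded q_def]
  show ?thesis
  proof
    assume "q dvd A * v - B * u"
    then show ?thesis using main[OF uv] by blast
  next
    assume "q dvd A * v + B * u"
    moreover have "A * (- v) - B * u = - (A * v + B * u)" by simp
    ultimately have "q dvd A * (- v) - B * u" by (simp only: dvd_minus_iff)
    moreover have "u ^ 2 + (- v) ^ 2 = q" using uv by simp
    ultimately show ?thesis using main by blast
  qed
qed

text \<open>With \<open>3 v = A - C\<close> the hypotheses become \<open>B^2 + 3 v^2 = 4 q\<close>,
  a representation by the same form as that of \<open>t\<close> and \<open>u\<close>, and the
  divisibility argument for two squares applies. The quotient \<open>w\<close> now satisfies
  \<open>3 w^2 <= 16\<close>; \<open>w = 0\<close> gives \<open>B\<close> and \<open>w^2 = 4\<close>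
  gives \<open>A\<close> or \<open>C\<close>, up to sign.\<close>

lemma eisenstein_norm_unique:
  fixes p A B C t u :: int
  assumes p: "prime p" "odd p" and ABC: "A + B + C = 0" "A ^ 2 + B ^ 2 + C ^ 2 = 6 * p ^ b"
    and tu: "t ^ 2 + 3 * u ^ 2 = 4 * p ^ b"
    and "b > 0" "\<not> p dvd B" "\<not> p dvd t"
  shows "t \<in> {A, - A, B, - B, C, - C}"
proof -
  define q where "q = p ^ b"
  note ABC = ABC[folded q_def] and tu = tu[folded q_def]
  have q0: "q > 0" using p prime_gt_0_int by (simp add: q_def)
  have pq: "p dvd q" using assms by (simp add: q_def dvd_power)
  have B: "B = - (A + C)" using ABC(1) by simp
  have ac: "A ^ 2 + A * C + C ^ 2 = 3 * q"
    using ABC(2) unfolding B by (simp add: power2_eq_square algebra_simps)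
  have "(A - C) ^ 2 = 3 * (q - A * C)"
    using ac by (simp add: power2_eq_square algebra_simps)
  then have "3 dvd (A - C) ^ 2" by simp
  then have "3 dvd A - C" using prime_dvd_power[of "3::int"] by simp
  then obtain v where v: "A - C = 3 * v" by blast
  have Bv: "B ^ 2 + 3 * v ^ 2 = 4 * q"
  proof -
    have "3 * (B ^ 2 + 3 * v ^ 2) = 3 * B ^ 2 + (A - C) ^ 2" unfolding v by (simp add: power2_eq_square)
    also have "\<dots> = 4 * (A ^ 2 + A * C + C ^ 2)" unfolding B by (simp add: power2_eq_square algebra_simps)
    finally show ?thesis using ac by simp
  qed
  have main: "t \<in> {A, - A, B, - B, C, - C}"
    if v: "A - C = 3 * v \<or> C - A = 3 * v" and Bv: "B ^ 2 + 3 * v ^ 2 = 4 * q" and dvd: "q dvd t * v - B * u" for v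
  proof -
    obtain w where w: "t * v - B * u = q * w" using dvd by blast
    have id: "(t * B + 3 * u * v) ^ 2 + 3 * (t * v - B * u) ^ 2 = (t ^ 2 + 3 * u ^ 2) * (B ^ 2 + 3 * v ^ 2)"
      by (simp add: power2_eq_square algebra_simps)
    then have sq: "(t * B + 3 * u * v) ^ 2 = q ^ 2 * (16 - 3 * w ^ 2)"
      unfolding w Bv tu by (simp add: power2_eq_square algebra_simps)
    have "q ^ 2 * (16 - 3 * w ^ 2) \<ge> 0" unfolding sq[symmetric] by simp
    then have "0 \<le> 16 - 3 * w ^ 2" by (rule nonneg_factor) (rule zero_less_power[OF q0])
    then have "w ^ 2 < 3 ^ 2" by simp
    then have "\<bar>w\<bar> < 3" using power2_less_imp_less[of "\<bar>w\<bar>" 3] by simp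
    then have "w \<in> {-2, -1, 0, 1, 2}" by auto
    then consider "w = 0" | "w ^ 2 = 1" | "w = 2 \<or> w = -2" by auto
    then show ?thesis
    proof cases
      case 1
      have "(t * B + 3 * u * v) ^ 2 = (4 * q) ^ 2" using sq 1 by (simp add: power2_eq_square)
      then have "t * B + 3 * u * v = 4 * q \<or> t * B + 3 * u * v = - (4 * q)" by (rule power2_eq_iff[THEN iffD1])
      moreover have "t * (4 * q) = B * (t * B + 3 * u * v) + 3 * v * (t * v - B * u)"
        unfolding Bv[symmetric] by (simp add: power2_eq_square algebra_simps)
      ultimately have "t * (4 * q) = B * (4 * q) \<or> t * (4 * q) = - B * (4 * q)" using w 1 by auto
      moreover have "4 * q \<noteq> 0" using q0 by simp
      ultimately have "t = B \<or> t = - B" by (metis mult_right_cancel)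
      then show ?thesis by auto
    next
      \<comment> \<open>Here the other composed value would be \<open>q\<close> times a square root
        of \<open>16 - 3 = 13\<close>.\<close>
      case 2
      define z where "z = t * B + 3 * u * v"
      have z: "z ^ 2 = 13 * q ^ 2" using sq 2 by (simp add: z_def mult.commute)
      then have "q ^ 2 dvd z ^ 2" by simp
      then have "q dvd z" by simp
      then obtain s where s: "z = q * s" by blast
      have "s ^ 2 = 13" using z q0 unfolding s by (simp add: power_mult_distrib)
      then have "3 ^ 2 < \<bar>s\<bar> ^ 2" "\<bar>s\<bar> ^ 2 < 4 ^ 2" by simp_all
      then have "3 < \<bar>s\<bar>" "\<bar>s\<bar> < 4" using power_less_imp_less_base[of 3 2 "\<bar>s\<bar>"] power_less_imp_less_base[of "\<bar>s\<bar>" 2 4] by auto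
      then show ?thesis by simp
    next
      case 3
      have w4: "w ^ 2 = 4" using 3 by auto
      have "(t * B + 3 * u * v) ^ 2 = (2 * q) ^ 2" using sq w4 by (simp add: power2_eq_square)
      then have Z: "t * B + 3 * u * v = 2 * q \<or> t * B + 3 * u * v = - (2 * q)"
        by (rule power2_eq_iff[THEN iffD1])
      have D: "t * v - B * u = 2 * q \<or> t * v - B * u = - (2 * q)" using w 3 by auto
      have "t * (4 * q) = B * (t * B + 3 * u * v) + 3 * v * (t * v - B * u)"
        unfolding Bv[symmetric] by (simp add: power2_eq_square algebra_simps)
      then have eq: "(2 * t) * (2 * q) = B * (t * B + 3 * u * v) + 3 * v * (t * v - B * u)" by simp
      have "(2 * t) * (2 * q) = (B + 3 * v) * (2 * q) \<or> (2 * t) * (2 * q) = (B - 3 * v) * (2 * q)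
          \<or> (2 * t) * (2 * q) = (- B + 3 * v) * (2 * q) \<or> (2 * t) * (2 * q) = (- B - 3 * v) * (2 * q)"
        using Z
      proof
        assume Z: "t * B + 3 * u * v = 2 * q"
        show ?thesis by (rule disjE[OF D]) (simp_all only: eq Z, simp_all add: algebra_simps)
      next
        assume Z: "t * B + 3 * u * v = - (2 * q)"
        show ?thesis by (rule disjE[OF D]) (simp_all only: eq Z, simp_all add: algebra_simps)
      qed
      moreover have "2 * q \<noteq> 0" using q0 by simp
      ultimately have "2 * t = B + 3 * v \<or> 2 * t = B - 3 * v \<or> 2 * t = - B + 3 * v \<or> 2 * t = - B - 3 * v"
        by (metis mult_right_cancel)
      \<comment> \<open>Since \<open>B = - (A + C)\<close> and \<open>3 v\<close> is
        \<open>A - C\<close> up to sign, the four right-hand sides are \<open>2 A\<close> and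
        \<open>2 C\<close> up to sign.\<close>
      then show ?thesis using v B by auto
    qed
  qed
  have "(t * v - B * u) * (t * v + B * u) = q * (4 * (v ^ 2 - u ^ 2))"
  proof -
    have "(t * v - B * u) * (t * v + B * u) = (t ^ 2 + 3 * u ^ 2) * v ^ 2 - (B ^ 2 + 3 * v ^ 2) * u ^ 2"
      by (simp add: power2_eq_square algebra_simps)
    then show ?thesis unfolding Bv tu by (simp add: algebra_simps)
  qed
  then have dvd: "q dvd (t * v - B * u) * (t * v + B * u)" by simp
  have pv: "\<not> p dvd v"
  proof
    assume "p dvd v"
    then have "p dvd 3 * v ^ 2" by (simp add: power2_eq_square)
    moreover have "p dvd 4 * q" using pq by simp
    ultimately have "p dvd B ^ 2" using Bv by (metis dvd_add_left_iff)
    then show False using p assms prime_dvd_power by blast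
  qed
  have "\<not> (p dvd t * v - B * u \<and> p dvd t * v + B * u)"
  proof
    assume "p dvd t * v - B * u \<and> p dvd t * v + B * u"
    then have "p dvd (t * v - B * u) + (t * v + B * u)" by (meson dvd_add)
    then have "p dvd 2 * (t * v)" by (simp add: algebra_simps)
    then have "p dvd 2 \<or> p dvd t * v" using p prime_dvd_mult_iff by blast
    moreover have "\<not> p dvd 2" using p by (rule odd_prime_not_dvd_2)
    ultimately show False using p assms pv prime_dvd_mult_iff by blast
  qed
  from prime_power_dvd_mult_cases[OF p(1) dvd[unfolded q_def] this, folded q_def]
  show ?thesis
  proof
    assume "q dvd t * v - B * u"
    then show ?thesis using main[OF _ Bv] v by blast
  next
    assume "q dvd t * v + B * u"
    moreover have "t * (- v) - B * u = - (t * v + B * u)" by simp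
    ultimately have "q dvd t * (- v) - B * u" by (simp only: dvd_minus_iff)
    moreover have "B ^ 2 + 3 * (- v) ^ 2 = 4 * q" using Bv by simp
    moreover have "C - A = 3 * (- v)" using v by simp
    ultimately show ?thesis using main by blast
  qed
qed

subsection \<open>Ordinary curves with prescribed trace\<close>

lemma coeff_binomial_power:
  fixes a b :: "'a::comm_ring_1"
  shows "Polynomial.coeff ((Polynomial.monom a r + Polynomial.monom b s) ^ m) n
    = (\<Sum>j\<le>m. if r * j + s * (m - j) = n then of_nat (m choose j) * (a ^ j * b ^ (m - j)) else 0)"
proof -
  have "(Polynomial.monom a r + Polynomial.monom b s) ^ m
      = (\<Sum>j\<le>m. [:of_nat (m choose j):] * (Polynomial.monom (a ^ j * b ^ (m - j)) (r * j + s * (m - j))))"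
    unfolding binomial_ring
    by (intro sum.cong refl) (simp only: monom_power mult_monom of_nat_poly mult.assoc)
  then show ?thesis by (simp add: coeff_sum if_distrib[of "\<lambda>x. _ * x"] cong: if_cong)
qed

lemma of_nat_binomial_neq_0:
  assumes "prime CHAR('a::comm_ring_1)" "m < CHAR('a)" "j \<le> m"
  shows "(of_nat (m choose j) :: 'a) \<noteq> 0"
proof
  assume "of_nat (m choose j) = (0 :: 'a)"
  then have "CHAR('a) dvd m choose j" by (simp add: of_nat_eq_0_iff_char_dvd)
  then have "CHAR('a) dvd fact m" using binomial_fact_lemma[OF assms(3)] by (metis dvd_mult)
  then show False using assms prime_dvd_fact_iff by fastforce
qed

context
  fixes n :: nat
  assumes card: "CARD('k::finite_field) = CHAR('k) ^ n" and odd: "odd CHAR('k)"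
begin

lemma odd_CARD: "odd CARD('k)"
  using odd by (simp add: card)

lemma two_neq_0_odd: "(2 :: 'k) \<noteq> 0"
proof -
  obtain g :: 'k where g: "bij_betw (\<lambda>i. g ^ i) {..<CARD('k) - 1} (UNIV - {0})"
    by (rule finite_field_generator)
  interpret odd_finite_field g by unfold_locales (rule odd_CARD, rule g)
  show ?thesis by (rule two_neq_0)
qed

lemma elliptic_quartic:
  assumes "k \<noteq> 0"
  shows "elliptic_curve (Weierstrass 0 0 0 k (0 :: 'k))"
proof -
  have "discriminant (Weierstrass 0 0 0 k 0) = - (2 ^ 6 * k ^ 3)"
    by (simp add: discriminant_def Let_def power_mult_distrib)
  then show ?thesis using assms two_neq_0_odd by (simp add: elliptic_curve_def del: power_numeral)
qed

lemma elliptic_sextic: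
  assumes "k \<noteq> 0" "(3 :: 'k) \<noteq> 0"
  shows "elliptic_curve (Weierstrass 0 0 0 0 (k :: 'k))"
proof -
  have "discriminant (Weierstrass 0 0 0 0 k) = - (3 ^ 3 * 2 ^ 4 * k ^ 2)"
    by (simp add: discriminant_def Let_def power_mult_distrib)
  then show ?thesis using assms two_neq_0_odd by (simp add: elliptic_curve_def del: power_numeral)
qed

lemma hasse_short:
  fixes a b :: 'k
  assumes "elliptic_curve (Weierstrass 0 0 0 a b)"
  shows "frobenius_curve.hasse (base_change (Weierstrass 0 0 0 a b))
    = Polynomial.coeff ([:to_ac b, to_ac a, 0, 1:] ^ ((CHAR('k) - 1) div 2)) (CHAR('k) - 1)"
proof -
  interpret frobenius_curve "base_change (Weierstrass 0 0 0 a b)" n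
    by (rule frobenius_curve_base_change[OF card assms odd])
  have "square_poly = [:to_ac b, to_ac a, 0, 1:]"
    by (simp add: square_poly_def cub_def lin_def)
  then show ?thesis by (simp add: hasse_def)
qed

text \<open>The middle coefficient of \<open>(x^3 + k x)^m\<close> with
  \<open>m = (p - 1) / 2\<close> comes from \<open>3 j + (m - j) = 2 m\<close>, that is
  \<open>j = (p - 1) / 4\<close>. The binomial coefficient is nonzero modulo \<open>p\<close>
  because \<open>m < p\<close>.\<close>

lemma not_dvd_quartic:
  assumes k: "k \<noteq> 0" and p4: "CHAR('k) mod 4 = 1"
  shows "\<not> CHAR('k) dvd card (rational_points (Weierstrass 0 0 0 k (0 :: 'k))) - 1"
proof -
  define m where "m = (CHAR('k) - 1) div 2"
  define l where "l = (CHAR('k) - 1) div 4"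
  have m: "CHAR('k) - 1 = 2 * m" "m = 2 * l" "m < CHAR('k)"
    using p4 CHAR_pos[where 'a = 'k] unfolding m_def l_def by presburger+
  have pc: "prime CHAR('k alg_closure)" by simp
  have "[:0, to_ac k, 0, 1:] = Polynomial.monom 1 3 + Polynomial.monom (to_ac k) 1"
    by (simp add: monom_altdef eval_nat_numeral)
  then have "Polynomial.coeff ([:0, to_ac k, 0, 1:] ^ m) (2 * m)
      = (\<Sum>j\<le>m. if 3 * j + 1 * (m - j) = 2 * m then of_nat (m choose j) * (1 ^ j * to_ac k ^ (m - j)) else 0)"
    by (simp only: coeff_binomial_power)
  also have "\<dots> = (\<Sum>j\<le>m. if j = l then of_nat (m choose l) * to_ac k ^ (m - l) else 0)"
    by (intro sum.cong refl) (auto simp: m(2))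
  also have "\<dots> = of_nat (m choose l) * to_ac k ^ (m - l)" by (simp add: m(2))
  also have "\<dots> \<noteq> 0"
    using of_nat_binomial_neq_0[OF pc, of m l] m k by simp
  finally show ?thesis
    unfolding char_dvd_card_iff_hasse[OF card elliptic_quartic[OF k] odd]
      hasse_short[OF elliptic_quartic[OF k]] m(1) by simp
qed

text \<open>The middle coefficient of \<open>(x^3 + k)^m\<close> comes from
  \<open>3 j = p - 1\<close>, which is solvable as \<open>p\<close> is 1 modulo 3; its binomial
  coefficient is again prime to \<open>p\<close>.\<close>

lemma not_dvd_sextic:
  assumes k: "k \<noteq> 0" and p3: "CHAR('k) mod 3 = 1"
  shows "\<not> CHAR('k) dvd card (rational_points (Weierstrass 0 0 0 0 (k :: 'k))) - 1"
proof -
  define m where "m = (CHAR('k) - 1) div 2"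
  define l where "l = (CHAR('k) - 1) div 3"
  have m: "CHAR('k) - 1 = 2 * m" "2 * m = 3 * l" "m < CHAR('k)"
    using p3 odd CHAR_pos[where 'a = 'k] unfolding m_def l_def by presburger+
  have "CHAR('k) \<noteq> 3" using p3 by auto
  then have three: "(3 :: 'k) \<noteq> 0"
    using of_nat_eq_0_iff_char_dvd[of 3, where 'a = 'k] primes_dvd_imp_eq[of "CHAR('k)" 3] by auto
  have pc: "prime CHAR('k alg_closure)" by simp
  have "[:to_ac k, 0, 0, 1:] = Polynomial.monom 1 3 + Polynomial.monom (to_ac k) 0"
    by (simp add: monom_altdef eval_nat_numeral)
  then have "Polynomial.coeff ([:to_ac k, 0, 0, 1:] ^ m) (2 * m)
      = (\<Sum>j\<le>m. if 3 * j + 0 * (m - j) = 2 * m then of_nat (m choose j) * (1 ^ j * to_ac k ^ (m - j)) else 0)"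
    by (simp only: coeff_binomial_power)
  also have "\<dots> = (\<Sum>j\<le>m. if j = l then of_nat (m choose l) * to_ac k ^ (m - l) else 0)"
    by (intro sum.cong refl) (auto simp: m(2))
  also have "\<dots> = of_nat (m choose l) * to_ac k ^ (m - l)" using m(2) by simp
  also have "\<dots> \<noteq> 0"
    using of_nat_binomial_neq_0[OF pc, of m l] m k by simp
  finally show ?thesis
    unfolding char_dvd_card_iff_hasse[OF card elliptic_sextic[OF k three] odd]
      hasse_short[OF elliptic_sextic[OF k three]] m(1) by simp
qed

theorem exists_quartic_trace:
  assumes n: "n > 0" and p4: "CHAR('k) mod 4 = 1"
    and uv: "u ^ 2 + v ^ 2 = int CARD('k)" "\<not> int CHAR('k) dvd u"
  obtains W :: "'k weierstrass" where "elliptic_curve W"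
    "int (card (rational_points W)) = int CARD('k) + 1 + 2 * u"
proof -
  let ?p = "CHAR('k)"
  obtain g :: 'k where g: "bij_betw (\<lambda>i. g ^ i) {..<CARD('k) - 1} (UNIV - {0})"
    by (rule finite_field_generator)
  interpret odd_finite_field g by unfold_locales (rule odd_CARD, rule g)
  have q4: "CARD('k) mod 4 = 1"
    using power_mod[of "CHAR('k)" 4 n] p4 by (simp add: card)
  obtain A B where AB: "A ^ 2 + B ^ 2 = int CARD('k)"
    "\<And>s. s \<in> {A, - A, B, - B} \<Longrightarrow> \<exists>k. k \<noteq> 0 \<and> quartic_sum k = 2 * s"
    using quartic_sums[OF q4] by blast
  have pts: "int (card (rational_points (Weierstrass 0 0 0 k 0))) = int CARD('k) + 1 + quartic_sum k" for k
    using card_points_short[of 0 k 0] by (simp add: quartic_sum_def)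
  \<comment> \<open>Otherwise \<open>p\<close> would divide the number of points minus 1 of a
    quartic twist, whose Hasse invariant is nonzero. This coprimality is what uniqueness of the
    representation requires.\<close>
  have "\<not> int ?p dvd A"
  proof
    assume dvd: "int ?p dvd A"
    obtain k where k: "k \<noteq> 0" "quartic_sum k = 2 * A" using AB(2)[of A] by auto
    let ?N = "card (rational_points (Weierstrass 0 0 0 k 0))"
    have "int ?p dvd int CARD('k)" using n by (simp add: card dvd_power)
    then have "int ?p dvd int ?N - 1" using pts[of k] k dvd by simp
    moreover have "?N > 0" using not_dvd_quartic[OF k(1) p4] by (cases ?N) auto
    ultimately have "int ?p dvd int (?N - 1)" by (simp add: of_nat_diff)
    then show False using not_dvd_quartic[OF k(1) p4] by (simp only: int_dvd_int_iff)
  qed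
  then have "u \<in> {A, - A, B, - B}"
    using sum_two_squares_unique[of "int ?p" A B n u v] AB(1) uv n odd by (simp add: card)
  then obtain k where k: "k \<noteq> 0" "quartic_sum k = 2 * u" using AB(2) by blast
  show thesis
    by (rule that[OF elliptic_quartic[OF k(1)]]) (simp add: pts k)
qed

theorem exists_sextic_trace:
  assumes n: "n > 0" and p3: "CHAR('k) mod 3 = 1"
    and tu: "t ^ 2 + 3 * u ^ 2 = 4 * int CARD('k)" "\<not> int CHAR('k) dvd t"
  obtains W :: "'k weierstrass" where "elliptic_curve W"
    "int (card (rational_points W)) = int CARD('k) + 1 + t"
proof -
  let ?p = "CHAR('k)"
  obtain g :: 'k where g: "bij_betw (\<lambda>i. g ^ i) {..<CARD('k) - 1} (UNIV - {0})"
    by (rule finite_field_generator)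
  interpret odd_finite_field g by unfold_locales (rule odd_CARD, rule g)
  have "CHAR('k) \<noteq> 3" using p3 by auto
  then have three: "(3 :: 'k) \<noteq> 0"
    using of_nat_eq_0_iff_char_dvd[of 3, where 'a = 'k] primes_dvd_imp_eq[of "CHAR('k)" 3] by auto
  have q3: "CARD('k) mod 3 = 1"
    using power_mod[of "CHAR('k)" 3 n] p3 by (simp add: card)
  obtain A B C where ABC: "A + B + C = 0" "A ^ 2 + B ^ 2 + C ^ 2 = 6 * int CARD('k)"
    "\<And>s. s \<in> {A, - A, B, - B, C, - C} \<Longrightarrow> \<exists>k. k \<noteq> 0 \<and> sextic_sum k = s"
    using sextic_sums[OF q3] by blast
  have pts: "int (card (rational_points (Weierstrass 0 0 0 0 k))) = int CARD('k) + 1 + sextic_sum k" for k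
    using card_points_short[of 0 0 k] by (simp add: sextic_sum_def)
  have "\<not> int ?p dvd B"
  proof
    assume dvd: "int ?p dvd B"
    obtain k where k: "k \<noteq> 0" "sextic_sum k = B" using ABC(3)[of B] by auto
    let ?N = "card (rational_points (Weierstrass 0 0 0 0 k))"
    have "int ?p dvd int CARD('k)" using n by (simp add: card dvd_power)
    then have "int ?p dvd int ?N - 1" using pts[of k] k dvd by simp
    moreover have "?N > 0" using not_dvd_sextic[OF k(1) p3] by (cases ?N) auto
    ultimately have "int ?p dvd int (?N - 1)" by (simp add: of_nat_diff)
    then show False using not_dvd_sextic[OF k(1) p3] by (simp only: int_dvd_int_iff)
  qed
  then have "t \<in> {A, - A, B, - B, C, - C}"
    using eisenstein_norm_unique[of "int ?p" A B C n t u] ABC(1,2) tu n odd by (simp add: card)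
  then obtain k where k: "k \<noteq> 0" "sextic_sum k = t" using ABC(3) by blast
  show thesis
    by (rule that[OF elliptic_sextic[OF k(1) three]]) (simp add: pts k)
qed

end

section \<open>Primes inert in \<open>Z[i]\<close> and \<open>Z[omega]\<close>\<close>

lemma dvd_sum_two_squares:
  fixes A B :: int
  assumes p: "prime (p :: nat)" "p mod 4 = 3" and dvd: "int p dvd A ^ 2 + B ^ 2"
  shows "int p dvd A"
proof (rule ccontr)
  assume A: "\<not> int p dvd A"
  have fermat: "[x ^ (p - 1) = 1] (mod int p)" if "\<not> int p dvd x" for x :: int
  proof -
    have "\<not> p dvd nat \<bar>x\<bar>" using that by (metis abs_ge_zero dvd_abs_iff int_dvd_int_iff int_nat_eq)
    then have "[nat \<bar>x\<bar> ^ (p - 1) = 1] (mod p)" using p(1) by (rule fermat_theorem[rotated])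
    then have "[int (nat \<bar>x\<bar> ^ (p - 1)) = int 1] (mod int p)" by (simp only: cong_int_iff)
    moreover have "even (p - 1)" using p(2) by presburger
    ultimately show ?thesis by (simp add: power_even_abs)
  qed
  have B: "\<not> int p dvd B"
  proof
    assume "int p dvd B"
    then have "int p dvd B ^ 2" by (simp add: power2_eq_square)
    then have "int p dvd A ^ 2" using dvd by (simp add: dvd_add_left_iff)
    then show False using A p prime_dvd_power[of "int p"] by simp
  qed
  \<comment> \<open>\<open>r\<close> is odd because \<open>p\<close> is 3 modulo 4, so raising
    \<open>A^2 = - B^2\<close> to the power \<open>r\<close> yields \<open>1 = - 1\<close> modulo
    \<open>p\<close> by Fermat's theorem.\<close>
  define r where "r = (p - 1) div 2"
  have r: "p - 1 = 2 * r" "odd r" using p(2) unfolding r_def by presburger+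
  have "[A ^ 2 = - (B ^ 2)] (mod int p)" using dvd by (simp add: cong_iff_dvd_diff)
  then have "[(A ^ 2) ^ r = (- (B ^ 2)) ^ r] (mod int p)" by (rule cong_pow)
  then have "[A ^ (p - 1) = - (B ^ (p - 1))] (mod int p)"
    using r by (simp add: power_mult)
  then have "[1 = - 1] (mod int p)"
    using fermat[OF A] fermat[OF B] by (meson cong_minus_minus_iff cong_sym cong_trans)
  then have "int p dvd 2" by (simp add: cong_iff_dvd_diff)
  then have "p \<le> 2" by (auto dest: zdvd_imp_le)
  then show False using mod_less_eq_dividend[of p 4] p(2) by linarith
qed

text \<open>Descent: an inert prime divides both \<open>A\<close> and \<open>B\<close> and cancels,
  until a representation of 1 is left.\<close>

lemma sum_two_squares_inert:
  fixes A B :: int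
  assumes p: "prime (p :: nat)" "p mod 4 = 3" and AB: "A ^ 2 + B ^ 2 = int p ^ (2 * c)"
  shows "int p ^ c \<in> {A, - A, B, - B}"
  using AB
proof (induction c arbitrary: A B)
  case 0
  then have "A ^ 2 + B ^ 2 = 1" by simp
  then have "A ^ 2 \<le> 1" "B ^ 2 \<le> 1" by (smt (verit) zero_le_power2)+
  then have "\<bar>A\<bar> \<le> 1" "\<bar>B\<bar> \<le> 1" by (simp_all add: abs_square_le_1)
  then have "A \<in> {-1,0,1}" "B \<in> {-1,0,1}" by auto
  then show ?case using 0 by auto
next
  case (Suc c)
  have dvd: "int p dvd A ^ 2 + B ^ 2" unfolding Suc.prems by simp
  obtain a where a: "A = int p * a" using dvd_sum_two_squares[OF p dvd] by blast
  obtain b where b: "B = int p * b" using dvd_sum_two_squares[OF p, of B A] dvd by (auto simp: add.commute)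
  have "int p ^ 2 * (a ^ 2 + b ^ 2) = int p ^ 2 * int p ^ (2 * c)"
    using Suc.prems by (simp add: a b power2_eq_square algebra_simps)
  moreover have "int p ^ 2 \<noteq> 0" using p by auto
  ultimately have "a ^ 2 + b ^ 2 = int p ^ (2 * c)" by (metis mult_left_cancel)
  from Suc.IH[OF this] show ?case by (auto simp: a b)
qed

text \<open>Divisibility gives \<open>A^3 = B^3\<close> modulo \<open>p\<close>. For
  \<open>p\<close> equal to 2 modulo 3 cubing is injective, so \<open>A = B\<close>, and the form
  reduces to \<open>3 A B\<close>, which is prime to \<open>p\<close>.\<close>

lemma dvd_eisenstein_norm:
  fixes A B :: int
  assumes p: "prime (p :: nat)" "p mod 3 = 2" "odd p" and dvd: "int p dvd A ^ 2 + A * B + B ^ 2"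
  shows "int p dvd A"
proof (rule ccontr)
  assume A: "\<not> int p dvd A"
  have fermat: "[x ^ (p - 1) = 1] (mod int p)" if "\<not> int p dvd x" for x :: int
  proof -
    have "\<not> p dvd nat \<bar>x\<bar>" using that by (metis abs_ge_zero dvd_abs_iff int_dvd_int_iff int_nat_eq)
    then have "[nat \<bar>x\<bar> ^ (p - 1) = 1] (mod p)" using p(1) by (rule fermat_theorem[rotated])
    then have "[int (nat \<bar>x\<bar> ^ (p - 1)) = int 1] (mod int p)" by (simp only: cong_int_iff)
    moreover have "even (p - 1)" using p(3) by simp
    ultimately show ?thesis by (simp add: power_even_abs)
  qed
  have B: "\<not> int p dvd B"
  proof
    assume "int p dvd B"
    then have "int p dvd A * B + B ^ 2" by (simp add: power2_eq_square)
    then have "int p dvd A ^ 2" using dvd by (metis add.assoc dvd_add_left_iff)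
    then show False using A p prime_dvd_power[of "int p"] by simp
  qed
  define r where "r = (p - 2) div 3"
  have r: "p - 1 = 3 * r + 1" using p unfolding r_def by presburger
  have "A ^ 3 - B ^ 3 = (A - B) * (A ^ 2 + A * B + B ^ 2)"
    by (simp add: power2_eq_square power3_eq_cube algebra_simps)
  then have "[A ^ 3 = B ^ 3] (mod int p)" using dvd by (simp add: cong_iff_dvd_diff)
  then have "[(A ^ 3) ^ r = (B ^ 3) ^ r] (mod int p)" by (rule cong_pow)
  then have "[A * (A ^ 3) ^ r = A * (B ^ 3) ^ r] (mod int p)" by (intro cong_mult cong_refl)
  moreover have "A * (A ^ 3) ^ r = A ^ (p - 1)" "B * (B ^ 3) ^ r = B ^ (p - 1)"
    unfolding r by (simp_all add: power_mult)
  ultimately have 1: "[A * (B ^ 3) ^ r = B * (B ^ 3) ^ r] (mod int p)"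
    using fermat[OF A] fermat[OF B] by (metis cong_sym cong_trans)
  have pp: "prime (int p)" using p by simp
  have Br: "\<not> int p dvd (B ^ 3) ^ r" using B prime_dvd_power[OF pp] by blast
  have "int p dvd (A - B) * (B ^ 3) ^ r" using 1 by (simp only: cong_iff_dvd_diff left_diff_distrib)
  then have "int p dvd A - B" using Br prime_dvd_mult_iff[OF pp] by blast
  then have "int p dvd (A - B) * (A - B)" by simp
  moreover have "A ^ 2 + A * B + B ^ 2 = (A - B) * (A - B) + 3 * (A * B)"
    by (simp add: power2_eq_square algebra_simps)
  ultimately have "int p dvd 3 * (A * B)" using dvd by (metis dvd_add_right_iff)
  then have "int p dvd 3" using A B prime_dvd_mult_iff[OF pp] by blast
  then have "p dvd 3" by (metis int_dvd_int_iff of_nat_numeral)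
  then have "p = 3" using p(1) primes_dvd_imp_eq[of p 3] by simp
  then show False using p(2) by simp
qed

subsection \<open>Supersingular curves with trace of maximal absolute value\<close>

text \<open>For an inert prime the representation supplied by \<open>quartic_sums\<close> has
  \<open>p ^ c\<close> as one component up to sign; the two signs belong to quadratic twists of each
  other.\<close>

theorem exists_max_trace_quartic:
  assumes card: "CARD('k::finite_field) = CHAR('k) ^ (2 * c)" and p4: "CHAR('k) mod 4 = 3"
    and s: "s = int CHAR('k) ^ c \<or> s = - (int CHAR('k) ^ c)"
  obtains W :: "('k::finite_field) weierstrass" where "elliptic_curve W"
    "int (card (rational_points W)) = int CARD('k) + 1 + 2 * s"
proof -
  let ?p = "CHAR('k)"
  have odd: "odd ?p" using p4 by presburger
  obtain g :: 'k where g: "bij_betw (\<lambda>i. g ^ i) {..<CARD('k) - 1} (UNIV - {0})"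
    by (rule finite_field_generator)
  interpret odd_finite_field g by unfold_locales (simp add: card odd, rule g)
  have "?p ^ 2 mod 4 = 1" using power_mod[of ?p 4 2] p4 by simp
  then have q4: "CARD('k) mod 4 = 1"
    using power_mod[of "?p ^ 2" 4 c] by (simp add: card power_mult)
  obtain A B where AB: "A ^ 2 + B ^ 2 = int CARD('k)"
    "\<And>s. s \<in> {A, - A, B, - B} \<Longrightarrow> \<exists>k. k \<noteq> 0 \<and> quartic_sum k = 2 * s"
    using quartic_sums[OF q4] by blast
  have "int ?p ^ c \<in> {A, - A, B, - B}"
    using AB(1) p4 by (intro sum_two_squares_inert) (simp_all add: card)
  then have "s \<in> {A, - A, B, - B}" using s by auto
  then obtain k where k: "k \<noteq> 0" "quartic_sum k = 2 * s" using AB(2) by blast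
  show thesis
    by (rule that[OF elliptic_quartic[OF card odd k(1)]])
      (use card_points_short[of 0 k 0] k in \<open>simp add: quartic_sum_def\<close>)
qed

text \<open>An inert prime divides all three numbers from \<open>sextic_sums\<close>; after division
  only finitely many triples are possible.\<close>

theorem exists_max_trace_sextic:
  assumes card: "CARD('k::finite_field) = CHAR('k) ^ 2" and p3: "CHAR('k) mod 3 = 2" and odd: "odd CHAR('k)"
    and s: "s = int CHAR('k) \<or> s = - int CHAR('k)"
  obtains W :: "('k::finite_field) weierstrass" where "elliptic_curve W"
    "int (card (rational_points W)) = int CARD('k) + 1 + 2 * s"
proof -
  let ?p = "CHAR('k)"
  obtain g :: 'k where g: "bij_betw (\<lambda>i. g ^ i) {..<CARD('k) - 1} (UNIV - {0})"
    by (rule finite_field_generator)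
  interpret odd_finite_field g by unfold_locales (simp add: card odd, rule g)
  have q3: "CARD('k) mod 3 = 1" using power_mod[of ?p 3 2] p3 by (simp add: card)
  have "?p \<noteq> 3" using p3 by auto
  then have three: "(3 :: 'k) \<noteq> 0"
    using of_nat_eq_0_iff_char_dvd[of 3, where 'a = 'k] primes_dvd_imp_eq[of ?p 3] by auto
  obtain A B C where ABC: "A + B + C = 0" "A ^ 2 + B ^ 2 + C ^ 2 = 6 * int CARD('k)"
    "\<And>s. s \<in> {A, - A, B, - B, C, - C} \<Longrightarrow> \<exists>k. k \<noteq> 0 \<and> sextic_sum k = s"
    using sextic_sums[OF q3] by blast
  have C: "C = - A - B" using ABC(1) by simp
  have AB: "A ^ 2 + A * B + B ^ 2 = 3 * int ?p ^ 2"
    using ABC(2) unfolding C card by (simp add: power2_eq_square algebra_simps)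
  have dvd: "int ?p dvd A ^ 2 + A * B + B ^ 2" unfolding AB by (simp add: power2_eq_square)
  obtain a where a: "A = int ?p * a"
    using dvd_eisenstein_norm[OF _ p3 odd dvd] CHAR_prime by blast
  have dvd': "int ?p dvd B ^ 2 + B * A + A ^ 2" using dvd by (simp add: algebra_simps)
  obtain b where b: "B = int ?p * b"
    using dvd_eisenstein_norm[OF _ p3 odd dvd'] CHAR_prime by blast
  have "int ?p ^ 2 * (a ^ 2 + a * b + b ^ 2) = int ?p ^ 2 * 3"
    using AB by (simp add: a b power2_eq_square algebra_simps)
  then have ab: "a ^ 2 + a * b + b ^ 2 = 3" by simp
  have "(2 * a + b) ^ 2 + 3 * b ^ 2 = 4 * (a ^ 2 + a * b + b ^ 2)"
    "(2 * b + a) ^ 2 + 3 * a ^ 2 = 4 * (a ^ 2 + a * b + b ^ 2)"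
    by (simp_all add: power2_eq_square algebra_simps)
  then have "3 * b ^ 2 \<le> 12" "3 * a ^ 2 \<le> 12" unfolding ab by (smt (verit) zero_le_power2)+
  then have "b ^ 2 < 3 ^ 2" "a ^ 2 < 3 ^ 2" by simp_all
  then have "\<bar>b\<bar> < 3" "\<bar>a\<bar> < 3"
    using power2_less_imp_less[of "\<bar>b\<bar>" 3] power2_less_imp_less[of "\<bar>a\<bar>" 3] by simp_all
  then have "a \<in> {-2, -1, 0, 1, 2}" "b \<in> {-2, -1, 0, 1, 2}" by auto
  \<comment> \<open>Up to sign the solutions are \<open>(1, 1)\<close>, \<open>(2, -1)\<close> and
    \<open>(1, -2)\<close>, and in each one of \<open>a\<close>, \<open>b\<close>,
    \<open>a + b\<close> has absolute value 2, the maximal trace divided by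
    \<open>p\<close>.\<close>
  then have "2 \<in> {a, - a, b, - b, - a - b, a + b}" using ab by auto
  moreover have "int ?p * x \<in> {A, - A, B, - B, C, - C}" if "x \<in> {a, - a, b, - b, - a - b, a + b}" for x
    using that unfolding C a b
    by (elim insertE emptyE; hypsubst) (simp_all add: right_diff_distrib distrib_left)
  ultimately have "int ?p * 2 \<in> {A, - A, B, - B, C, - C}" by blast
  then have "2 * s \<in> {A, - A, B, - B, C, - C}" using s by auto
  then obtain k where k: "k \<noteq> 0" "sextic_sum k = 2 * s" using ABC(3) by blast
  show thesis
    by (rule that[OF elliptic_sextic[OF card odd k(1) three]])
      (use card_points_short[of 0 0 k] k in \<open>simp add: sextic_sum_def\<close>)
qed

subsection \<open>Curves over the fields with three and nine elements\<close>

lemma CARD_3_power: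
  assumes "CARD('k::finite_field) = 3 ^ n"
  shows "CHAR('k) = 3" "(3 :: 'k) = 0"
proof -
  show "CHAR('k) = 3" using CHAR_of_CARD_power[OF assms] by simp
  then show "(3 :: 'k) = 0" using of_nat_CHAR[where 'a = 'k] by simp
qed

text \<open>Two points serve the pair \<open>q1 = 2\<close>, \<open>q2 = 3\<close> of trace 0; four
  points serve \<open>q1 = 4\<close>, \<open>q2 = 3\<close>.\<close>

lemma exists_F3:
  assumes card: "CARD('k::finite_field) = 3"
  obtains W W' :: "('k::finite_field) weierstrass" where "elliptic_curve W" "card (rational_points W) = 2"
    "elliptic_curve W'" "card (rational_points W') = 4"
proof -
  obtain g :: 'k where g: "bij_betw (\<lambda>i. g ^ i) {..<CARD('k) - 1} (UNIV - {0})"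
    by (rule finite_field_generator)
  interpret odd_finite_field g by unfold_locales (simp add: card, rule g)
  have char: "CHAR('k) = 3" and three: "(3 :: 'k) = 0"
    using CARD_3_power[where 'k = 'k, of 1] card by simp_all
  have "g ^ 2 = 1" using power_card[OF g_neq_0] card by simp
  moreover have "g \<noteq> 1" using g_power_eq_iff[of 1 0] card by simp
  ultimately have "g = - 1" using power2_eq_1_iff by blast
  then have chi_m1: "chi (- 1 :: 'k) = - 1" using chi_g[of 1] by simp
  have sum: "(\<Sum>x\<in>UNIV. F x) = F 0 + F 1 + F (- 1)" for F :: "'k \<Rightarrow> int"
    using sum_UNIV_split[of F] card \<open>g = -1\<close> by (simp add: numeral_2_eq_2)
  have m3: "(- 3 :: 'k) = 0" using three by simp
  have "(- 1 - 1 + 1 :: 'k) = - 1" by simp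
  then have "int (card (rational_points (Weierstrass 0 (- 1) 0 (- 1) (0 :: 'k)))) = 2"
    unfolding card_points_short sum by (simp add: chi_m1 card)
  moreover have "elliptic_curve (Weierstrass 0 (- 1) 0 (- 1) (0 :: 'k))"
  proof -
    have "discriminant (Weierstrass 0 (- 1) 0 (- 1) (0 :: 'k)) = 2 + 3 * 26"
      by (simp add: discriminant_def Let_def)
    then show ?thesis using two_neq_0 three by (simp add: elliptic_curve_def)
  qed
  moreover have "int (card (rational_points (Weierstrass 0 0 0 (- 1) (0 :: 'k)))) = 4"
    unfolding card_points_short sum by (simp add: card)
  moreover have "elliptic_curve (Weierstrass 0 0 0 (- 1) (0 :: 'k))"
    by (rule elliptic_quartic[of 1]) (use char card in auto)
  ultimately show thesis by (intro that) auto
qed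

text \<open>Serves \<open>q1 = 8\<close>, \<open>q2 = 9\<close>. The curve
  \<open>y^2 = x^3 - x^2 - x\<close> has 2 points over the field of order 3, so trace 2 there and
  trace \<open>2^2 - 6 = -2\<close>, that is 12 points, over the field of order 9. Its quadratic
  twist by the nonsquare \<open>g\<close> has the remaining 8.\<close>

lemma exists_F9:
  assumes card: "CARD('k::finite_field) = 9"
  obtains W :: "('k::finite_field) weierstrass" where "elliptic_curve W" "card (rational_points W) = 8"
proof -
  obtain g :: 'k where g: "bij_betw (\<lambda>i. g ^ i) {..<CARD('k) - 1} (UNIV - {0})"
    by (rule finite_field_generator)
  interpret odd_finite_field g by unfold_locales (simp add: card, rule g)
  have three: "(3 :: 'k) = 0" using CARD_3_power[where 'k = 'k, of 2] card by simp
  have "(g ^ 4) ^ 2 = 1" using power_card[OF g_neq_0] card by (simp add: power_mult[symmetric])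
  moreover have "g ^ 4 \<noteq> 1" using g_power_eq_iff[of 4 0] card by simp
  ultimately have g4: "g ^ 4 = - 1" using power2_eq_1_iff by blast
  have "(g ^ 2 - g - 1) * (g ^ 2 + g - 1) = g ^ 4 + 1 - 3 * g ^ 2" by Groebner_Basis.algebra
  then have "(g ^ 2 - g - 1) * (g ^ 2 + g - 1) = 0" by (simp add: g4 three)
  then have "g ^ 2 - g - 1 = 0 \<or> g ^ 2 + g - 1 = 0" by simp
  \<comment> \<open>The nonzero elements are the powers \<open>h^0\<close> to \<open>h^3\<close> up
    to sign, and \<open>h^2 = h + 1\<close> reduces each value of the cubic to a signed power of
    \<open>h\<close> or 0, modulo 3.\<close>
  then obtain h where h: "h = g \<or> h = - g" "h ^ 2 = h + 1"
  proof
    assume "g ^ 2 - g - 1 = 0"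
    then have "g ^ 2 = g + 1" by Groebner_Basis.algebra
    then show thesis using that by blast
  next
    assume "g ^ 2 + g - 1 = 0"
    then have "(- g) ^ 2 = - g + 1" by Groebner_Basis.algebra
    then show thesis using that by blast
  qed
  have chi_m1: "chi (- 1 :: 'k) = 1" using chi_g[of 4] g4 by simp
  have chi_neg: "chi (- x) = chi x" for x :: 'k using chi_mult[of "-1" x] chi_m1 by simp
  have chi_h: "chi h = - 1" using h(1) chi_g[of 1] chi_neg by auto
  have h4: "h ^ 4 = - 1" using h(1) g4 by auto
  define F where "F = (\<lambda>x :: 'k. chi (x ^ 3 - x ^ 2 - x))"
  have "F 0 = 0" "F 1 = 1" by (simp_all add: F_def chi_m1)
  moreover have "F (- 1) = 1"
    by (simp add: F_def chi_m1)
  moreover have "F h = 0"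
  proof -
    have "h ^ 3 - h ^ 2 - h = 0" using h(2) by Groebner_Basis.algebra
    then show ?thesis by (simp add: F_def)
  qed
  moreover have "F (- h) = 1"
  proof -
    have "(- h) ^ 3 - (- h) ^ 2 - (- h) = h ^ 2 + 3 * (- h - 1)" using h(2) by Groebner_Basis.algebra
    then have "(- h) ^ 3 - (- h) ^ 2 - (- h) = h ^ 2" unfolding three by simp
    then show ?thesis by (simp only: F_def chi_neg chi_power chi_h, simp?)
  qed
  moreover have "F (h ^ 2) = - 1"
  proof -
    have "(h ^ 2) ^ 3 - (h ^ 2) ^ 2 - h ^ 2 = - (h ^ 3) + 3 * (2 * h + 1)" using h(2) by Groebner_Basis.algebra
    then have "(h ^ 2) ^ 3 - (h ^ 2) ^ 2 - h ^ 2 = - (h ^ 3)" unfolding three by simp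
    then show ?thesis by (simp only: F_def chi_neg chi_power chi_h, simp?)
  qed
  moreover have "F (- (h ^ 2)) = - 1"
  proof -
    have "(- (h ^ 2)) ^ 3 - (- (h ^ 2)) ^ 2 - (- (h ^ 2)) = - h + 3 * (- 3 * h - 2)" using h(2) by Groebner_Basis.algebra
    then have "(- (h ^ 2)) ^ 3 - (- (h ^ 2)) ^ 2 - (- (h ^ 2)) = - h" unfolding three by simp
    then show ?thesis by (simp only: F_def chi_neg chi_power chi_h, simp?)
  qed
  moreover have "F (h ^ 3) = 0"
  proof -
    have "(h ^ 3) ^ 3 - (h ^ 3) ^ 2 - h ^ 3 = 0 + 3 * (8 * h + 5)" using h(2) by Groebner_Basis.algebra
    then have "(h ^ 3) ^ 3 - (h ^ 3) ^ 2 - h ^ 3 = 0" unfolding three by simp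
    then show ?thesis by (simp add: F_def)
  qed
  moreover have "F (- (h ^ 3)) = 1"
  proof -
    have "(- (h ^ 3)) ^ 3 - (- (h ^ 3)) ^ 2 - (- (h ^ 3)) = - (h ^ 2) + 3 * (- 13 * h - 8)" using h(2) by Groebner_Basis.algebra
    then have "(- (h ^ 3)) ^ 3 - (- (h ^ 3)) ^ 2 - (- (h ^ 3)) = - (h ^ 2)" unfolding three by simp
    then show ?thesis by (simp only: F_def chi_neg chi_power chi_h, simp?)
  qed
  moreover have "(\<Sum>x\<in>UNIV. F x) = F 0 + (F 1 + F (- 1)) + (F h + F (- h)) + (F (h ^ 2) + F (- (h ^ 2))) + (F (h ^ 3) + F (- (h ^ 3)))"
  proof -
    have powers: "g ^ 5 = - g" "g ^ 6 = - (g ^ 2)" "g ^ 7 = - (g ^ 3)"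
      using power_add[of g 4 1] power_add[of g 4 2] power_add[of g 4 3] g4 by simp_all
    have "(\<Sum>x\<in>UNIV. F x) = F 0 + (\<Sum>i<8. F (g ^ i))" using sum_UNIV_split[of F] card by simp
    also have "{..<8} = {0, 1, 2, 3, 4, 5, 6, 7 :: nat}" by auto
    finally have "(\<Sum>x\<in>UNIV. F x) = F 0 + (F 1 + F (- 1)) + (F g + F (- g)) + (F (g ^ 2) + F (- (g ^ 2))) + (F (g ^ 3) + F (- (g ^ 3)))"
      by (simp add: powers g4)
    then show ?thesis using h(1) by auto
  qed
  ultimately have S: "(\<Sum>x\<in>UNIV. F x) = 2" by simp
  let ?W = "Weierstrass 0 (- g) 0 (- (g ^ 2)) (0 :: 'k)"
  have "(\<Sum>x\<in>UNIV. chi (x ^ 3 + - g * x ^ 2 + - (g ^ 2) * x + 0))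
      = (\<Sum>x\<in>UNIV. chi ((g * x) ^ 3 + - g * (g * x) ^ 2 + - (g ^ 2) * (g * x) + 0))"
    by (rule sum_scale[OF g_neq_0, symmetric])
  also have "\<dots> = (\<Sum>x\<in>UNIV. - F x)"
  proof (rule sum.cong[OF refl])
    fix x
    have "(g * x) ^ 3 + - g * (g * x) ^ 2 + - (g ^ 2) * (g * x) + 0 = g ^ 3 * (x ^ 3 - x ^ 2 - x)"
      by (simp add: power2_eq_square power3_eq_cube algebra_simps)
    then show "chi ((g * x) ^ 3 + - g * (g * x) ^ 2 + - (g ^ 2) * (g * x) + 0) = - F x"
      using chi_g[of 3] by (simp only: chi_mult) (simp add: F_def)
  qed
  finally have "int (card (rational_points ?W)) = 8"
    unfolding card_points_short using S by (simp add: card sum_negf)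
  moreover have "elliptic_curve ?W"
  proof -
    have "discriminant ?W = g ^ 6 * (2 + 3 * 26)"
      by (simp add: discriminant_def Let_def power_mult_distrib eval_nat_numeral algebra_simps)
    then show ?thesis using two_neq_0 three g_neq_0 by (simp add: elliptic_curve_def)
  qed
  ultimately show thesis by (intro that) auto
qed

subsection \<open>Isomorphism classes\<close>

lemma curve_iso_refl:
  fixes W :: "'a::field weierstrass"
  assumes "elliptic_curve W"
  shows "(W, W) \<in> curve_iso"
  unfolding curve_iso_def mem_Collect_eq prod.case
  apply (rule conjI[OF assms conjI[OF assms]])
  apply (rule exI[where x = "1::'a"])
  apply (rule exI[where x = "0::'a"])+
  apply simp
  done

lemma card_rational_points_iso:
  fixes W W' :: "'a::field weierstrass"
  assumes "(W, W') \<in> curve_iso"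
  shows "card (rational_points W') = card (rational_points W)"
proof -
  obtain u r s t where u: "u \<noteq> 0" and iso: "u * wc1 W' = wc1 W + 2 * s"
    "u ^ 2 * wc2 W' = wc2 W - s * wc1 W + 3 * r - s ^ 2"
    "u ^ 3 * wc3 W' = wc3 W + r * wc1 W + 2 * t"
    "u ^ 4 * wc4 W' = wc4 W - s * wc3 W + 2 * r * wc2 W - (t + r * s) * wc1 W + 3 * r ^ 2 - 2 * s * t"
    "u ^ 6 * wc6 W' = wc6 W + r * wc4 W + r ^ 2 * wc2 W + r ^ 3 - t * wc3 W - t ^ 2 - r * t * wc1 W"
    using assms by (auto simp: curve_iso_def)
  define f where "f = (\<lambda>P. case P of Infinity \<Rightarrow> Infinity
    | Affine x y \<Rightarrow> Affine (u ^ 2 * x + r) (u ^ 3 * y + u ^ 2 * s * x + t))"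
  define F where "F = (\<lambda>(W :: 'a weierstrass) x y. y ^ 2 + wc1 W * x * y + wc3 W * y
    - (x ^ 3 + wc2 W * x ^ 2 + wc4 W * x + wc6 W))"
  have F: "F W (u ^ 2 * x + r) (u ^ 3 * y + u ^ 2 * s * x + t) = u ^ 6 * F W' x y" for x y
  proof -
    \<comment> \<open>The expansion is grouped by the right-hand sides of the transformation
      formulas, so that \<open>iso\<close> can replace them by coefficients of
      \<open>W'\<close>.\<close>
    have "F W (u ^ 2 * x + r) (u ^ 3 * y + u ^ 2 * s * x + t) =
      u ^ 6 * y ^ 2 + (wc1 W + 2 * s) * (u ^ 5 * x * y) + (wc3 W + r * wc1 W + 2 * t) * (u ^ 3 * y)
      - (u ^ 6 * x ^ 3 + (wc2 W - s * wc1 W + 3 * r - s ^ 2) * (u ^ 4 * x ^ 2)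
        + (wc4 W - s * wc3 W + 2 * r * wc2 W - (t + r * s) * wc1 W + 3 * r ^ 2 - 2 * s * t) * (u ^ 2 * x)
        + (wc6 W + r * wc4 W + r ^ 2 * wc2 W + r ^ 3 - t * wc3 W - t ^ 2 - r * t * wc1 W))"
      unfolding F_def by Groebner_Basis.algebra
    also have "\<dots> = u ^ 6 * F W' x y"
      unfolding iso[symmetric] F_def by Groebner_Basis.algebra
    finally show ?thesis .
  qed
  then have "on_curve W (Affine (u ^ 2 * x + r) (u ^ 3 * y + u ^ 2 * s * x + t)) \<longleftrightarrow> on_curve W' (Affine x y)" for x y
  proof -
    have *: "on_curve V (Affine x y) \<longleftrightarrow> F V x y = 0" for V x y
      by (simp add: F_def)
    show ?thesis using u unfolding * F by simp
  qed
  then have on: "on_curve W (f P) \<longleftrightarrow> on_curve W' P" for P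
    by (cases P) (simp_all add: f_def del: on_curve.simps(2))
  have "inj f"
  proof (rule injI)
    fix P Q assume "f P = f Q"
    then show "P = Q" using u by (cases P; cases Q) (auto simp: f_def)
  qed
  have "P \<in> range f" for P
  proof (cases P)
    case Infinity
    then show ?thesis by (auto simp: f_def intro: range_eqI[of _ _ Infinity])
  next
    case (Affine x y)
    define x' where "x' = (x - r) / u ^ 2"
    define y' where "y' = (y - u ^ 2 * s * x' - t) / u ^ 3"
    have "f (Affine x' y') = P"
      using u by (simp add: f_def x'_def y'_def Affine)
    then show ?thesis by blast
  qed
  then have "surj f" by blast
  have "rational_points W' = f -` rational_points W"
    using on by (auto simp: rational_points_def)
  then show ?thesis using \<open>inj f\<close> \<open>surj f\<close> by (simp add: card_vimage_inj)
qed

lemma curve_classesD: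
  fixes W :: "'a::finite_field weierstrass"
  assumes "C \<in> curve_classes n" "W \<in> C"
  shows "elliptic_curve W" "card (rational_points W) = n"
proof -
  from assms(1)[unfolded curve_classes_def]
  obtain V where V: "C = curve_iso `` {V}" "card (rational_points V) = n"
    by (rule quotientE) simp
  then have iso: "(V, W) \<in> curve_iso" using assms(2) by simp
  then show "elliptic_curve W" by (auto simp: curve_iso_def)
  show "card (rational_points W) = n" using card_rational_points_iso[OF iso] V(2) by simp
qed

lemma curve_classes_nonempty:
  fixes W :: "'a::finite_field weierstrass"
  assumes "elliptic_curve W" "card (rational_points W) = n"
  shows "(curve_classes n :: 'a weierstrass set set) \<noteq> {}"
proof
  have "curve_iso `` {W} \<in> curve_classes n"
    unfolding curve_classes_def by (rule quotientI) (simp add: assms)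
  moreover assume "(curve_classes n :: 'a weierstrass set set) = {}"
  ultimately show False by simp
qed

lemma supersingular_classesE:
  assumes "supersingular_classes (curve_classes n :: 'a::finite_field weierstrass set set)"
  obtains W :: "'a::finite_field weierstrass"
  where "elliptic_curve W" "card (rational_points W) = n" "supersingular W"
proof -
  from assms obtain C where C: "C \<in> (curve_classes n :: 'a weierstrass set set)"
    unfolding supersingular_classes_def by blast
  from C[unfolded curve_classes_def]
  obtain V where V: "C = curve_iso `` {V}" "elliptic_curve V"
    by (rule quotientE) simp
  have VC: "V \<in> C" unfolding V(1) using curve_iso_refl[OF V(2)] by simp
  have "supersingular V"
    using assms C VC unfolding supersingular_classes_def by blast
  with curve_classesD[OF C VC] show thesis by (rule that)
qed

text \<open>Supersingularity depends only on the number of points, so one witness curve settles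
  nonemptiness and the type of all classes together.\<close>

lemma classes_iff_dvd:
  assumes "CARD('k::finite_field) = CHAR('k) ^ m" "odd CHAR('k)"
    and "elliptic_curve (W :: 'k weierstrass)" "card (rational_points W) = n"
  shows "CHAR('k) dvd n - 1 \<Longrightarrow> supersingular_classes (curve_classes n :: 'k weierstrass set set)"
    and "\<not> CHAR('k) dvd n - 1 \<Longrightarrow> ordinary_classes (curve_classes n :: 'k weierstrass set set)"
proof -
  have ne: "(curve_classes n :: 'k weierstrass set set) \<noteq> {}"
    by (rule curve_classes_nonempty[OF assms(3,4)])
  have ss: "supersingular V \<longleftrightarrow> CHAR('k) dvd n - 1"
    if "C \<in> curve_classes n" "V \<in> C" for C and V :: "'k weierstrass"
    using supersingular_iff_card[OF assms(1) curve_classesD(1)[OF that] assms(2)] curve_classesD(2)[OF that]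
    by simp
  show "CHAR('k) dvd n - 1 \<Longrightarrow> supersingular_classes (curve_classes n :: 'k weierstrass set set)"
    using ne ss by (auto simp: supersingular_classes_def)
  show "\<not> CHAR('k) dvd n - 1 \<Longrightarrow> ordinary_classes (curve_classes n :: 'k weierstrass set set)"
    using ne ss by (auto simp: ordinary_classes_def ordinary_def)
qed

subsection \<open>The arithmetic of the traces\<close>

lemma square_eq_power_two:
  fixes t :: int
  assumes "t ^ 2 = 2 ^ b"
  shows "even b" "t = 2 ^ (b div 2) \<or> t = - (2 ^ (b div 2))"
proof -
  have "int (nat \<bar>t\<bar> ^ 2) = int (2 ^ b)" using assms by simp
  then have n: "nat \<bar>t\<bar> ^ 2 = 2 ^ b" by (simp only: of_nat_eq_iff)
  then have "nat \<bar>t\<bar> dvd 2 ^ b" by (metis dvd_triv_left power2_eq_square)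
  then obtain s where s: "nat \<bar>t\<bar> = 2 ^ s"
    using divides_primepow_nat[OF two_is_prime_nat] by blast
  then have "(2::nat) ^ (s * 2) = 2 ^ b" using n by (simp only: power_mult)
  then have b: "s * 2 = b" by (simp only: power_inject_exp one_less_numeral_iff semiring_norm)
  show "even b" unfolding b[symmetric] by simp
  have "\<bar>t\<bar> = 2 ^ (b div 2)" using s b by auto
  then show "t = 2 ^ (b div 2) \<or> t = - (2 ^ (b div 2))" by (auto simp: abs_if split: if_splits)
qed

text \<open>\<open>M\<close> is nonnegative as \<open>t^2\<close> is, and \<open>M = 3\<close> would
  make 3 divide a power of 2. The values 1, 2, 4 make \<open>t^2\<close> itself a power of
  2.\<close>

lemma supersingular_trace_cases:
  fixes t M :: int
  assumes t: "t ^ 2 = 2 ^ a * M" and M: "M \<le> 4"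
  obtains "t = 0"
  | "odd a" "t = 2 ^ ((a + 1) div 2) \<or> t = - (2 ^ ((a + 1) div 2))"
  | "even a" "t = 2 ^ (a div 2) \<or> t = - (2 ^ (a div 2))"
  | "even a" "t = 2 ^ (a div 2 + 1) \<or> t = - (2 ^ (a div 2 + 1))"
proof -
  have "0 \<le> 2 ^ a * M" unfolding t[symmetric] by simp
  then have "0 \<le> M" by (rule nonneg_factor) simp
  then consider "M = 0" | "M = 1" | "M = 2" | "M = 3" | "M = 4" using M by linarith
  then show thesis
  proof cases
    case 1
    then show ?thesis using t that(1) by simp
  next
    case 2
    then have "t ^ 2 = 2 ^ a" using t by simp
    from square_eq_power_two[OF this] show ?thesis using that(3) by blast
  next
    case 3
    then have "t ^ 2 = 2 ^ (a + 1)" using t by simp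
    from square_eq_power_two[OF this] show ?thesis using that(2) by simp
  next
    case 4
    then have "3 dvd t ^ 2" using t by simp
    then have "3 dvd t" using prime_dvd_power[of "3::int"] by simp
    then obtain c where "t = 3 * c" by blast
    then have "3 * c ^ 2 = 2 ^ a" using t 4 by (simp add: power2_eq_square)
    then have "3 dvd (2::int) ^ a" using dvd_triv_left[of 3 "c ^ 2"] by simp
    then have "3 dvd (2::int)" using prime_dvd_power[of "3::int" 2 a] by simp
    then show ?thesis by simp
  next
    case 5
    then have "t ^ 2 = 2 ^ (a + 2)" using t by simp
    from square_eq_power_two[OF this] show ?thesis using that(4) by simp
  qed
qed

lemma prime_power_square:
  fixes p x :: nat
  assumes "prime p" "x ^ 2 = p ^ b"
  obtains c where "x = p ^ c" "b = 2 * c"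
proof -
  have "x dvd p ^ b" using assms(2) by (metis dvd_triv_left power2_eq_square)
  then obtain c where c: "x = p ^ c" using divides_primepow_nat[OF assms(1)] by blast
  then have "p ^ (c * 2) = p ^ b" using assms(2) by (simp add: power_mult)
  then have "c * 2 = b" using prime_gt_1_nat[OF assms(1)] by (simp add: power_inject_exp)
  then show thesis using that c by simp
qed

subsection \<open>Curves with a power of two many points\<close>

lemma int_dvd_power_two_minus_1: "p dvd 2 ^ a - 1 \<longleftrightarrow> int p dvd 2 ^ a - 1"
proof -
  have "int (2 ^ a - 1) = 2 ^ a - 1" by (simp add: of_nat_diff)
  then show ?thesis by (metis int_dvd_int_iff)
qed

lemma odd_prime_dvd_power_two:
  fixes p :: nat
  assumes "prime p" "odd p"
  shows "\<not> int p dvd 2 ^ k"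
proof
  assume "int p dvd 2 ^ k"
  then have "int p dvd 2" using assms(1) prime_dvd_power[of "int p"] by simp
  then show False using odd_prime_not_dvd_2[of "int p"] assms by simp
qed

lemma odd_mod_4: "odd (p::nat) \<Longrightarrow> p mod 4 \<noteq> 3 \<Longrightarrow> p mod 4 = 1"
  by presburger

context
  fixes p a b :: nat
  assumes card: "CARD('k::finite_field) = p ^ b" and p: "prime p" "odd p"
    and a: "a \<ge> 1" and b: "b \<ge> 1"
begin

lemma char_eq: "CHAR('k) = p"
  by (rule CHAR_of_CARD_power[OF card p(1)])

lemma card_char: "CARD('k) = CHAR('k) ^ b"
  by (simp add: char_eq card)

lemma odd_char: "odd CHAR('k)"
  by (simp add: char_eq p)

lemma p_dvd_card: "int p dvd int CARD('k)"
  using b by (simp add: card dvd_power)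

lemma classes_ordinary:
  assumes "elliptic_curve (W :: 'k weierstrass)" "int (card (rational_points W)) = 2 ^ a"
    and "\<not> int p dvd 2 ^ a - 1"
  shows "ordinary_classes (curve_classes (2 ^ a) :: 'k weierstrass set set)"
proof -
  have "card (rational_points W) = 2 ^ a"
    using assms(2) by (metis of_nat_eq_iff of_nat_numeral of_nat_power)
  then show ?thesis
    using classes_iff_dvd(2)[OF card_char odd_char assms(1)] assms(3)
    by (simp only: char_eq int_dvd_power_two_minus_1 not_False_eq_True)
qed

lemma classes_supersingular:
  assumes "elliptic_curve (W :: 'k weierstrass)" "int (card (rational_points W)) = 2 ^ a"
    and "int p dvd 2 ^ a - 1"
  shows "supersingular_classes (curve_classes (2 ^ a) :: 'k weierstrass set set)"
proof -
  have "card (rational_points W) = 2 ^ a"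
    using assms(2) by (metis of_nat_eq_iff of_nat_numeral of_nat_power)
  then show ?thesis
    using classes_iff_dvd(1)[OF card_char odd_char assms(1)] assms(3)
    by (simp only: char_eq int_dvd_power_two_minus_1)
qed

text \<open>For even \<open>a\<close> the representation \<open>1 + (2 ^ (a / 2))^2\<close> makes
  \<open>p\<close> split in \<open>Z[i]\<close> and prescribes the trace. For odd \<open>a\<close>,
  3 divides \<open>2 ^ a + 1\<close>, which leaves \<open>q2 = 3\<close> and
  \<open>q2 = 9\<close>.\<close>

lemma ordinary_trace_zero:
  assumes q: "p ^ b = 2 ^ a + 1"
  shows "ordinary_classes (curve_classes (2 ^ a) :: 'k weierstrass set set)"
proof -
  have card': "int CARD('k) = 2 ^ a + 1" using q by (simp add: card)
  have "\<not> int p dvd 2 ^ a - 1"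
  proof
    assume "int p dvd 2 ^ a - 1"
    then have "int p dvd int CARD('k) - (2 ^ a - 1)" using p_dvd_card by (rule dvd_diff[rotated])
    then have "int p dvd 2" by (simp add: card')
    then show False using odd_prime_not_dvd_2[of "int p"] p by simp
  qed
  moreover have "\<exists>W :: 'k weierstrass. elliptic_curve W \<and> int (card (rational_points W)) = 2 ^ a"
  proof (cases "even a")
    case True
    then obtain c where c: "a = 2 * c" by blast
    have sq: "(- 1) ^ 2 + (2 ^ c) ^ 2 = int CARD('k)"
      by (simp add: card' c power_mult[symmetric] mult.commute)
    have "p mod 4 \<noteq> 3"
    proof
      assume "p mod 4 = 3"
      from dvd_sum_two_squares[OF p(1) this, of "- 1" "2 ^ c"] have "int p dvd - 1"
        using p_dvd_card unfolding sq by blast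
      then show False using prime_gt_1_nat[OF p(1)] by simp
    qed
    then have p4: "CHAR('k) mod 4 = 1" using odd_mod_4 p char_eq by simp
    have "\<not> int CHAR('k) dvd - 1" using prime_gt_1_nat[OF p(1)] by (simp add: char_eq)
    from exists_quartic_trace[OF card_char odd_char _ p4 sq this] b
    obtain W :: "'k weierstrass" where "elliptic_curve W" "int (card (rational_points W)) = int CARD('k) + 1 + 2 * - 1"
      by auto
    then show ?thesis by (intro exI[of _ W]) (simp add: card')
  next
    case False
    consider "b = 1" | "p = 3" "b = 2" "a = 3" using fermat_prime_power[OF p(1) q a] by blast
    then show ?thesis
    proof cases
      case 1
      obtain c where c: "a = 2 * c + 1" using False by (elim oddE)
      have "4 ^ c mod 3 = (1::nat)" using power_mod[of "4::nat" 3 c] by simp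
      moreover have "2 ^ a = 2 * (4::nat) ^ c" by (simp add: c power_mult)
      ultimately have "2 ^ a mod 3 = (2::nat)" by presburger
      then have "(2 ^ a + 1) mod 3 = (0 :: nat)" by presburger
      then have "3 dvd p" using q 1 by (simp add: dvd_eq_mod_eq_0)
      then have "p = 3" using p(1) primes_dvd_imp_eq[of 3 p] by simp
      then have "CARD('k) = 3" "(2::int) ^ a = 2" using card q 1 card' by simp_all
      then show ?thesis using exists_F3[where 'k = 'k] by (metis of_nat_numeral)
    next
      case 2
      then have "CARD('k) = 9" "(2::int) ^ a = 8" using card by simp_all
      then show ?thesis using exists_F9[where 'k = 'k] by (metis of_nat_numeral)
    qed
  qed
  ultimately show ?thesis using classes_ordinary by blast
qed

lemma ordinary_trace_odd:
  fixes e :: int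
  assumes oa: "odd a" and e: "e ^ 2 = 1" and q: "int (p ^ b) = 2 ^ a + 1 - e * 2 ^ ((a + 1) div 2)"
  shows "ordinary_classes (curve_classes (2 ^ a) :: 'k weierstrass set set)"
proof -
  obtain k where k: "a = 2 * k + 1" using oa by (elim oddE)
  define x :: int where "x = 2 ^ k"
  have pa: "2 ^ a = 2 * x ^ 2" by (simp add: k x_def power_mult[symmetric] mult.commute)
  have card': "int CARD('k) = 2 * x ^ 2 + 1 - e * (2 * x)"
    using q by (simp only: card pa) (simp add: k x_def)
  \<comment> \<open>The component \<open>e x - 1\<close> is the wanted one because
    \<open>2 ^ a = q2 + 1 + 2 (e x - 1)\<close>; the other is a power of two, hence prime to
    \<open>p\<close>.\<close>
  have sq: "(e * x - 1) ^ 2 + x ^ 2 = int CARD('k)"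
  proof -
    have "(e * x - 1) ^ 2 + x ^ 2 = e ^ 2 * x ^ 2 - 2 * (e * x) + 1 + x ^ 2"
      by (simp add: power2_eq_square algebra_simps)
    then show ?thesis by (simp add: e card')
  qed
  have nd: "\<not> int p dvd e * x - 1"
  proof
    assume d: "int p dvd e * x - 1"
    then have "int p dvd (e * x - 1) ^ 2" by (simp add: power2_eq_square)
    then have "int p dvd x ^ 2" using p_dvd_card unfolding sq[symmetric] by (simp add: dvd_add_right_iff)
    then show False using odd_prime_dvd_power_two[OF p, of "k * 2"] by (simp add: x_def power_mult)
  qed
  have "p mod 4 \<noteq> 3"
    using dvd_sum_two_squares[OF p(1), of "e * x - 1" x] p_dvd_card nd unfolding sq by blast
  then have p4: "CHAR('k) mod 4 = 1" using odd_mod_4 p char_eq by simp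
  have "\<not> int CHAR('k) dvd e * x - 1" using nd by (simp add: char_eq)
  from exists_quartic_trace[OF card_char odd_char _ p4 sq this] b
  obtain W :: "'k weierstrass" where "elliptic_curve W" "int (card (rational_points W)) = int CARD('k) + 1 + 2 * (e * x - 1)"
    by auto
  then have W: "elliptic_curve W" "int (card (rational_points W)) = 2 ^ a"
    by (simp_all add: card' pa algebra_simps)
  have "\<not> int p dvd 2 ^ a - 1"
  proof
    assume d: "int p dvd 2 ^ a - 1"
    have "int p dvd int CARD('k) - (2 ^ a - 1)" using p_dvd_card d by (rule dvd_diff)
    moreover have "int CARD('k) - (2 ^ a - 1) = 2 * (1 - e * x)" by (simp add: card' pa)
    ultimately have "int p dvd 2 * (1 - e * x)" by (simp only:)
    then have "int p dvd 2 \<or> int p dvd 1 - e * x"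
      using p(1) by (intro prime_dvd_multD) simp_all
    then have "int p dvd 1 - e * x" using odd_prime_not_dvd_2[of "int p"] p by simp
    then have "int p dvd - (1 - e * x)" by (simp only: dvd_minus_iff)
    then show False using nd by simp
  qed
  then show ?thesis using classes_ordinary W by blast
qed

lemma ordinary_trace_even:
  fixes e :: int
  assumes ea: "even a" and e: "e ^ 2 = 1" and q: "int (p ^ b) = 2 ^ a + 1 - e * 2 ^ (a div 2)"
    and p3: "p \<noteq> 3"
  shows "ordinary_classes (curve_classes (2 ^ a) :: 'k weierstrass set set)"
proof -
  obtain k where k: "a = 2 * k" using ea by blast
  define x :: int where "x = 2 ^ k"
  have pa: "2 ^ a = x ^ 2" by (simp add: k x_def power_mult[symmetric] mult.commute)
  have card': "int CARD('k) = x ^ 2 + 1 - e * x"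
    using q by (simp only: card pa) (simp add: k x_def)
  \<comment> \<open>Here \<open>2 ^ a = q2 + 1 + (e x - 2)\<close>, so \<open>e x - 2\<close> is the
    sextic sum to be realized.\<close>
  have sq: "(e * x - 2) ^ 2 + 3 * x ^ 2 = 4 * int CARD('k)"
  proof -
    have "(e * x - 2) ^ 2 + 3 * x ^ 2 = e ^ 2 * x ^ 2 - 4 * (e * x) + 4 + 3 * x ^ 2"
      by (simp add: power2_eq_square algebra_simps)
    then show ?thesis by (simp add: e card')
  qed
  have n3: "\<not> int p dvd 3"
  proof
    assume "int p dvd 3"
    then have "p dvd 3" by (metis int_dvd_int_iff of_nat_numeral)
    then show False using p3 p(1) primes_dvd_imp_eq[of p 3] by simp
  qed
  have nd: "\<not> int p dvd e * x - 2"
  proof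
    assume d: "int p dvd e * x - 2"
    then have "int p dvd (e * x - 2) ^ 2" by (simp add: power2_eq_square)
    moreover have "int p dvd (e * x - 2) ^ 2 + 3 * x ^ 2" unfolding sq using p_dvd_card by simp
    ultimately have "int p dvd 3 * x ^ 2" by (simp add: dvd_add_right_iff)
    then have "int p dvd 3 \<or> int p dvd x ^ 2" using p(1) prime_dvd_mult_iff[of "int p" 3] by simp
    then show False using n3 odd_prime_dvd_power_two[OF p, of "k * 2"] by (simp add: x_def power_mult)
  qed
  have "p mod 3 \<noteq> 2"
  proof
    assume "p mod 3 = 2"
    moreover have "1 ^ 2 + 1 * (- e * x) + (- e * x) ^ 2 = int CARD('k)"
      by (simp add: card' power_mult_distrib e)
    ultimately have "int p dvd 1" using dvd_eisenstein_norm[OF p(1) _ p(2), of 1 "- e * x"] p_dvd_card by simp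
    then show False using prime_gt_1_nat[OF p(1)] by simp
  qed
  moreover have "p mod 3 \<noteq> 0" using p3 p(1) primes_dvd_imp_eq[of 3 p] unfolding mod_eq_0_iff_dvd by auto
  ultimately have "p mod 3 = 1" by presburger
  then have p3': "CHAR('k) mod 3 = 1" by (simp add: char_eq)
  have "\<not> int CHAR('k) dvd e * x - 2" using nd by (simp add: char_eq)
  from exists_sextic_trace[OF card_char odd_char _ p3' sq this] b
  obtain W :: "'k weierstrass" where "elliptic_curve W" "int (card (rational_points W)) = int CARD('k) + 1 + (e * x - 2)"
    by auto
  then have W: "elliptic_curve W" "int (card (rational_points W)) = 2 ^ a"
    by (simp_all add: card' pa)
  have "\<not> int p dvd 2 ^ a - 1"
  proof
    assume d: "int p dvd 2 ^ a - 1"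
    have "int p dvd (2 ^ a - 1) - int CARD('k)" using d p_dvd_card by (rule dvd_diff)
    moreover have "(2 ^ a - 1) - int CARD('k) = e * x - 2" by (simp add: card' pa)
    ultimately show False using nd by simp
  qed
  then show ?thesis using classes_ordinary W by blast
qed

text \<open>With \<open>y = e 2 ^ k\<close> the equation is \<open>y^2 - y + 1 = 3 ^ b\<close>, so
  \<open>b = 1\<close> and \<open>y\<close> is 2 or -1; the latter would need
  \<open>k = 0\<close>.\<close>

lemma trace_even_p_3:
  fixes e :: int
  assumes ea: "even a" and e: "e ^ 2 = 1" and q: "int (p ^ b) = 2 ^ a + 1 - e * 2 ^ (a div 2)" and p3: "p = 3"
  shows "b = 1" "a = 2" "e = 1"
proof -
  obtain k where k: "a = 2 * k" using ea by blast
  define y :: int where "y = e * 2 ^ k"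
  have y: "y ^ 2 - y + 1 = 3 ^ b"
    using q e by (simp add: p3 y_def k power_mult_distrib power_mult[symmetric] mult.commute)
  then show b1: "b = 1" using eisenstein_power_three[OF y] b by simp
  have "(y - 2) * (y + 1) = 0" using y b1 by (simp add: power2_eq_square algebra_simps)
  then have "y = 2 \<or> y = - 1" by auto
  moreover have "e = 1 \<or> e = -1" using e power2_eq_1_iff by blast
  moreover have "(2::int) ^ k \<ge> 2" using a k self_le_power[of "2::int" k] by (cases k) simp_all
  ultimately have "e = 1" "(2::int) ^ k = 2 ^ 1" by (auto simp: y_def)
  then show "e = 1" "a = 2" using k by (simp_all only: power_inject_exp one_less_numeral_iff semiring_norm)
qed

text \<open>Here \<open>p ^ c = 2 ^ m - e\<close>, which leaves Mersenne primes for
  \<open>e = 1\<close>, and Fermat primes or \<open>3 ^ 2\<close> for \<open>e = - 1\<close>.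
  Inertness chooses the family of curves: 3 and the Mersenne primes in \<open>Z[i]\<close>, the
  Fermat primes above 3 in \<open>Z[omega]\<close>.\<close>

lemma supersingular_trace_max:
  fixes e :: int
  assumes ea: "even a" and e: "e ^ 2 = 1" and q: "int (p ^ b) = 2 ^ a + 1 - e * 2 ^ (a div 2 + 1)"
  shows "supersingular_classes (curve_classes (2 ^ a) :: 'k weierstrass set set)"
    "(p = 3 \<and> b = 4 \<and> a = 6) \<or>
     (\<exists>n. a = 2 ^ (n + 1) \<and> p = 2 ^ (2 ^ n) + 1 \<and> b = 2) \<or>
     (\<exists>m. a = 2 * m \<and> p = 2 ^ m - 1 \<and> b = 2)"
proof -
  obtain m where m: "a = 2 * m" using ea by blast
  have m1: "m \<ge> 1" using a m by simp
  define x :: int where "x = 2 ^ m"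
  have pa: "2 ^ a = x ^ 2" by (simp add: m x_def power_mult[symmetric] mult.commute)
  have card': "int CARD('k) = x ^ 2 + 1 - e * (2 * x)"
    using q by (simp only: card pa) (simp add: m x_def)
  have e1: "e = 1 \<or> e = -1" using e power2_eq_1_iff by blast
  define y where "y = nat (x - e)"
  have "x \<ge> 2" using m1 self_le_power[of "2::int" m] by (simp add: x_def)
  then have y: "int y = x - e" using e1 by (auto simp: y_def)
  have "int (y ^ 2) = int (p ^ b)"
    using card' e by (simp add: y card power2_eq_square algebra_simps)
  then have "y ^ 2 = p ^ b" by (simp only: of_nat_eq_iff)
  then obtain c where c: "y = p ^ c" "b = 2 * c" using prime_power_square[OF p(1)] by metis
  have c0: "c \<ge> 1" using b c by simp
  \<comment> \<open>Both sides are \<open>(p ^ c + e)^2\<close>, so the required trace over this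
    field has maximal absolute value \<open>2 p ^ c\<close>.\<close>
  have S: "2 ^ a = int CARD('k) + 1 + 2 * (e * int p ^ c)"
  proof -
    have pc: "int p ^ c = x - e" using y c by simp
    show ?thesis unfolding pc card' pa using e by (simp add: power2_eq_square algebra_simps)
  qed
  have dvd: "int p dvd 2 ^ a - 1"
  proof -
    have "2 ^ a - 1 = int CARD('k) + 2 * (e * int p ^ c)" using S by simp
    moreover have "int p dvd int p ^ c" using c0 by (simp add: dvd_power)
    ultimately show ?thesis using p_dvd_card by (simp add: dvd_add)
  qed
  have ep: "e * int p ^ c = int CHAR('k) ^ c \<or> e * int p ^ c = - (int CHAR('k) ^ c)"
    using e1 by (auto simp: char_eq)
  have ex4: "supersingular_classes (curve_classes (2 ^ a) :: 'k weierstrass set set)" if p4: "p mod 4 = 3"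
  proof -
    have "CARD('k) = CHAR('k) ^ (2 * c)" "CHAR('k) mod 4 = 3" using p4 c by (simp_all add: card char_eq)
    from exists_max_trace_quartic[OF this ep]
    obtain W :: "'k weierstrass" where "elliptic_curve W"
      "int (card (rational_points W)) = int CARD('k) + 1 + 2 * (e * int p ^ c)" .
    then show ?thesis using classes_supersingular dvd S by simp
  qed
  show "supersingular_classes (curve_classes (2 ^ a) :: 'k weierstrass set set)"
    "(p = 3 \<and> b = 4 \<and> a = 6) \<or> (\<exists>n. a = 2 ^ (n + 1) \<and> p = 2 ^ (2 ^ n) + 1 \<and> b = 2) \<or>
     (\<exists>m. a = 2 * m \<and> p = 2 ^ m - 1 \<and> b = 2)"
  proof -
    have "supersingular_classes (curve_classes (2 ^ a) :: 'k weierstrass set set) \<and>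
      ((p = 3 \<and> b = 4 \<and> a = 6) \<or> (\<exists>n. a = 2 ^ (n + 1) \<and> p = 2 ^ (2 ^ n) + 1 \<and> b = 2) \<or>
     (\<exists>m. a = 2 * m \<and> p = 2 ^ m - 1 \<and> b = 2))"
      using e1
    proof
      assume "e = 1"
      then have "int (p ^ c + 1) = int (2 ^ m)" using y c by (simp add: x_def)
      then have pc: "p ^ c + 1 = 2 ^ m" by (simp only: of_nat_eq_iff)
      have "m \<noteq> 1"
      proof
        assume "m = 1"
        then have "p ^ c = 1" using pc by simp
        then show False using p(1) c0 by (auto simp: prime_nat_iff)
      qed
      then have m2: "m \<ge> 2" using m1 by simp
      have "c = 1" by (rule mersenne_prime_power[OF p(1) pc m2])
      then have pm: "p + 1 = 2 ^ m" using pc by simp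
      have "(4::nat) dvd 2 ^ m" using m2 le_imp_power_dvd[of 2 m "2::nat"] by simp
      then have "4 dvd p + 1" by (simp only: pm)
      then have "p mod 4 = 3" by presburger
      moreover have "p = 2 ^ m - 1" using pm by simp
      ultimately show ?thesis using ex4 m c \<open>c = 1\<close> by auto
    next
      assume "e = - 1"
      then have "int (p ^ c) = int (2 ^ m + 1)" using y c by (simp add: x_def)
      then have pc: "p ^ c = 2 ^ m + 1" by (simp only: of_nat_eq_iff)
      consider "c = 1" | "p = 3" "c = 2" "m = 3" using fermat_prime_power[OF p(1) pc m1] by blast
      then show ?thesis
      proof cases
        case 2
        then show ?thesis using ex4 c m by simp
      next
        case 1
        then have pm: "p = 2 ^ m + 1" using pc by simp
        then obtain n where n: "m = 2 ^ n" using fermat_prime_exponent[of m] p(1) m1 by blast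
        have shape: "a = 2 ^ (n + 1) \<and> p = 2 ^ (2 ^ n) + 1 \<and> b = 2" using n m pm 1 c by simp
        have "supersingular_classes (curve_classes (2 ^ a) :: 'k weierstrass set set)"
        \<comment> \<open>For \<open>n = 0\<close> the prime is 3, inert in \<open>Z[i]\<close> but
          ramified in \<open>Z[omega]\<close>. For positive \<open>n\<close> the exponent
          \<open>m\<close> is even, so \<open>p\<close> is 2 modulo 3.\<close>
        proof (cases "n = 0")
          case True
          then show ?thesis using ex4 pm n by simp
        next
          case False
          then obtain l where l: "m = 2 * l" using n by (cases n) simp_all
          have "2 ^ m mod 3 = (1 :: nat)" using power_mod[of "4::nat" 3 l] by (simp add: l power_mult)
          then have "p mod 3 = 2" unfolding pm by presburger
          then have "CARD('k) = CHAR('k) ^ 2" "CHAR('k) mod 3 = 2" using 1 c by (simp_all add: card char_eq)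
          from exists_max_trace_sextic[OF this odd_char, of "e * int p ^ c"] ep 1
          obtain W :: "'k weierstrass" where "elliptic_curve W"
            "int (card (rational_points W)) = int CARD('k) + 1 + 2 * (e * int p ^ c)"
            by (metis power_one_right)
          then show ?thesis using classes_supersingular dvd S by simp
        qed
        then show ?thesis using shape by blast
      qed
    qed
    then show "supersingular_classes (curve_classes (2 ^ a) :: 'k weierstrass set set)"
      "(p = 3 \<and> b = 4 \<and> a = 6) \<or> (\<exists>n. a = 2 ^ (n + 1) \<and> p = 2 ^ (2 ^ n) + 1 \<and> b = 2) \<or>
     (\<exists>m. a = 2 * m \<and> p = 2 ^ m - 1 \<and> b = 2)" by blast+
  qed
qed

end

section \<open>The trichotomy for the first trace\<close>

lemma supersingular_F3:
  assumes "CARD('k::finite_field) = 3"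
  shows "supersingular_classes (curve_classes 4 :: 'k weierstrass set set)"
proof -
  have char: "CHAR('k) = 3" using CARD_3_power(1)[where 'k = 'k, of 1] assms by simp
  obtain W :: "'k weierstrass" where "elliptic_curve W" "card (rational_points W) = 4"
    using exists_F3[OF assms] by blast
  from classes_iff_dvd(1)[OF _ _ this, of 1] show ?thesis by (simp add: assms char)
qed

text \<open>The sign is carried by an \<open>e\<close> with \<open>e ^ 2 = 1\<close>, so that each
  existence lemma can treat both signs in one argument.\<close>

lemma supersingular_trace:
  assumes "CARD('k::finite_field) = 2 ^ a" "a \<ge> 1"
    and "supersingular_classes (curve_classes n :: 'k weierstrass set set)"
    and t: "t = int (2 ^ a) + 1 - int n"
  shows "t = 0 \<or>
    (\<exists>e. e ^ 2 = 1 \<and> (odd a \<and> t = e * 2 ^ ((a + 1) div 2) \<or> even a \<and> t = e * 2 ^ (a div 2) \<or>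
      even a \<and> t = e * 2 ^ (a div 2 + 1)))"
proof -
  have char: "CHAR('k) = 2" by (rule CHAR_of_CARD_power[OF assms(1)]) simp
  obtain W :: "'k weierstrass" where W: "elliptic_curve W" "card (rational_points W) = n" "supersingular W"
    using supersingular_classesE[OF assms(3)] .
  obtain M where "(int CARD('k) + 1 - int (card (rational_points W))) ^ 2 = int CARD('k) * M" "M \<le> 4"
    by (rule supersingular_char_2_trace[OF char W(1,3)])
  then have M: "t ^ 2 = 2 ^ a * M" "M \<le> 4" by (simp_all add: t W assms(1))
  have sign: "\<exists>e::int. e ^ 2 = 1 \<and> t = e * x" if "t = x \<or> t = - x" for x
    using that by (auto intro: exI[of _ 1] exI[of _ "- 1"])
  from M show ?thesis
  proof (cases rule: supersingular_trace_cases)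
    case 1
    then show ?thesis by simp
  next
    case 2
    then show ?thesis using sign[OF 2(2)] by blast
  next
    case 3
    then show ?thesis using sign[OF 3(2)] by blast
  next
    case 4
    then show ?thesis using sign[OF 4(2)] by blast
  qed
qed

lemma power_two_inj: "(2::nat) ^ a = 2 ^ b \<Longrightarrow> a = b"
  by (simp only: power_inject_exp one_less_numeral_iff semiring_norm)

text \<open>Translates the real exponent of case (1) into an integer power.\<close>

lemma powr_half_even:
  assumes "even a"
  shows "(2::real) powr ((real a + 2) / 2) = real_of_int (2 ^ (a div 2 + 1))"
proof -
  obtain m where m: "a = 2 * m" using assms by blast
  have "(real a + 2) / 2 = real (m + 1)" by (simp add: m)
  then show ?thesis by (simp only: powr_realpow) (simp add: m powr_realpow)
qed

theorem theorem4p6: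
  fixes a1 a2 p2 q1 q2 :: nat and t1 :: int
    and \<E>1 :: "'k1 :: finite_field weierstrass set set"
    and \<E>2 :: "'k2 :: finite_field weierstrass set set"
    and case1 case2 case3 :: bool
  assumes "a1 \<ge> 1" and "a2 \<ge> 1" and "prime p2"
    and "q1 = 2 ^ a1" and "q2 = p2 ^ a2" and "q1 \<noteq> q2"
    and "\<bar>sqrt (real q1) - sqrt (real q2)\<bar> \<le> 1"
    and "CARD('k1) = q1" and "CARD('k2) = q2"
    and "\<E>1 = curve_classes q2" and "\<E>2 = curve_classes q1"
    and "supersingular_classes \<E>1"
    and "t1 = int q1 + 1 - int q2"
    and "case1 \<longleftrightarrow>
      (real_of_int t1 = 2 powr ((real a1 + 2) / 2) \<or>
       real_of_int t1 = - (2 powr ((real a1 + 2) / 2))) \<and>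
      ((q1, q2) = (2 ^ 6, 3 ^ 4) \<or>
       (\<exists>n. (q1, q2) = (2 ^ (2 ^ (n + 1)), (2 ^ (2 ^ n) + 1) ^ 2) \<and>
            p2 = 2 ^ (2 ^ n) + 1) \<or>
       (\<exists>m. (q1, q2) = (2 ^ (2 * m), (2 ^ m - 1) ^ 2) \<and> p2 = 2 ^ m - 1))"
    and "case2 \<longleftrightarrow> t1 = 2 \<and> (q1, q2) = (2 ^ 2, 3)"
    and "case3 \<longleftrightarrow>
      t1 = 0 \<or>
      (odd a1 \<and> (t1 = 2 ^ ((a1 + 1) div 2) \<or> t1 = - (2 ^ ((a1 + 1) div 2)))) \<or>
      (even a1 \<and> (t1 = 2 ^ (a1 div 2) \<or> t1 = - (2 ^ (a1 div 2))) \<and> p2 \<noteq> 3)"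
  shows "((case1 \<and> \<not> case2 \<and> \<not> case3) \<or> (\<not> case1 \<and> case2 \<and> \<not> case3) \<or>
          (\<not> case1 \<and> \<not> case2 \<and> case3)) \<and>
         (case1 \<or> case2 \<longrightarrow> supersingular_classes \<E>2) \<and>
         (case3 \<longrightarrow> ordinary_classes \<E>2)"
proof -
  have p2: "prime p2" and a1: "a1 \<ge> 1" and a2: "a2 \<ge> 1" using assms by simp_all
  have card1: "CARD('k1) = 2 ^ a1" and card2: "CARD('k2) = p2 ^ a2" using assms by simp_all
  have E2: "\<E>2 = curve_classes (2 ^ a1)" using assms by simp
  have q: "int (p2 ^ a2) = 2 ^ a1 + 1 - t1" using assms by simp
  have ss: "supersingular_classes (curve_classes (p2 ^ a2) :: 'k1 weierstrass set set)"
    using assms by simp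
  note c1 = assms(14) and c2 = assms(15) and c3 = assms(16)
  have t: "t1 = 0 \<or> (\<exists>e. e ^ 2 = 1 \<and> (odd a1 \<and> t1 = e * 2 ^ ((a1 + 1) div 2) \<or>
    even a1 \<and> t1 = e * 2 ^ (a1 div 2) \<or> even a1 \<and> t1 = e * 2 ^ (a1 div 2 + 1)))"
    by (rule supersingular_trace[OF card1 a1 ss]) (use q in simp)
  have half: "0 < (a1 + 1) div 2" "even a1 \<Longrightarrow> 0 < a1 div 2" using a1 by presburger+
  \<comment> \<open>Every admissible trace is 0 or a power of two with positive exponent up to sign.
    Hence \<open>q2 = q1 + 1 - t1\<close> is odd, and the results for odd characteristic
    apply.\<close>
  have "even t1"
    using t half by (auto simp: even_mult_iff)
  then have "odd (int (p2 ^ a2))" using a1 unfolding q by simp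
  then have odd: "odd p2" using a2 by simp
  note ctx = card2 p2 odd a1 a2
  have sign: "e = 1 \<or> e = -1" if "e ^ 2 = 1" for e :: int
    using that by (simp add: power2_eq_1_iff)
  \<comment> \<open>Each of the listed shapes of \<open>q1\<close> forces \<open>a1\<close> to be
    even. The absolute value of \<open>t1\<close> then separates this case from the other
    two.\<close>
  have c1_abs: "even a1 \<and> \<bar>t1\<bar> = 2 ^ (a1 div 2 + 1)" if case1
  proof -
    from that have t1: "real_of_int t1 = 2 powr ((real a1 + 2) / 2) \<or>
        real_of_int t1 = - (2 powr ((real a1 + 2) / 2))"
      and "q1 = 2 ^ 6 \<or> (\<exists>n. q1 = 2 ^ (2 ^ (n + 1))) \<or> (\<exists>m. q1 = 2 ^ (2 * m))"
      unfolding c1 by blast+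
    then have "a1 = 6 \<or> (\<exists>n. a1 = 2 ^ (n + 1)) \<or> (\<exists>m. a1 = 2 * m)"
      using power_two_inj unfolding assms(4) by blast
    then have ea: "even a1" by auto
    from t1 have "real_of_int t1 = real_of_int (2 ^ (a1 div 2 + 1)) \<or>
        real_of_int t1 = real_of_int (- (2 ^ (a1 div 2 + 1)))"
      by (simp only: powr_half_even[OF ea] of_int_minus)
    then have "t1 = 2 ^ (a1 div 2 + 1) \<or> t1 = - (2 ^ (a1 div 2 + 1))"
      by (simp only: of_int_eq_iff)
    then show ?thesis using ea by auto
  qed
  have c2_vals: "a1 = 2 \<and> p2 = 3 \<and> t1 = 2" if case2
  proof -
    from that have "t1 = 2" "2 ^ a1 = (2::nat) ^ 2" "p2 ^ a2 = 3" unfolding c2 using assms(4,5) by simp_all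
    moreover have "p2 = 3"
    proof -
      have "p2 dvd 3" using a2 \<open>p2 ^ a2 = 3\<close> by (metis dvd_power gr0I not_one_le_zero)
      then show ?thesis using primes_dvd_imp_eq[OF p2] by simp
    qed
    ultimately show ?thesis using power_two_inj by blast
  qed
  have c3_abs: "t1 = 0 \<or> odd a1 \<or> even a1 \<and> \<bar>t1\<bar> = 2 ^ (a1 div 2) \<and> p2 \<noteq> 3" if case3
    using that unfolding c3 by auto
  have excl: "\<not> (case1 \<and> case2)" "\<not> (case1 \<and> case3)" "\<not> (case2 \<and> case3)"
  proof -
    show "\<not> (case1 \<and> case2)" using c1_abs c2_vals by auto
    show "\<not> (case1 \<and> case3)" using c1_abs c3_abs by auto
    show "\<not> (case2 \<and> case3)" using c2_vals c3_abs by auto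
  qed
  have main: "case1 \<and> supersingular_classes \<E>2 \<or> case2 \<and> supersingular_classes \<E>2 \<or>
    case3 \<and> ordinary_classes \<E>2"
    using t
  proof (elim disjE exE conjE)
    assume "t1 = 0"
    then have "int (p2 ^ a2) = int (2 ^ a1 + 1)" unfolding q by simp
    then have "p2 ^ a2 = 2 ^ a1 + 1" by (simp only: of_nat_eq_iff)
    moreover have case3 unfolding c3 using \<open>t1 = 0\<close> by (rule disjI1)
    ultimately show ?thesis unfolding E2 using ordinary_trace_zero[OF ctx] by blast
  next
    fix e :: int
    assume e: "e ^ 2 = 1" and o: "odd a1" and te: "t1 = e * 2 ^ ((a1 + 1) div 2)"
    have "t1 = 2 ^ ((a1 + 1) div 2) \<or> t1 = - (2 ^ ((a1 + 1) div 2))"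
      using sign[OF e] unfolding te by auto
    then have case3 unfolding c3 using o by blast
    then show ?thesis unfolding E2 using ordinary_trace_odd[OF ctx o e q[unfolded te]] by blast
  next
    fix e :: int
    assume e: "e ^ 2 = 1" and ea: "even a1" and te: "t1 = e * 2 ^ (a1 div 2)"
    show ?thesis
    \<comment> \<open>The traces of absolute value \<open>2 ^ (a1 div 2)\<close> are shared between
      cases (2) and (3): characteristic 3 leaves \<open>q1 = 4\<close>, \<open>q2 = 3\<close>,
      \<open>t1 = 2\<close> alone, which is case (2).\<close>
    proof (cases "p2 = 3")
      case True
      from trace_even_p_3[OF ctx ea e q[unfolded te] True]
      have v: "a2 = 1" "a1 = 2" "e = 1" .
      then have case2 unfolding c2 assms(4,5) using te True by simp
      moreover have "CARD('k2) = 3" using card2 v True by simp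
      ultimately show ?thesis using supersingular_F3[where 'k = 'k2] E2 v by simp
    next
      case False
      have "t1 = 2 ^ (a1 div 2) \<or> t1 = - (2 ^ (a1 div 2))"
        using sign[OF e] unfolding te by auto
      then have case3 unfolding c3 using ea False by blast
      then show ?thesis unfolding E2 using ordinary_trace_even[OF ctx ea e q[unfolded te] False] by blast
    qed
  next
    fix e :: int
    assume e: "e ^ 2 = 1" and ea: "even a1" and te: "t1 = e * 2 ^ (a1 div 2 + 1)"
    note max = supersingular_trace_max[OF ctx ea e q[unfolded te]]
    have "t1 = 2 ^ (a1 div 2 + 1) \<or> t1 = - (2 ^ (a1 div 2 + 1))"
      using sign[OF e] te by (elim disjE) (simp_all only: mult_1_left mult_minus1 simp_thms)
    then have "real_of_int t1 = 2 powr ((real a1 + 2) / 2) \<or> real_of_int t1 = - (2 powr ((real a1 + 2) / 2))"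
      by (simp only: powr_half_even[OF ea] of_int_minus[symmetric] of_int_eq_iff)
    moreover have "(q1, q2) = (2 ^ 6, 3 ^ 4) \<or>
       (\<exists>n. (q1, q2) = (2 ^ (2 ^ (n + 1)), (2 ^ (2 ^ n) + 1) ^ 2) \<and> p2 = 2 ^ (2 ^ n) + 1) \<or>
       (\<exists>m. (q1, q2) = (2 ^ (2 * m), (2 ^ m - 1) ^ 2) \<and> p2 = 2 ^ m - 1)"
      using max(2) unfolding assms(4,5) by (elim disjE exE conjE) simp_all
    ultimately have case1 unfolding c1 by (rule conjI)
    then show ?thesis unfolding E2 using max(1) by blast
  qed
  then show ?thesis using excl by blast
qed

end
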